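(* Let $X$ and $Y$ be complex manifolds. (i) If $X$ is strongly dominable by LSAP manifolds, then $X$ is an LSAP manifold. In particular, if $Z$ is an LSAP manifold and $Z\to X$ is a surjective holomorphic submersion, then $X$ is an LSAP manifold. (ii) If $h:X\to Y$ is a surjective Oka map and $Y$ is an LSAP manifold, then $X$ is an LSAP manifold. (iii) LSAP is a Hausdorff-local property, that is, if a complex manifold $X$ is covered by sets that are open in the Hausdorff (manifold) topology and satisfy LSAP, then $X$ satisfies LSAP.
   Context: Special pair: a pair of compact topological discs $D\subset D'\subset\mathbb{C}$ is a special pair if both discs have piecewise smooth boundaries and $D'\setminus\mathring{D}$ is a disc attached to $D$ along an arc in the boundary $bD$. Let $\mathbb{B}^N$ be the open unit ball in $\mathbb{C}^N$. A holomorphic spray of maps $D\to X$ is a holomorphic map $F:D\times\mathbb{B}^N\to X$ (maps holomorphic on a compact set are understood to be holomorphic on an unspecified open neighbourhood; here, over a neighbourhood of $D$). LSAP (local spray approximation property): a complex manifold $X$ has LSAP at a point $x\in X$ if there is a neighbourhood $V\subset X$ of $x$ such that, given any special pair of compact discs $D\subset D'\subset\mathbb{C}$ and any holomorphic spray $F:D\times\mathbb{B}^N\to V$, there is a number $r=r(F)\in(0,1)$ such that $F$ can be approximated uniformly on $D\times r\overline{\mathbb{B}}^N$ by holomorphic sprays $D'\times r\overline{\mathbb{B}}^N\to X$. The manifold $X$ has LSAP, or is an LSAP manifold, if this holds for every $x\in X$. $X$ is strongly dominable by LSAP manifolds if for every point $x\in X$ there exist an LSAP manifold $Y$ (possibly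 depending on $x$), a holomorphic map $h:Y\to X$, and a point $y\in Y$ such that $h(y)=x$ and $dh_y:T_yY\to T_xX$ is surjective. Oka map: a holomorphic map $h:X\to Y$ of complex manifolds is an Oka map if it is a Serre fibration and satisfies the parametric Oka property with approximation and interpolation for liftings, namely: given a Stein manifold (or reduced Stein space) $S$, a compact $\mathscr{O}(S)$-convex set $K\subset S$, a closed complex subvariety $S'\subset S$, compact sets $P_0\subset P$ in a Euclidean space, a continuous map $g:P\times S\to Y$ with $g(p,\cdot)$ holomorphic on $S$ for every $p\in P$, and a continuous lifting $f_0:P\times S\to X$ of $g$ (i.e. $h\circ f_0=g$) such that $f_0(p,\cdot)$ is holomorphic on a fixed neighbourhood of $K$ and on $S'$ for all $p\in P$ and is holomorphic on $S$ for all $p\in P_0$, there is a homotopy of continuous liftings $f_t:P\times S\to X$ of $g$, $t\in[0,1]$, starting at $f_0$, fixed on $(P_0\times S)\cup(P\times S')$, with $f_t(p,\cdot)$ holomorphic near $K$ and as close as desired to $f_0$ on $P\times K$ for all $t$, and with $f_1(p,\cdot)$ holomorphic on $S$ for every $p\in P$. *)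

theory Defs
  imports "HOL-Analysis.Analysis"
begin

section \<open>Holomorphic functions on open subsets of C^n\<close>

text \<open>
  Dimensions have to be quantified over inside definitions (sprays, Stein manifolds), so C^n is
  rendered as a set of sequences supported on the first \<open>n\<close> indices, in the style of the library's
  \<^const>\<open>Euclidean_space\<close>. The topology it inherits from the product topology on
  \<^typ>\<open>nat \<Rightarrow> complex\<close> is the usual one.
\<close>

definition cspace :: "nat \<Rightarrow> (nat \<Rightarrow> complex) set" where
  "cspace n = {z. \<forall>i\<ge>n. z i = 0}"

definition cnorm :: "nat \<Rightarrow> (nat \<Rightarrow> complex) \<Rightarrow> real" where
  "cnorm n z = L2_set (\<lambda>i. cmod (z i)) {..<n}"

definition cspace_ball :: "nat \<Rightarrow> real \<Rightarrow> (nat \<Rightarrow> complex) set" where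
  "cspace_ball n r = {z \<in> cspace n. cnorm n z < r}"

definition cspace_cball :: "nat \<Rightarrow> real \<Rightarrow> (nat \<Rightarrow> complex) set" where
  "cspace_cball n r = {z \<in> cspace n. cnorm n z \<le> r}"

text \<open>
  \<open>has_complex_gradient n f a z\<close>: the function \<open>f\<close>, defined near the point \<open>z\<close> of C^n, is complex
  (Frechet) differentiable at \<open>z\<close>, its differential being the complex linear form
  \<open>v \<mapsto> \<Sum>j<n. a j * v j\<close>.
\<close>

definition has_complex_gradient ::
    "nat \<Rightarrow> ((nat \<Rightarrow> complex) \<Rightarrow> complex) \<Rightarrow> (nat \<Rightarrow> complex) \<Rightarrow> (nat \<Rightarrow> complex) \<Rightarrow> bool" where
  "has_complex_gradient n f a z \<longleftrightarrow>
     ((\<lambda>w. (f w - f z - (\<Sum>j<n. a j * (w j - z j))) / of_real (cnorm n (\<lambda>j. w j - z j)))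
        \<longlongrightarrow> 0) (at z within cspace n)"


section \<open>Complex manifolds\<close>

text \<open>
  A chart is a triple \<open>(n, U, \<phi>)\<close>: a homeomorphism \<open>\<phi>\<close> from the open set \<open>U\<close> onto an open subset of
  C^n. Its inverse is \<open>inv_into U \<phi>\<close>. The atlas need not be maximal; all notions below depend only
  on the complex structure it generates. The dimension is attached to the charts, so connected
  components may have different dimensions.
\<close>

type_synonym 'a chart = "nat \<times> 'a set \<times> ('a \<Rightarrow> nat \<Rightarrow> complex)"

record 'a charted_space =
  mtop :: "'a topology"
  charts :: "'a chart set"

abbreviation points :: "'a charted_space \<Rightarrow> 'a set" where
  "points M \<equiv> topspace (mtop M)"

definition holomorphic_function_on ::
    "'a charted_space \<Rightarrow> 'a set \<Rightarrow> ('a \<Rightarrow> complex) \<Rightarrow> bool" where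
  "holomorphic_function_on M W f \<longleftrightarrow>
     openin (mtop M) W \<and>
     (\<forall>(n, U, \<phi>) \<in> charts M. \<forall>x \<in> W \<inter> U.
        \<exists>a. has_complex_gradient n (\<lambda>z. f (inv_into U \<phi> z)) a (\<phi> x))"

definition complex_manifold :: "'a charted_space \<Rightarrow> bool" where
  "complex_manifold M \<longleftrightarrow>
     Hausdorff_space (mtop M) \<and> second_countable (mtop M) \<and>
     (\<Union>(n, U, \<phi>) \<in> charts M. U) = points M \<and>
     (\<forall>(n, U, \<phi>) \<in> charts M.
        openin (mtop M) U \<and> openin (top_of_set (cspace n)) (\<phi> ` U) \<and>
        homeomorphic_map (subtopology (mtop M) U) (top_of_set (\<phi> ` U)) \<phi>) \<and>
     (\<forall>(n, U, \<phi>) \<in> charts M. \<forall>(m, V, \<psi>) \<in> charts M. \<forall>i<m.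
        holomorphic_function_on M (U \<inter> V) (\<lambda>x. \<psi> x i))"

text \<open>
  In the last clause the charts of \<open>M\<close> through which holomorphy is tested include \<open>(n, U, \<phi>)\<close>, so it
  says in particular that \<open>\<psi> \<circ> \<phi>\<^sup>-\<^sup>1\<close> is holomorphic on \<open>\<phi> ` (U \<inter> V)\<close>.
\<close>

definition holomorphic_map_on ::
    "'a charted_space \<Rightarrow> 'a set \<Rightarrow> 'b charted_space \<Rightarrow> ('a \<Rightarrow> 'b) \<Rightarrow> bool" where
  "holomorphic_map_on M W N f \<longleftrightarrow>
     openin (mtop M) W \<and> continuous_map (subtopology (mtop M) W) (mtop N) f \<and>
     (\<forall>(m, V, \<psi>) \<in> charts N. \<forall>i<m.
        holomorphic_function_on M {x \<in> W. f x \<in> V} (\<lambda>x. \<psi> (f x) i))"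

abbreviation holomorphic_map ::
    "'a charted_space \<Rightarrow> 'b charted_space \<Rightarrow> ('a \<Rightarrow> 'b) \<Rightarrow> bool" where
  "holomorphic_map M N f \<equiv> holomorphic_map_on M (points M) N f"

definition holomorphic_near ::
    "'a charted_space \<Rightarrow> 'a set \<Rightarrow> 'b charted_space \<Rightarrow> ('a \<Rightarrow> 'b) \<Rightarrow> bool" where
  "holomorphic_near M K N f \<longleftrightarrow> (\<exists>W. K \<subseteq> W \<and> holomorphic_map_on M W N f)"

definition cspace_manifold :: "nat \<Rightarrow> (nat \<Rightarrow> complex) charted_space" where
  "cspace_manifold n = \<lparr>mtop = top_of_set (cspace n), charts = {(n, cspace n, \<lambda>z. z)}\<rparr>"

definition open_submanifold :: "'a charted_space \<Rightarrow> 'a set \<Rightarrow> 'a charted_space" where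
  "open_submanifold M W =
     \<lparr>mtop = subtopology (mtop M) W, charts = (\<lambda>(n, U, \<phi>). (n, U \<inter> W, \<phi>)) ` charts M\<rparr>"

text \<open>
  Surjectivity of the differential at \<open>x\<close>, the tangent spaces at \<open>x\<close> and \<open>f x\<close> being identified with
  C^n and C^m by charts; \<open>A\<close> is the complex Jacobian matrix of \<open>f\<close> in these charts.
\<close>

definition surjective_differential_at ::
    "'a charted_space \<Rightarrow> 'b charted_space \<Rightarrow> ('a \<Rightarrow> 'b) \<Rightarrow> 'a \<Rightarrow> bool" where
  "surjective_differential_at M N f x \<longleftrightarrow>
     (\<forall>(n, U, \<phi>) \<in> charts M. \<forall>(m, V, \<psi>) \<in> charts N. x \<in> U \<and> f x \<in> V \<longrightarrow>
        (\<exists>A. (\<forall>i<m. has_complex_gradient n (\<lambda>z. \<psi> (f (inv_into U \<phi> z)) i) (A i) (\<phi> x)) \<and>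
             (\<forall>v \<in> cspace m. \<exists>u \<in> cspace n. \<forall>i<m. (\<Sum>j<n. A i j * u j) = v i)))"

definition holomorphic_submersion ::
    "'a charted_space \<Rightarrow> 'b charted_space \<Rightarrow> ('a \<Rightarrow> 'b) \<Rightarrow> bool" where
  "holomorphic_submersion M N f \<longleftrightarrow>
     holomorphic_map M N f \<and> (\<forall>x \<in> points M. surjective_differential_at M N f x)"

text \<open>
  Manifolds carry no preferred metric. Uniform approximation, which here only takes place on compact
  sets, is required with respect to every metric inducing the manifold topology; on compact sets all
  these metrics give the same notion.
\<close>

definition metric_of :: "'a topology \<Rightarrow> ('a \<Rightarrow> 'a \<Rightarrow> real) \<Rightarrow> bool" where
  "metric_of T d \<longleftrightarrow>
     Metric_space (topspace T) d \<and> Metric_space.mtopology (topspace T) d = T"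


section \<open>The local spray approximation property\<close>

text \<open>
  Smooth means C-infinity up to the endpoints, with nowhere vanishing (one-sided) derivative;
  \<open>g k\<close> is the \<open>k\<close>-th derivative.
\<close>

definition smooth_arc_on :: "real \<Rightarrow> real \<Rightarrow> (real \<Rightarrow> complex) \<Rightarrow> bool" where
  "smooth_arc_on a b \<gamma> \<longleftrightarrow>
     (\<exists>g :: nat \<Rightarrow> real \<Rightarrow> complex.
        (\<forall>t \<in> {a..b}. g 0 t = \<gamma> t \<and> g 1 t \<noteq> 0) \<and>
        (\<forall>k. \<forall>t \<in> {a..b}. (g k has_vector_derivative g (Suc k) t) (at t within {a..b})))"

definition piecewise_smooth_boundary :: "complex set \<Rightarrow> bool" where
  "piecewise_smooth_boundary D \<longleftrightarrow>
     (\<exists>\<gamma> (\<tau> :: nat \<Rightarrow> real) n.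
        simple_path \<gamma> \<and> pathfinish \<gamma> = pathstart \<gamma> \<and> path_image \<gamma> = frontier D \<and>
        \<tau> 0 = 0 \<and> \<tau> n = 1 \<and>
        (\<forall>i<n. \<tau> i < \<tau> (Suc i) \<and> smooth_arc_on (\<tau> i) (\<tau> (Suc i)) \<gamma>))"

definition closed_disc :: "complex set \<Rightarrow> bool" where
  "closed_disc D \<longleftrightarrow> D homeomorphic (cball 0 1 :: complex set)"

text \<open>
  The attached piece is \<open>D'\<close> minus the interior of \<open>D\<close> relative to \<open>D'\<close>, that is,
  \<open>closure (D' - D)\<close>. With the interior of \<open>D\<close> in the plane the difference would contain the whole
  boundary circle of \<open>D\<close> and could never be a disc.
\<close>

definition special_pair :: "complex set \<Rightarrow> complex set \<Rightarrow> bool" where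
  "special_pair D D' \<longleftrightarrow>
     D \<subseteq> D' \<and> closed_disc D \<and> closed_disc D' \<and>
     piecewise_smooth_boundary D \<and> piecewise_smooth_boundary D' \<and>
     closed_disc (closure (D' - D)) \<and>
     (\<exists>\<alpha>. arc \<alpha> \<and> path_image \<alpha> \<subseteq> frontier D \<and> D \<inter> closure (D' - D) = path_image \<alpha>)"

text \<open>
  The product of a subset of C and a subset of C^N as a subset of C^(1+N): the coordinate \<open>u 0\<close> is
  the point of C and the shifted sequence is the point of C^N.
\<close>

definition cprod :: "complex set \<Rightarrow> (nat \<Rightarrow> complex) set \<Rightarrow> (nat \<Rightarrow> complex) set" where
  "cprod A B = {u. u 0 \<in> A \<and> (\<lambda>i. u (Suc i)) \<in> B}"

definition holomorphic_spray ::
    "complex set \<Rightarrow> nat \<Rightarrow> 'a charted_space \<Rightarrow> ((nat \<Rightarrow> complex) \<Rightarrow> 'a) \<Rightarrow> bool" where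
  "holomorphic_spray D N M F \<longleftrightarrow>
     (\<exists>\<Omega>. open \<Omega> \<and> D \<subseteq> \<Omega> \<and>
        holomorphic_map_on (cspace_manifold (Suc N)) (cprod \<Omega> (cspace_ball N 1)) M F)"

definition LSAP_at :: "'a charted_space \<Rightarrow> 'a \<Rightarrow> bool" where
  "LSAP_at X x \<longleftrightarrow>
     (\<exists>V. openin (mtop X) V \<and> x \<in> V \<and>
        (\<forall>D D' N F. special_pair D D' \<and> holomorphic_spray D N (open_submanifold X V) F \<longrightarrow>
           (\<exists>r. 0 < r \<and> r < 1 \<and>
              (\<forall>d \<epsilon>. metric_of (mtop X) d \<and> 0 < \<epsilon> \<longrightarrow>
                 (\<exists>G. holomorphic_near (cspace_manifold (Suc N)) (cprod D' (cspace_cball N r)) X G \<and>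
                      (\<forall>u \<in> cprod D (cspace_cball N r). d (F u) (G u) < \<epsilon>))))))"

definition LSAP_manifold :: "'a charted_space \<Rightarrow> bool" where
  "LSAP_manifold X \<longleftrightarrow> complex_manifold X \<and> (\<forall>x \<in> points X. LSAP_at X x)"

text \<open>
  HOL cannot quantify existentially over the type carrying the dominating manifolds, so it is a
  parameter. As complex manifolds are second countable, they have at most the cardinality of the
  continuum, and taking for \<^typ>\<open>'b\<close> any type of that cardinality captures all of them at once.
\<close>

definition strongly_dominable_by_LSAP :: "'b itself \<Rightarrow> 'a charted_space \<Rightarrow> bool" where
  "strongly_dominable_by_LSAP (_ :: 'b itself) X \<longleftrightarrow>
     (\<forall>x \<in> points X. \<exists>(Y :: 'b charted_space) h y.
        LSAP_manifold Y \<and> holomorphic_map Y X h \<and>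
        y \<in> points Y \<and> h y = x \<and> surjective_differential_at Y X h y)"


section \<open>Stein manifolds\<close>

definition holomorphic_hull :: "'a charted_space \<Rightarrow> 'a set \<Rightarrow> 'a set" where
  "holomorphic_hull S K =
     {x \<in> points S. \<forall>f B. holomorphic_function_on S (points S) f \<and> (\<forall>y \<in> K. cmod (f y) \<le> B)
        \<longrightarrow> cmod (f x) \<le> B}"

definition stein_manifold :: "'a charted_space \<Rightarrow> bool" where
  "stein_manifold S \<longleftrightarrow>
     complex_manifold S \<and>
     (\<forall>x \<in> points S. \<forall>y \<in> points S. x \<noteq> y \<longrightarrow>
        (\<exists>f. holomorphic_function_on S (points S) f \<and> f x \<noteq> f y)) \<and>
     (\<forall>(n, U, \<phi>) \<in> charts S. \<forall>x \<in> U.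
        \<exists>f. holomorphic_map S (cspace_manifold n) f \<and>
            surjective_differential_at S (cspace_manifold n) f x) \<and>
     (\<forall>K. compactin (mtop S) K \<longrightarrow> compactin (mtop S) (holomorphic_hull S K))"

definition complex_subvariety :: "'a charted_space \<Rightarrow> 'a set \<Rightarrow> bool" where
  "complex_subvariety S Z \<longleftrightarrow>
     closedin (mtop S) Z \<and>
     (\<forall>x \<in> Z. \<exists>U \<F>. openin (mtop S) U \<and> x \<in> U \<and> finite \<F> \<and>
        (\<forall>f \<in> \<F>. holomorphic_function_on S U f) \<and> Z \<inter> U = {y \<in> U. \<forall>f \<in> \<F>. f y = 0})"

text \<open>
  A map on a subvariety is holomorphic if locally it extends to a holomorphic map on an open subset
  of the ambient manifold.
\<close>

definition holomorphic_on_subvariety ::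
    "'a charted_space \<Rightarrow> 'a set \<Rightarrow> 'b charted_space \<Rightarrow> ('a \<Rightarrow> 'b) \<Rightarrow> bool" where
  "holomorphic_on_subvariety S Z M f \<longleftrightarrow>
     (\<forall>x \<in> Z. \<exists>U g. x \<in> U \<and> holomorphic_map_on S U M g \<and> (\<forall>y \<in> Z \<inter> U. g y = f y))"


section \<open>Oka maps\<close>

definition unit_cube :: "nat \<Rightarrow> (nat \<Rightarrow> real) topology" where
  "unit_cube k = subtopology (Euclidean_space k) {x. \<forall>i<k. 0 \<le> x i \<and> x i \<le> 1}"

definition serre_fibration :: "'a topology \<Rightarrow> 'b topology \<Rightarrow> ('a \<Rightarrow> 'b) \<Rightarrow> bool" where
  "serre_fibration E B h \<longleftrightarrow>
     continuous_map E B h \<and>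
     (\<forall>k H f.
        continuous_map (prod_topology (unit_cube k) (top_of_set {0..1 :: real})) B H \<and>
        continuous_map (unit_cube k) E f \<and>
        (\<forall>x \<in> topspace (unit_cube k). h (f x) = H (x, 0)) \<longrightarrow>
        (\<exists>L. continuous_map (prod_topology (unit_cube k) (top_of_set {0..1 :: real})) E L \<and>
             (\<forall>x \<in> topspace (unit_cube k). L (x, 0) = f x) \<and>
             (\<forall>x \<in> topspace (unit_cube k). \<forall>t \<in> {0..1}. h (L (x, t)) = H (x, t))))"

definition lifting ::
    "'p topology \<Rightarrow> 's topology \<Rightarrow> 'a topology \<Rightarrow> ('a \<Rightarrow> 'b) \<Rightarrow>
     ('p \<Rightarrow> 's \<Rightarrow> 'b) \<Rightarrow> ('p \<Rightarrow> 's \<Rightarrow> 'a) \<Rightarrow> bool" where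
  "lifting P S E h g f \<longleftrightarrow>
     continuous_map (prod_topology P S) E (\<lambda>(p, s). f p s) \<and>
     (\<forall>p \<in> topspace P. \<forall>s \<in> topspace S. h (f p s) = g p s)"

text \<open>
  The parametric Oka property with approximation and interpolation for liftings, with Stein manifolds
  (rather than reduced Stein spaces) as sources. Every Stein manifold
  is second countable and so has, up to biholomorphism, a copy carried by a subset of
  \<^typ>\<open>nat \<Rightarrow> complex\<close> (with a topology and an atlas of its own); quantifying over these is no
  restriction.
\<close>

definition parametric_oka_property ::
    "'a charted_space \<Rightarrow> 'b charted_space \<Rightarrow> ('a \<Rightarrow> 'b) \<Rightarrow> bool" where
  "parametric_oka_property X Y h \<longleftrightarrow>
     (\<forall>(S :: (nat \<Rightarrow> complex) charted_space) K S' k P\<^sub>0 P g f\<^sub>0 d \<epsilon>.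
        stein_manifold S \<and>
        compactin (mtop S) K \<and> holomorphic_hull S K = K \<and>
        complex_subvariety S S' \<and>
        P\<^sub>0 \<subseteq> P \<and> compactin (Euclidean_space k) P\<^sub>0 \<and> compactin (Euclidean_space k) P \<and>
        continuous_map (prod_topology (subtopology (Euclidean_space k) P) (mtop S)) (mtop Y)
          (\<lambda>(p, s). g p s) \<and>
        (\<forall>p \<in> P. holomorphic_map S Y (g p)) \<and>
        lifting (subtopology (Euclidean_space k) P) (mtop S) (mtop X) h g f\<^sub>0 \<and>
        (\<exists>W. K \<subseteq> W \<and> (\<forall>p \<in> P. holomorphic_map_on S W X (f\<^sub>0 p))) \<and>
        (\<forall>p \<in> P. holomorphic_on_subvariety S S' X (f\<^sub>0 p)) \<and>
        (\<forall>p \<in> P\<^sub>0. holomorphic_map S X (f\<^sub>0 p)) \<and>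
        metric_of (mtop X) d \<and> 0 < \<epsilon> \<longrightarrow>
        (\<exists>f :: real \<Rightarrow> (nat \<Rightarrow> real) \<Rightarrow> (nat \<Rightarrow> complex) \<Rightarrow> 'a.
           continuous_map
             (prod_topology (top_of_set {0..1})
                (prod_topology (subtopology (Euclidean_space k) P) (mtop S)))
             (mtop X) (\<lambda>(t, p, s). f t p s) \<and>
           (\<forall>t \<in> {0..1}. lifting (subtopology (Euclidean_space k) P) (mtop S) (mtop X) h g (f t)) \<and>
           (\<forall>p \<in> P. \<forall>s \<in> points S. f 0 p s = f\<^sub>0 p s) \<and>
           (\<forall>t \<in> {0..1}. \<forall>p \<in> P. \<forall>s \<in> points S. p \<in> P\<^sub>0 \<or> s \<in> S' \<longrightarrow> f t p s = f\<^sub>0 p s) \<and>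
           (\<forall>t \<in> {0..1}. \<forall>p \<in> P. holomorphic_near S K X (f t p)) \<and>
           (\<forall>t \<in> {0..1}. \<forall>p \<in> P. \<forall>s \<in> K. d (f t p s) (f\<^sub>0 p s) < \<epsilon>) \<and>
           (\<forall>p \<in> P. holomorphic_map S X (f 1 p))))"

definition oka_map :: "'a charted_space \<Rightarrow> 'b charted_space \<Rightarrow> ('a \<Rightarrow> 'b) \<Rightarrow> bool" where
  "oka_map X Y h \<longleftrightarrow>
     holomorphic_map X Y h \<and> serre_fibration (mtop X) (mtop Y) h \<and> parametric_oka_property X Y h"

end

theory Submission
  imports Defs "HOL-Complex_Analysis.Complex_Analysis"
begin

text \<open>
  A holomorphic map whose differential at a point is surjective has a holomorphic local section there.
  A spray near the image point is moved by the section into the dominating LSAP manifold, approximated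
  there, and mapped back; this gives (i). Part (iii) is the case of an inclusion.

  For (ii), an Oka map is first seen to be a submersion: over a ball the Serre property gives a
  continuous section through a given point, which the Oka property with interpolation makes
  holomorphic. Now let \<open>F\<close> be a spray of small image and \<open>G\<close> an approximation of \<open>h \<circ> F\<close> over \<open>D'\<close>. The
  local form of \<open>h\<close> lifts \<open>G\<close> to a spray over \<open>D\<close> close to \<open>F\<close>, and the lifting extends continuously to
  a neighbourhood of \<open>D'\<close> because \<open>D\<close> is a deformation retract of \<open>D'\<close>. The product of a plane
  neighbourhood of \<open>D'\<close> and a ball is Stein, and \<open>D\<close> times a smaller closed ball is holomorphically convex
  in it, as the complement of \<open>D\<close> is connected; so the Oka property with approximation applies.
\<close>

section \<open>The norm topology of C^n and complex gradients\<close>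

text \<open>Three obstacles shape the proof. Holomorphy means differentiability at each point, with
  no continuity of the derivative given, so the implicit function theorem starts from Cauchy
  estimates on complex lines: they give the remainder a small Lipschitz constant. Second, LSAP
  demands approximation in every metric of the target, with \<open>r\<close> fixed before metric and
  error. Using LSAP of \<open>Y\<close> thus requires some metric on \<open>Y\<close>, whence
  metrization; closeness in \<open>Y\<close> is carried to \<open>X\<close> by an open condition on
  pairs \<open>(u, b)\<close> around a compact graph, and the radius of the transported spray is
  kept. Third, the Oka property deforms only exact liftings, and an approximation \<open>G\<close>
  of \<open>h \<circ> F\<close> is not lifted by \<open>F\<close>. This is why the local form of a
  submersion is a map of two arguments: \<open>T a b\<close> moves \<open>a\<close> into the fibre
  over \<open>b\<close> and fixes \<open>a\<close> if it already lies there, so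
  \<open>T (F u) (G u)\<close> lifts \<open>G\<close> and is close to \<open>F\<close>. Fixing the
  first argument gives the section for (i). Serre lifting is given on cubes only, so the homotopies
  are defined on a whole box by clipping and radial retraction.\<close>

abbreviation cdist :: "nat \<Rightarrow> (nat \<Rightarrow> complex) \<Rightarrow> (nat \<Rightarrow> complex) \<Rightarrow> real" where
  "cdist n w z \<equiv> cnorm n (\<lambda>j. w j - z j)"

lemma cnorm_nonneg [simp]: "0 \<le> cnorm n z"
  by (simp add: cnorm_def)

lemma cnorm_zero [simp]: "cnorm n (\<lambda>_. 0) = 0"
  by (simp add: cnorm_def L2_set_def)

lemma cnorm_cong: "(\<And>i. i < n \<Longrightarrow> x i = y i) \<Longrightarrow> cnorm n x = cnorm n y"
  unfolding cnorm_def by (rule L2_set_cong) auto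

lemma component_le_cnorm: "i < n \<Longrightarrow> cmod (z i) \<le> cnorm n z"
  unfolding cnorm_def by (rule member_le_L2_set) auto

lemma cnorm_le_sum: "cnorm n z \<le> (\<Sum>i<n. cmod (z i))"
  unfolding cnorm_def by (rule L2_set_le_sum) auto

lemma cnorm_triangle: "cnorm n (\<lambda>i. x i + y i) \<le> cnorm n x + cnorm n y"
proof -
  have "cnorm n (\<lambda>i. x i + y i) \<le> L2_set (\<lambda>i. cmod (x i) + cmod (y i)) {..<n}"
    unfolding cnorm_def by (rule L2_set_mono) (auto intro: norm_triangle_ineq)
  also have "\<dots> \<le> cnorm n x + cnorm n y"
    unfolding cnorm_def by (rule L2_set_triangle_ineq)
  finally show ?thesis .
qed

lemma cnorm_minus: "cnorm n (\<lambda>i. - x i) = cnorm n x"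
  by (simp add: cnorm_def)

lemma cdist_commute: "cdist n x y = cdist n y x"
  by (simp add: cnorm_def norm_minus_commute)

lemma cdist_triangle: "cdist n x z \<le> cdist n x y + cdist n y z"
  using cnorm_triangle[of n "\<lambda>i. x i - y i" "\<lambda>i. y i - z i"] by simp

lemma cnorm_scale: "cnorm n (\<lambda>i. c * x i) = cmod c * cnorm n x"
  unfolding cnorm_def by (simp add: norm_mult L2_set_right_distrib)

lemma cnorm_triangle_diff: "cnorm n x \<le> cdist n x y + cnorm n y"
  using cnorm_triangle[of n "\<lambda>i. x i - y i" y] by simp

lemma cnorm_eq_0_iff: "cnorm n x = 0 \<longleftrightarrow> (\<forall>i<n. x i = 0)"
  unfolding cnorm_def by (subst L2_set_eq_0_iff) auto

lemma cdist_eq_0_iff: "x \<in> cspace n \<Longrightarrow> y \<in> cspace n \<Longrightarrow> cdist n x y = 0 \<longleftrightarrow> x = y"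
  unfolding cnorm_eq_0_iff cspace_def fun_eq_iff by (simp, metis linorder_not_le)

lemma cmod_linear_form_le: "cmod (\<Sum>j<n. a j * v j) \<le> cnorm n a * cnorm n v"
proof -
  have "cmod (\<Sum>j<n. a j * v j) \<le> (\<Sum>j<n. cmod (a j) * cmod (v j))"
    by (rule order_trans[OF norm_sum]) (simp add: norm_mult)
  also have "\<dots> \<le> cnorm n a * cnorm n v"
    unfolding cnorm_def using L2_set_mult_ineq[of "\<lambda>i. cmod (a i)" "\<lambda>i. cmod (v i)" "{..<n}"] by simp
  finally show ?thesis .
qed

lemma continuous_on_coordinate: "continuous_on S (\<lambda>z::nat\<Rightarrow>'b::topological_space. z i)"
  by (rule continuous_on_product_then_coordinatewise) (rule continuous_on_id)

lemma continuous_on_cnorm: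
  assumes "\<And>i. continuous_on S (\<lambda>x. f x i)"
  shows "continuous_on S (\<lambda>x. cnorm n (f x))"
  unfolding cnorm_def L2_set_def by (intro continuous_intros assms)

text \<open>For \<open>i >= n\<close> the coordinates of \<open>w\<close> and \<open>z\<close> both
  vanish, so only the finitely many coordinates below \<open>n\<close> restrict \<open>w\<close>,
  and each of them is dominated by the norm.\<close>

lemma cspace_nhds_subset:
  assumes U: "open U" and z: "z \<in> U" "z \<in> cspace n"
  shows "\<exists>\<delta>>0. \<forall>w\<in>cspace n. cdist n w z < \<delta> \<longrightarrow> w \<in> U"
proof -
  obtain X where X: "z \<in> Pi\<^sub>E UNIV X" "\<And>i. open (X i)" "finite {i. X i \<noteq> UNIV}" "Pi\<^sub>E UNIV X \<subseteq> U"
    using product_topology_open_contains_basis[of "\<lambda>i. euclidean" UNIV U z] U z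
    by (auto simp: euclidean_product_topology)
  have "\<exists>d>0. \<forall>y. dist y (z i) < d \<longrightarrow> y \<in> X i" for i
    using X(1,2) by (auto simp: open_dist PiE_def Pi_def)
  then obtain d where d: "\<And>i. d i > 0" "\<And>i y. dist y (z i) < d i \<Longrightarrow> y \<in> X i" by metis
  \<comment> \<open>The \<open>1\<close> keeps the set nonempty when \<open>n = 0\<close>.\<close>
  define \<delta> where "\<delta> = Min (insert 1 (d ` {..<n}))"
  have \<delta>: "\<delta> > 0" "\<And>i. i < n \<Longrightarrow> \<delta> \<le> d i"
    unfolding \<delta>_def using d(1) by auto
  have "w \<in> U" if w: "w \<in> cspace n" "cdist n w z < \<delta>" for w
  proof -
    have "w i \<in> X i" for i
    proof (cases "i < n")
      case True
      then have "dist (w i) (z i) < d i"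
        using component_le_cnorm[OF True, of "\<lambda>j. w j - z j"] \<delta>(2)[OF True] w(2) by (simp add: dist_norm)
      then show ?thesis by (rule d(2))
    next
      case False
      then have "w i = z i" using w z by (simp add: cspace_def)
      then show ?thesis using X(1) by auto
    qed
    then show ?thesis using X(4) by auto
  qed
  then show ?thesis using \<delta>(1) by blast
qed

lemma open_cdist_ball: "open {w. cdist n w z < \<delta>}"
proof -
  have "continuous_on UNIV (\<lambda>w. cdist n w z)"
    by (intro continuous_on_cnorm continuous_intros continuous_on_coordinate)
  then show ?thesis by (intro open_Collect_less) auto
qed

text \<open>This makes the topology inherited from the infinite product usable: openness is tested
  with norm balls, on which all later estimates are made.\<close>

lemma openin_cspace_iff:
  "openin (top_of_set (cspace n)) W \<longleftrightarrow>
     W \<subseteq> cspace n \<and> (\<forall>z\<in>W. \<exists>\<delta>>0. \<forall>w\<in>cspace n. cdist n w z < \<delta> \<longrightarrow> w \<in> W)" (is "?L \<longleftrightarrow> ?R")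
proof
  assume ?L
  then obtain U where U: "open U" "W = cspace n \<inter> U" by (auto simp: openin_open)
  show ?R
  proof (intro conjI ballI)
    fix z assume "z \<in> W"
    then show "\<exists>\<delta>>0. \<forall>w\<in>cspace n. cdist n w z < \<delta> \<longrightarrow> w \<in> W"
      using cspace_nhds_subset[OF U(1), of z n] U(2) by auto
  qed (use U in auto)
next
  assume R: ?R
  have "\<exists>T. openin (top_of_set (cspace n)) T \<and> z \<in> T \<and> T \<subseteq> W" if zW: "z \<in> W" for z
  proof -
    obtain \<delta> where \<delta>: "\<delta> > 0" "\<And>w. w \<in> cspace n \<Longrightarrow> cdist n w z < \<delta> \<Longrightarrow> w \<in> W"
      using bspec[OF conjunct2[OF R] zW] by metis
    have "openin (top_of_set (cspace n)) (cspace n \<inter> {w. cdist n w z < \<delta>})"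
      using open_cdist_ball by blast
    moreover have "z \<in> cspace n \<inter> {w. cdist n w z < \<delta>}" "cspace n \<inter> {w. cdist n w z < \<delta>} \<subseteq> W"
      using \<delta> R that by auto
    ultimately show ?thesis by (intro exI conjI)
  qed
  then show ?L by (subst openin_subopen) simp
qed

section \<open>Complex gradients in epsilon-delta form and the chain rule\<close>

lemma eventually_at_cspace:
  assumes "z \<in> cspace n"
  shows "eventually P (at z within cspace n) \<longleftrightarrow>
    (\<exists>\<delta>>0. \<forall>w\<in>cspace n. w \<noteq> z \<and> cdist n w z < \<delta> \<longrightarrow> P w)" (is "?L \<longleftrightarrow> ?R")
proof
  assume ?L
  then obtain U where "open U" "z \<in> U" "\<forall>w\<in>U. w \<noteq> z \<longrightarrow> w \<in> cspace n \<longrightarrow> P w"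
    unfolding eventually_at_topological by blast
  then show ?R using cspace_nhds_subset[OF _ _ assms] by (metis)
next
  assume ?R
  then obtain \<delta> where "\<delta> > 0" "\<forall>w\<in>cspace n. w \<noteq> z \<and> cdist n w z < \<delta> \<longrightarrow> P w" by blast
  then show ?L unfolding eventually_at_topological
    by (intro exI[of _ "{w. cdist n w z < \<delta>}"]) (auto simp: open_cdist_ball)
qed

text \<open>Clearing the denominator removes the quotient at \<open>w = z\<close>, so the estimate
  may include the centre and be non-strict. Strictness is regained by using the estimate with
  \<open>e/2\<close>.\<close>

lemma has_complex_gradient_iff:
  assumes z: "z \<in> cspace n"
  shows "has_complex_gradient n f a z \<longleftrightarrow>
    (\<forall>e>0. \<exists>\<delta>>0. \<forall>w\<in>cspace n. cdist n w z < \<delta> \<longrightarrow>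
       cmod (f w - f z - (\<Sum>j<n. a j * (w j - z j))) \<le> e * cdist n w z)" (is "_ \<longleftrightarrow> ?R")
proof -
  have *: "dist (x / of_real c) 0 < e \<longleftrightarrow> cmod x < e * c" if "c > 0" for x c e
    using that by (simp add: norm_divide field_simps)
  have pos: "cdist n w z > 0" if "w \<in> cspace n" "w \<noteq> z" for w
    using that cdist_eq_0_iff[OF that(1) z] by (metis cnorm_nonneg order_le_less)
  have "has_complex_gradient n f a z \<longleftrightarrow>
    (\<forall>e>0. \<exists>\<delta>>0. \<forall>w\<in>cspace n. w \<noteq> z \<and> cdist n w z < \<delta> \<longrightarrow>
       cmod (f w - f z - (\<Sum>j<n. a j * (w j - z j))) < e * cdist n w z)"
    unfolding has_complex_gradient_def tendsto_iff eventually_at_cspace[OF z]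
    by (intro all_cong ex_cong1 conj_cong ball_cong refl imp_cong) (use pos * in auto)
  also have "\<dots> \<longleftrightarrow> ?R" (is "?A \<longleftrightarrow> _")
  proof
    assume A: ?A
    show ?R
    proof (intro allI impI)
      fix e :: real assume "e > 0"
      then obtain \<delta> where "\<delta>>0" and d: "\<forall>w\<in>cspace n. w \<noteq> z \<and> cdist n w z < \<delta> \<longrightarrow>
       cmod (f w - f z - (\<Sum>j<n. a j * (w j - z j))) < e * cdist n w z" using A by blast
      have "cmod (f w - f z - (\<Sum>j<n. a j * (w j - z j))) \<le> e * cdist n w z"
        if "w \<in> cspace n" "cdist n w z < \<delta>" for w
        using that d by (cases "w = z") (auto intro: less_imp_le)
      then show "\<exists>\<delta>>0. \<forall>w\<in>cspace n. cdist n w z < \<delta> \<longrightarrow>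
       cmod (f w - f z - (\<Sum>j<n. a j * (w j - z j))) \<le> e * cdist n w z" using \<open>\<delta> > 0\<close> by blast
    qed
  next
    assume R: ?R
    show ?A
    proof (intro allI impI)
      fix e :: real assume "e > 0"
      then obtain \<delta> where "\<delta>>0" and d: "\<forall>w\<in>cspace n. cdist n w z < \<delta> \<longrightarrow>
       cmod (f w - f z - (\<Sum>j<n. a j * (w j - z j))) \<le> e/2 * cdist n w z" using R half_gt_zero by blast
      have "cmod (f w - f z - (\<Sum>j<n. a j * (w j - z j))) < e * cdist n w z"
        if "w \<in> cspace n" "w \<noteq> z" "cdist n w z < \<delta>" for w
      proof -
        have "cmod (f w - f z - (\<Sum>j<n. a j * (w j - z j))) \<le> e/2 * cdist n w z" using that d by blast
        also have "\<dots> < e * cdist n w z" using pos[OF that(1,2)] \<open>e > 0\<close> by simp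
        finally show ?thesis .
      qed
      then show "\<exists>\<delta>>0. \<forall>w\<in>cspace n. w \<noteq> z \<and> cdist n w z < \<delta> \<longrightarrow>
       cmod (f w - f z - (\<Sum>j<n. a j * (w j - z j))) < e * cdist n w z" using \<open>\<delta> > 0\<close> by blast
    qed
  qed
  finally show ?thesis .
qed

lemma has_complex_gradient_cong:
  assumes f: "has_complex_gradient n f a z" and z: "z \<in> cspace n" and d: "\<delta> > 0"
    and eq: "\<And>w. w \<in> cspace n \<Longrightarrow> cdist n w z < \<delta> \<Longrightarrow> f w = g w"
  shows "has_complex_gradient n g a z"
  unfolding has_complex_gradient_iff[OF z]
proof (intro allI impI)
  fix e :: real assume "e > 0"
  then obtain \<epsilon> where \<epsilon>: "\<epsilon>>0" "\<forall>w\<in>cspace n. cdist n w z < \<epsilon> \<longrightarrow>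
       cmod (f w - f z - (\<Sum>j<n. a j * (w j - z j))) \<le> e * cdist n w z"
    using f unfolding has_complex_gradient_iff[OF z] by blast
  then show "\<exists>\<delta>>0. \<forall>w\<in>cspace n. cdist n w z < \<delta> \<longrightarrow>
       cmod (g w - g z - (\<Sum>j<n. a j * (w j - z j))) \<le> e * cdist n w z"
    using d z eq[OF z] eq by (intro exI[of _ "min \<delta> \<epsilon>"]) auto
qed

lemma has_complex_gradient_linear:
  assumes "z \<in> cspace n"
  shows "has_complex_gradient n (\<lambda>w. c + (\<Sum>j<n. a j * w j)) a z"
proof -
  have "cmod ((\<Sum>j<n. a j * w j) - (\<Sum>j<n. a j * z j) - (\<Sum>j<n. a j * (w j - z j))) = 0" for w
    by (simp add: algebra_simps sum_subtractf)
  then show ?thesis unfolding has_complex_gradient_iff[OF assms] by (auto intro!: exI[of _ 1])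
qed

lemma has_complex_gradient_coordinate:
  assumes "z \<in> cspace n" "i < n"
  shows "has_complex_gradient n (\<lambda>w. w i) (\<lambda>j. if j = i then 1 else 0) z"
proof -
  have "(\<Sum>j<n. (if j = i then 1 else 0) * w j) = w i" for w :: "nat \<Rightarrow> complex"
    using assms(2) by (simp add: if_distrib[of "\<lambda>x. x * _"] cong: if_cong)
  then show ?thesis using has_complex_gradient_linear[OF assms(1), of 0 "\<lambda>j. if j = i then 1 else 0"] by simp
qed

lemma has_complex_gradient_const:
  assumes "z \<in> cspace n" shows "has_complex_gradient n (\<lambda>w. c) (\<lambda>_. 0) z"
  using has_complex_gradient_linear[OF assms, of c "\<lambda>_. 0"] by simp

lemma jacobian_estimate:
  assumes z: "z \<in> cspace n" and f: "\<And>i. i < m \<Longrightarrow> has_complex_gradient n (\<lambda>w. f w i) (A i) z"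
    and e: "e > 0"
  shows "\<exists>\<delta>>0. \<forall>w\<in>cspace n. cdist n w z < \<delta> \<longrightarrow>
       cnorm m (\<lambda>i. f w i - f z i - (\<Sum>j<n. A i j * (w j - z j))) \<le> e * cdist n w z"
proof -
  \<comment> \<open>The norm is bounded by the sum of \<open>m\<close> moduli, so each component
    gets a share of \<open>e\<close>; \<open>m + 1\<close> avoids dividing by zero.\<close>
  define e' where "e' = e / (m + 1)"
  have e': "e' > 0" using e by (simp add: e'_def)
  have "\<exists>\<delta>>0. \<forall>w\<in>cspace n. cdist n w z < \<delta> \<longrightarrow>
       cmod (f w i - f z i - (\<Sum>j<n. A i j * (w j - z j))) \<le> e' * cdist n w z" if "i < m" for i
    using f[OF that] e' unfolding has_complex_gradient_iff[OF z] by blast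
  then have "\<forall>i. \<exists>d. i < m \<longrightarrow> d > 0 \<and> (\<forall>w\<in>cspace n. cdist n w z < d \<longrightarrow>
       cmod (f w i - f z i - (\<Sum>j<n. A i j * (w j - z j))) \<le> e' * cdist n w z)" by simp
  from choice[OF this] obtain d where d': "\<forall>i<m. d i > 0 \<and> (\<forall>w\<in>cspace n. cdist n w z < d i \<longrightarrow>
       cmod (f w i - f z i - (\<Sum>j<n. A i j * (w j - z j))) \<le> e' * cdist n w z)" by (elim exE)
  note d = conjunct1[OF d'[rule_format]] conjunct2[OF d'[rule_format], rule_format]
  define \<delta> where "\<delta> = Min (insert 1 (d ` {..<m}))"
  have \<delta>: "\<delta> > 0" "\<And>i. i < m \<Longrightarrow> \<delta> \<le> d i"
    unfolding \<delta>_def using d(1) by auto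
  have "cnorm m (\<lambda>i. f w i - f z i - (\<Sum>j<n. A i j * (w j - z j))) \<le> e * cdist n w z"
    if w: "w \<in> cspace n" "cdist n w z < \<delta>" for w
  proof -
    have "cnorm m (\<lambda>i. f w i - f z i - (\<Sum>j<n. A i j * (w j - z j)))
       \<le> (\<Sum>i<m. cmod (f w i - f z i - (\<Sum>j<n. A i j * (w j - z j))))" by (rule cnorm_le_sum)
    also have "\<dots> \<le> (\<Sum>i<m. e' * cdist n w z)"
    proof (rule sum_mono)
      fix i assume "i \<in> {..<m}"
      then have "i < m" by simp
      moreover from this have "cdist n w z < d i" using w(2) \<delta>(2)[of i] by linarith
      ultimately show "cmod (f w i - f z i - (\<Sum>j<n. A i j * (w j - z j))) \<le> e' * cdist n w z"
        using d(2) w(1) by blast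
    qed
    also have "\<dots> \<le> e * cdist n w z"
    proof -
      have "m * e' \<le> e" using e by (simp add: e'_def field_simps)
      then show ?thesis using mult_right_mono[of "m * e'" e "cdist n w z"] by (simp add: mult.assoc)
    qed
    finally show ?thesis .
  qed
  then show ?thesis using \<delta>(1) by blast
qed

lemma gradient_lipschitz_at:
  assumes z: "z \<in> cspace n" and f: "\<And>i. i < m \<Longrightarrow> \<exists>a. has_complex_gradient n (\<lambda>w. f w i) a z"
  shows "\<exists>C>0. \<exists>\<delta>>0. \<forall>w\<in>cspace n. cdist n w z < \<delta> \<longrightarrow> cdist m (f w) (f z) \<le> C * cdist n w z"
proof -
  obtain A where A: "\<And>i. i < m \<Longrightarrow> has_complex_gradient n (\<lambda>w. f w i) (A i) z" using f by metis
  obtain \<delta> where \<delta>: "\<delta> > 0" "\<And>w. w \<in> cspace n \<Longrightarrow> cdist n w z < \<delta> \<Longrightarrow>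
       cnorm m (\<lambda>i. f w i - f z i - (\<Sum>j<n. A i j * (w j - z j))) \<le> 1 * cdist n w z"
    using jacobian_estimate[OF z, of m f A 1] A by auto
  \<comment> \<open>The linear part contributes the row norms of the Jacobian, the remainder
    contributes \<open>1\<close>.\<close>
  define C where "C = 1 + (\<Sum>i<m. cnorm n (A i))"
  have "cdist m (f w) (f z) \<le> C * cdist n w z" if "w \<in> cspace n" "cdist n w z < \<delta>" for w
  proof -
    have "cdist m (f w) (f z) \<le> cnorm m (\<lambda>i. f w i - f z i - (\<Sum>j<n. A i j * (w j - z j)))
        + cnorm m (\<lambda>i. \<Sum>j<n. A i j * (w j - z j))"
      using cnorm_triangle[of m "\<lambda>i. f w i - f z i - (\<Sum>j<n. A i j * (w j - z j))" "\<lambda>i. \<Sum>j<n. A i j * (w j - z j)"]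
      by simp
    also have "cnorm m (\<lambda>i. \<Sum>j<n. A i j * (w j - z j)) \<le> (\<Sum>i<m. cnorm n (A i) * cdist n w z)"
      by (rule order_trans[OF cnorm_le_sum]) (intro sum_mono cmod_linear_form_le)
    finally show ?thesis using \<delta>(2)[OF that] by (simp add: C_def algebra_simps sum_distrib_left sum_distrib_right)
  qed
  moreover have "C > 0" unfolding C_def by (smt (verit) cnorm_nonneg sum_nonneg)
  ultimately show ?thesis using \<delta>(1) by blast
qed

text \<open>The error of the composite is the error of \<open>g\<close> at \<open>f w\<close>,
  controlled by a Lipschitz constant of \<open>f\<close> at \<open>z\<close>, plus \<open>b\<close>
  applied to the error of \<open>f\<close>. The choices of \<open>e1\<close> and \<open>e2\<close>
  give each of them half of \<open>e\<close>.\<close>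

lemma has_complex_gradient_compose:
  assumes z: "z \<in> cspace n"
    and f: "\<And>i. i < m \<Longrightarrow> has_complex_gradient n (\<lambda>w. f w i) (A i) z"
    and g: "has_complex_gradient m g b (f z)"
    and d: "\<delta> > 0" and fm: "\<And>w. w \<in> cspace n \<Longrightarrow> cdist n w z < \<delta> \<Longrightarrow> f w \<in> cspace m"
  shows "has_complex_gradient n (\<lambda>w. g (f w)) (\<lambda>j. \<Sum>i<m. b i * A i j) z"
proof -
  have fz: "f z \<in> cspace m" using fm[OF z] d by simp
  obtain C \<delta>1 where C: "C > 0" "\<delta>1 > 0"
    "\<And>w. w\<in>cspace n \<Longrightarrow> cdist n w z < \<delta>1 \<Longrightarrow> cdist m (f w) (f z) \<le> C * cdist n w z"
    using gradient_lipschitz_at[OF z, of m f] f by metis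
  show ?thesis unfolding has_complex_gradient_iff[OF z]
  proof (intro allI impI)
    fix e :: real assume e: "e > 0"
    define e1 where "e1 = e / (2 * C)"
    define e2 where "e2 = e / (2 * (cnorm m b + 1))"
    have b1: "cnorm m b + 1 > 0" by (smt (verit) cnorm_nonneg)
    have e1: "e1 > 0" and e2: "e2 > 0" using e C b1 by (simp_all add: e1_def e2_def)
    obtain \<delta>2 where d2: "\<delta>2 > 0" "\<And>w. w \<in> cspace m \<Longrightarrow> cdist m w (f z) < \<delta>2 \<Longrightarrow>
       cmod (g w - g (f z) - (\<Sum>j<m. b j * (w j - f z j))) \<le> e1 * cdist m w (f z)"
      using g e1 unfolding has_complex_gradient_iff[OF fz] by meson
    have "\<exists>\<delta>>0. \<forall>w\<in>cspace n. cdist n w z < \<delta> \<longrightarrow>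
       cnorm m (\<lambda>i. f w i - f z i - (\<Sum>j<n. A i j * (w j - z j))) \<le> e2 * cdist n w z"
      by (rule jacobian_estimate[OF z f e2])
    then obtain \<delta>3 where d3': "\<delta>3 > 0" "\<forall>w\<in>cspace n. cdist n w z < \<delta>3 \<longrightarrow>
       cnorm m (\<lambda>i. f w i - f z i - (\<Sum>j<n. A i j * (w j - z j))) \<le> e2 * cdist n w z"
      by (elim exE conjE)
    note d3 = d3'(1) d3'(2)[rule_format]
    define \<delta>' where "\<delta>' = Min {\<delta>, \<delta>1, \<delta>2 / C, \<delta>3}"
    have "\<delta>' > 0" using d C d2 d3 by (simp add: \<delta>'_def)
    moreover have "cmod (g (f w) - g (f z) - (\<Sum>j<n. (\<Sum>i<m. b i * A i j) * (w j - z j))) \<le> e * cdist n w z"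
      if w: "w \<in> cspace n" "cdist n w z < \<delta>'" for w
    proof -
      have w': "cdist n w z < \<delta>" "cdist n w z < \<delta>1" "cdist n w z < \<delta>2 / C" "cdist n w z < \<delta>3"
        using w by (auto simp: \<delta>'_def)
      have c1: "cdist m (f w) (f z) \<le> C * cdist n w z" using C(3) w w' by blast
      also have "\<dots> < \<delta>2" using w'(3) C(1) by (simp add: field_simps)
      finally have "cmod (g (f w) - g (f z) - (\<Sum>j<m. b j * (f w j - f z j))) \<le> e1 * cdist m (f w) (f z)"
        by (intro d2(2) fm w w')
      also have "\<dots> \<le> e1 * (C * cdist n w z)" using c1 e1 by (intro mult_left_mono) auto
      also have "\<dots> = e/2 * cdist n w z" using C by (simp add: e1_def)
      finally have 1: "cmod (g (f w) - g (f z) - (\<Sum>j<m. b j * (f w j - f z j))) \<le> e/2 * cdist n w z" .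
      have "cmod (\<Sum>i<m. b i * (f w i - f z i - (\<Sum>j<n. A i j * (w j - z j))))
         \<le> cnorm m b * cnorm m (\<lambda>i. f w i - f z i - (\<Sum>j<n. A i j * (w j - z j)))"
        by (rule cmod_linear_form_le)
      also have "\<dots> \<le> (cnorm m b + 1) * (e2 * cdist n w z)"
        using d3(2)[OF w(1) w'(4)] by (intro mult_mono) (auto simp: add_nonneg_nonneg)
      also have "\<dots> = e/2 * cdist n w z" using b1 by (simp add: e2_def field_simps)
      finally have 2: "cmod (\<Sum>i<m. b i * (f w i - f z i - (\<Sum>j<n. A i j * (w j - z j)))) \<le> e/2 * cdist n w z" .
      have "(\<Sum>j<n. (\<Sum>i<m. b i * A i j) * (w j - z j)) = (\<Sum>i<m. b i * (\<Sum>j<n. A i j * (w j - z j)))"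
        unfolding sum_distrib_left sum_distrib_right by (subst sum.swap) (simp add: mult.assoc)
      then have "g (f w) - g (f z) - (\<Sum>j<n. (\<Sum>i<m. b i * A i j) * (w j - z j))
        = (g (f w) - g (f z) - (\<Sum>j<m. b j * (f w j - f z j)))
          + (\<Sum>i<m. b i * (f w i - f z i - (\<Sum>j<n. A i j * (w j - z j))))"
        by (simp add: right_diff_distrib sum_subtractf)
      then have "cmod (g (f w) - g (f z) - (\<Sum>j<n. (\<Sum>i<m. b i * A i j) * (w j - z j)))
         \<le> e/2 * cdist n w z + e/2 * cdist n w z"
        by (simp only:) (rule norm_triangle_le[OF add_mono[OF 1 2]])
      then show ?thesis by linarith
    qed
    ultimately show "\<exists>\<delta>>0. \<forall>w\<in>cspace n. cdist n w z < \<delta> \<longrightarrow>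
       cmod (g (f w) - g (f z) - (\<Sum>j<n. (\<Sum>i<m. b i * A i j) * (w j - z j))) \<le> e * cdist n w z" by blast
  qed
qed

text \<open>An increment of length \<open>t\<close> along the \<open>i\<close>-th axis isolates the
  \<open>i\<close>-th coefficient. Two different values would be at distance \<open>4 * e\<close>,
  while the two estimates together allow only \<open>2 * e\<close>.\<close>

lemma has_complex_gradient_unique:
  assumes z: "z \<in> cspace n" and a: "has_complex_gradient n f a z" and b: "has_complex_gradient n f b z"
    and i: "i < n"
  shows "a i = b i"
proof (rule ccontr)
  assume ne: "a i \<noteq> b i"
  define e where "e = cmod (a i - b i) / 4"
  have e: "e > 0" using ne by (simp add: e_def)
  obtain d1 where d1: "d1 > 0" "\<And>w. w \<in> cspace n \<Longrightarrow> cdist n w z < d1 \<Longrightarrow>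
       cmod (f w - f z - (\<Sum>j<n. a j * (w j - z j))) \<le> e * cdist n w z"
    using a e unfolding has_complex_gradient_iff[OF z] by meson
  obtain d2 where d2: "d2 > 0" "\<And>w. w \<in> cspace n \<Longrightarrow> cdist n w z < d2 \<Longrightarrow>
       cmod (f w - f z - (\<Sum>j<n. b j * (w j - z j))) \<le> e * cdist n w z"
    using b e unfolding has_complex_gradient_iff[OF z] by meson
  define t where "t = min d1 d2 / 2"
  have t: "t > 0" "t < d1" "t < d2" using d1 d2 by (auto simp: t_def)
  define w where "w = z(i := z i + of_real t)"
  have w: "w \<in> cspace n" using z i by (auto simp: w_def cspace_def)
  have wz: "w j - z j = (if j = i then of_real t else 0)" for j by (simp add: w_def)
  have cd: "cdist n w z = t"
    unfolding wz cnorm_def L2_set_def using i t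
    by (simp add: if_distrib[of "\<lambda>x. (cmod x)\<^sup>2"] cong: if_cong)
  have s: "(\<Sum>j<n. c j * (w j - z j)) = c i * of_real t" for c
    unfolding wz using i by (simp add: if_distrib[of "\<lambda>x. _ * x"] cong: if_cong)
  have "cmod (f w - f z - a i * of_real t) \<le> e * t" "cmod (f w - f z - b i * of_real t) \<le> e * t"
    using d1(2)[OF w] d2(2)[OF w] t unfolding cd s by auto
  then have "cmod ((a i - b i) * of_real t) \<le> 2 * e * t"
    using norm_triangle_ineq4[of "f w - f z - b i * of_real t" "f w - f z - a i * of_real t"]
    by (simp add: algebra_simps)
  then have "cmod (a i - b i) * t \<le> 2 * e * t" using t by (simp add: norm_mult)
  then have "(4 * e) * t \<le> (2 * e) * t" by (simp add: e_def)
  then have "4 * e \<le> 2 * e" using t by (simp only: mult_le_cancel_right_pos)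
  then show False using e by simp
qed

section \<open>The holomorphic implicit function theorem\<close>

lemma continuous_on_cspaceI:
  fixes f :: "(nat \<Rightarrow> complex) \<Rightarrow> 'b::metric_space"
  assumes "\<And>z e. z \<in> S \<Longrightarrow> e > 0 \<Longrightarrow> \<exists>\<delta>>0. \<forall>w\<in>S. cdist n w z < \<delta> \<longrightarrow> dist (f w) (f z) < e"
  shows "continuous_on S f"
  unfolding continuous_on_def tendsto_iff
proof (intro ballI allI impI)
  fix z e assume "z \<in> S" "e > (0::real)"
  then obtain \<delta> where "\<delta> > 0" "\<forall>w\<in>S. cdist n w z < \<delta> \<longrightarrow> dist (f w) (f z) < e" using assms by blast
  then show "\<forall>\<^sub>F x in at z within S. dist (f x) (f z) < e"
    unfolding eventually_at_topological
    by (intro exI[of _ "{w. cdist n w z < \<delta>}"]) (auto simp: open_cdist_ball)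
qed

text \<open>The ball is closed in a product of \<open>n\<close> discs and copies of
  \<open>{0}\<close>, which is compact by Tychonoff's theorem.\<close>

lemma compact_cspace_cball: "compact (cspace_cball n r)"
proof -
  have "compactin (product_topology (\<lambda>i. euclidean) UNIV)
     (Pi\<^sub>E UNIV (\<lambda>i. if i < n then cball 0 r else {0::complex}))"
    by (subst compactin_PiE) auto
  then have "compact (Pi\<^sub>E UNIV (\<lambda>i. if i < n then cball 0 r else {0::complex}))"
    by (simp add: euclidean_product_topology)
  moreover have "closed {z. cnorm n z \<le> r}"
  proof -
    have "continuous_on UNIV (cnorm n)"
      using continuous_on_cnorm[of UNIV "\<lambda>z. z" n] by (auto intro: continuous_on_coordinate)
    then show ?thesis by (intro closed_Collect_le) auto
  qed
  ultimately have "compact ((Pi\<^sub>E UNIV (\<lambda>i. if i < n then cball 0 r else {0::complex})) \<inter> {z. cnorm n z \<le> r})"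
    by (rule compact_Int_closed)
  moreover have "(Pi\<^sub>E UNIV (\<lambda>i. if i < n then cball 0 r else {0::complex})) \<inter> {z. cnorm n z \<le> r} = cspace_cball n r"
    (is "?A = ?B")
  proof (intro set_eqI iffI)
    fix z assume z: "z \<in> ?A"
    have "z i = 0" if "i \<ge> n" for i
    proof -
      have "z i \<in> (if i < n then cball 0 r else {0})" using z by (auto simp: PiE_def Pi_def)
      then show ?thesis using that by simp
    qed
    then show "z \<in> ?B" using z by (simp add: cspace_cball_def cspace_def)
  next
    fix z assume z: "z \<in> ?B"
    then have "cmod (z i) \<le> r" if "i < n" for i
      using component_le_cnorm[OF that, of z] by (auto simp: cspace_cball_def)
    with z show "z \<in> ?A"
      by (auto simp: cspace_cball_def cspace_def PiE_def Pi_def)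
  qed
  ultimately show ?thesis by simp
qed

text \<open>Compactness replaces iteration: the displacement \<open>cdist m (\<Theta> v) v\<close>
  attains its minimum on the ball, and a positive minimum would be lowered by passing from
  \<open>v\<close> to \<open>\<Theta> v\<close>.\<close>

lemma cspace_contraction_fixpoint:
  assumes s: "0 \<le> s" and maps: "\<And>v. v \<in> cspace_cball m s \<Longrightarrow> \<Theta> v \<in> cspace_cball m s"
    and c: "c < 1" and lip: "\<And>v w. v \<in> cspace_cball m s \<Longrightarrow> w \<in> cspace_cball m s \<Longrightarrow>
      cdist m (\<Theta> v) (\<Theta> w) \<le> c * cdist m v w"
  shows "\<exists>v \<in> cspace_cball m s. \<Theta> v = v"
proof -
  let ?\<phi> = "\<lambda>v. cdist m (\<Theta> v) v"
  have "continuous_on (cspace_cball m s) ?\<phi>"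
  proof (rule continuous_on_cspaceI[where n=m])
    fix z and e :: real assume z: "z \<in> cspace_cball m s" and e: "e > 0"
    show "\<exists>\<delta>>0. \<forall>w\<in>cspace_cball m s. cdist m w z < \<delta> \<longrightarrow> dist (?\<phi> w) (?\<phi> z) < e"
    proof (intro exI[of _ "e/2"] conjI ballI impI)
      show "e/2 > 0" using e by simp
      fix w assume w: "w \<in> cspace_cball m s" "cdist m w z < e / 2"
      have "cdist m (\<Theta> w) (\<Theta> z) \<le> 1 * cdist m w z"
        using lip[OF w(1) z] mult_right_mono[of c 1 "cdist m w z"] c by simp
      moreover have "?\<phi> w \<le> cdist m (\<Theta> w) (\<Theta> z) + (?\<phi> z + cdist m z w)"
        using cdist_triangle[of m "\<Theta> w" w "\<Theta> z"] cdist_triangle[of m "\<Theta> z" w z] by linarith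
      moreover have "?\<phi> z \<le> cdist m (\<Theta> z) (\<Theta> w) + (?\<phi> w + cdist m w z)"
        using cdist_triangle[of m "\<Theta> z" z "\<Theta> w"] cdist_triangle[of m "\<Theta> w" z w] by linarith
      ultimately show "dist (?\<phi> w) (?\<phi> z) < e"
        using w(2) cdist_commute[of m z w] cdist_commute[of m "\<Theta> z" "\<Theta> w"]
        unfolding dist_real_def abs_less_iff by linarith
    qed
  qed
  moreover have "(\<lambda>_. 0) \<in> cspace_cball m s" using s by (simp add: cspace_cball_def cspace_def)
  ultimately obtain v where v: "v \<in> cspace_cball m s" "\<And>w. w \<in> cspace_cball m s \<Longrightarrow> ?\<phi> v \<le> ?\<phi> w"
    using continuous_attains_inf[OF compact_cspace_cball[of m s], of ?\<phi>] by blast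
  have "?\<phi> v \<le> ?\<phi> (\<Theta> v)" by (rule v(2)[OF maps[OF v(1)]])
  also have "\<dots> \<le> c * ?\<phi> v" by (rule lip[OF maps[OF v(1)] v(1)])
  finally have "(1 - c) * ?\<phi> v \<le> 0" by (simp add: algebra_simps)
  then have "?\<phi> v = 0" using c cnorm_nonneg[of m "\<lambda>j. \<Theta> v j - v j"] by (simp add: mult_le_0_iff)
  then have "\<Theta> v = v"
    using maps[OF v(1)] v(1) by (subst (asm) cdist_eq_0_iff) (auto simp: cspace_cball_def)
  then show ?thesis using v(1) by blast
qed

section \<open>Pointwise differentiability improved by Cauchy estimates on complex lines\<close>

lemma gradient_along_line:
  assumes p: "p \<in> cspace n" and q: "q \<in> cspace n"
    and f: "has_complex_gradient n f a (\<lambda>j. p j + t * q j)"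
  shows "((\<lambda>t. f (\<lambda>j. p j + t * q j)) has_field_derivative (\<Sum>j<n. a j * q j)) (at t)"
  unfolding has_field_derivative_def has_derivative_at_alt
proof (intro conjI allI impI)
  show "bounded_linear ((*) (\<Sum>j<n. a j * q j))" by (rule bounded_linear_mult_right)
next
  fix e :: real assume e: "e > 0"
  let ?l = "\<lambda>t j. p j + t * q j"
  \<comment> \<open>The \<open>+ 1\<close> admits the direction \<open>q = 0\<close>.\<close>
  define Q where "Q = cnorm n q + 1"
  have Q: "Q > 0" unfolding Q_def by (smt (verit) cnorm_nonneg)
  have l: "?l t \<in> cspace n" for t using p q by (auto simp: cspace_def)
  have d: "cdist n (?l y) (?l t) = cmod (y - t) * cnorm n q" for y
    using cnorm_scale[of n "y - t" q] by (simp add: algebra_simps)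
  obtain \<delta> where \<delta>: "\<delta> > 0" "\<forall>w\<in>cspace n. cdist n w (?l t) < \<delta> \<longrightarrow>
       cmod (f w - f (?l t) - (\<Sum>j<n. a j * (w j - ?l t j))) \<le> e / Q * cdist n w (?l t)"
    using f[unfolded has_complex_gradient_iff[OF l], rule_format, OF divide_pos_pos[OF e Q]] by (elim exE conjE)
  have "cmod (f (?l y) - f (?l t) - (\<Sum>j<n. a j * q j) * (y - t)) \<le> e * cmod (y - t)"
    if y: "cmod (y - t) < \<delta> / Q" for y
  proof -
    have "cmod (y - t) * cnorm n q \<le> cmod (y - t) * Q" by (simp add: Q_def mult_left_mono)
    also have "\<dots> < \<delta>" using y Q by (simp add: field_simps)
    finally have "cdist n (?l y) (?l t) < \<delta>" using d by simp
    then have "cmod (f (?l y) - f (?l t) - (\<Sum>j<n. a j * (?l y j - ?l t j))) \<le> e / Q * cdist n (?l y) (?l t)"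
      by (intro \<delta>(2)[rule_format] l)
    also have "\<dots> \<le> e / Q * (cmod (y - t) * Q)"
      unfolding d using e Q by (intro mult_left_mono) (auto simp: Q_def)
    also have "\<dots> = e * cmod (y - t)" using Q by simp
    also have "(\<Sum>j<n. a j * (?l y j - ?l t j)) = (\<Sum>j<n. a j * q j) * (y - t)"
      by (simp add: sum_distrib_right mult.assoc mult.commute[of "y - t"] flip: left_diff_distrib)
    finally show ?thesis .
  qed
  then show "\<exists>d>0. \<forall>y. cmod (y - t) < d \<longrightarrow>
          cmod (f (?l y) - f (?l t) - (\<Sum>j<n. a j * q j) * (y - t)) \<le> e * cmod (y - t)"
    using \<delta>(1) Q by (intro exI[of _ "\<delta> / Q"] conjI allI impI) simp_all
qed

text \<open>Around each point of the unit disc the disc of radius \<open>R/2\<close> stays inside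
  \<open>ball 0 R\<close>, because \<open>R > 2\<close>. Cauchy's inequality there bounds the
  derivative by \<open>2 * M / R\<close>, and the segment from 0 to 1 has length one.\<close>

lemma holomorphic_increment_bound:
  fixes g :: "complex \<Rightarrow> complex"
  assumes hol: "g holomorphic_on ball 0 R" and R: "R > 2" and M: "\<And>t. t \<in> ball 0 R \<Longrightarrow> cmod (g t) \<le> M"
  shows "cmod (g 1 - g 0) \<le> 2 * M / R"
proof -
  have "cmod (deriv g t) \<le> 2 * M / R" if t: "t \<in> cball 0 1" for t
  proof -
    have sub: "cball t (R/2) \<subseteq> ball 0 R"
    proof
      fix x assume "x \<in> cball t (R/2)"
      then have "cmod x \<le> cmod t + R/2" using norm_triangle_ineq[of t "x - t"] by (simp add: dist_norm norm_minus_commute)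
      then show "x \<in> ball 0 R" using t R by simp
    qed
    have "cmod ((deriv ^^ 1) g t) \<le> fact 1 * M / (R/2) ^ 1"
    proof (rule Cauchy_inequality)
      show "g holomorphic_on ball t (R/2)"
        by (rule holomorphic_on_subset[OF hol order_trans[OF ball_subset_cball sub]])
      show "continuous_on (cball t (R/2)) g"
        by (rule holomorphic_on_imp_continuous_on[OF holomorphic_on_subset[OF hol sub]])
      show "0 < R/2" using R by simp
      fix x assume "cmod (t - x) = R/2"
      then show "cmod (g x) \<le> M" by (intro M subsetD[OF sub]) (simp add: dist_norm)
    qed
    then show ?thesis by (simp add: field_simps)
  qed
  moreover have "(g has_field_derivative deriv g t) (at t within cball 0 1)" if "t \<in> cball 0 1" for t
  proof (rule has_field_derivative_at_within, rule holomorphic_derivI[OF hol open_ball])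
    show "t \<in> ball 0 R" using that R by simp
  qed
  moreover have "(1::complex) \<in> cball 0 1" "(0::complex) \<in> cball 0 1" by simp_all
  ultimately have "cmod (g 1 - g 0) \<le> 2 * M / R * cmod (1 - 0 :: complex)"
    by (intro field_differentiable_bound[of "cball 0 1" g "deriv g"] convex_cball)
  then show ?thesis by simp
qed

text \<open>On the ball of radius \<open>r\<close> the error \<open>E\<close> is at most
  \<open>\<eta>/4 * r\<close>. On the complex line through \<open>v\<close> and \<open>w\<close> it
  is a holomorphic function of one variable, so its increment is small compared with the distance of
  \<open>v\<close> and \<open>w\<close>. This strict differentiability stands in for continuity of
  the derivative.\<close>

lemma holomorphic_remainder_lipschitz:
  assumes z: "z \<in> cspace n" and R: "R > 0"
    and f: "\<And>w. w \<in> cspace n \<Longrightarrow> cdist n w z < R \<Longrightarrow> \<exists>b. has_complex_gradient n f b w"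
    and a: "has_complex_gradient n f a z" and \<eta>: "\<eta> > 0"
  shows "\<exists>\<rho>>0. \<forall>v\<in>cspace n. \<forall>w\<in>cspace n. cdist n v z < \<rho> \<longrightarrow> cdist n w z < \<rho> \<longrightarrow>
     cmod (f w - f v - (\<Sum>j<n. a j * (w j - v j))) \<le> \<eta> * cdist n w v"
proof -
  obtain \<delta> where \<delta>: "\<delta> > 0" and \<delta>': "\<And>w. w\<in>cspace n \<Longrightarrow> cdist n w z < \<delta> \<Longrightarrow>
       cmod (f w - f z - (\<Sum>j<n. a j * (w j - z j))) \<le> \<eta>/4 * cdist n w z"
    using a[unfolded has_complex_gradient_iff[OF z], rule_format, of "\<eta>/4"] \<eta> by auto
  define r where "r = min \<delta> R"
  have r: "r > 0" "r \<le> \<delta>" "r \<le> R" using \<delta> R by (auto simp: r_def)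
  have "cmod (f w - f v - (\<Sum>j<n. a j * (w j - v j))) \<le> \<eta> * cdist n w v"
    if v: "v \<in> cspace n" "cdist n v z < r/8" and w: "w \<in> cspace n" "cdist n w z < r/8" for v w
  proof (cases "w = v")
    case False
    define D where "D = cdist n w v"
    define q where "q = (\<lambda>j. w j - v j)"
    have q: "q \<in> cspace n" using v w by (auto simp: q_def cspace_def)
    have D: "D > 0" "cnorm n q = D" using False v w cdist_eq_0_iff[OF w(1) v(1)]
      by (auto simp: D_def q_def order_less_le)
    have D4: "D < r/4" using cdist_triangle[of n w v z] cdist_commute[of n z v] v w by (auto simp: D_def)
    \<comment> \<open>The line moves with speed \<open>D\<close> in the parameter \<open>t\<close>,
      so the disc of radius \<open>S\<close> covers the distance \<open>r/2\<close> from
      \<open>v\<close>; closeness of \<open>v\<close> and \<open>w\<close> makes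
      \<open>S > 2\<close>. The increment bound becomes
      \<open>2 * (\<eta>/4 * r) / S = \<eta> * D\<close>.\<close>
    define S where "S = r / (2 * D)"
    have S: "S > 2" using D4 D by (simp add: S_def field_simps)
    let ?l = "\<lambda>t j. v j + t * q j"
    define E where "E = (\<lambda>w. f w - f z - (\<Sum>j<n. a j * (w j - z j)))"
    have l: "?l t \<in> cspace n" for t using v q by (auto simp: cspace_def)
    have lr: "cdist n (?l t) z < r" if "t \<in> ball 0 S" for t
    proof -
      have "cdist n (?l t) z \<le> cdist n (?l t) v + cdist n v z" by (rule cdist_triangle)
      also have "cdist n (?l t) v = cmod t * D" using cnorm_scale[of n t q] D by simp
      also have "cmod t * D < S * D" using that D by (intro mult_strict_right_mono) auto
      also have "S * D = r/2" using D by (simp add: S_def)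
      finally show ?thesis using v r by simp
    qed
    have "(\<lambda>t. E (?l t)) holomorphic_on ball 0 S"
    proof -
      have "\<exists>d. ((\<lambda>t. f (?l t)) has_field_derivative d) (at t)" if "t \<in> ball 0 S" for t
        using gradient_along_line[OF v(1) q] f[OF l, of t] lr[OF that] r by force
      then have "(\<lambda>t. f (?l t)) holomorphic_on ball 0 S"
        unfolding holomorphic_on_open[OF open_ball] by blast
      then show ?thesis unfolding E_def by (intro holomorphic_intros)
    qed
    moreover have "cmod (E (?l t)) \<le> \<eta>/4 * r" if "t \<in> ball 0 S" for t
    proof -
      have "cmod (E (?l t)) \<le> \<eta>/4 * cdist n (?l t) z"
        unfolding E_def using lr[OF that] r by (intro \<delta>' l) auto
      also have "\<dots> \<le> \<eta>/4 * r" using lr[OF that] \<eta> by (intro mult_left_mono) auto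
      finally show ?thesis .
    qed
    ultimately have "cmod (E (?l 1) - E (?l 0)) \<le> 2 * (\<eta>/4 * r) / S"
      by (rule holomorphic_increment_bound[OF _ S])
    also have "\<dots> = \<eta> * D" using D r by (simp add: S_def field_simps)
    also have "E (?l 1) - E (?l 0) = f w - f v - (\<Sum>j<n. a j * (w j - v j))"
      unfolding E_def q_def by (simp add: sum_subtractf algebra_simps)
    finally show ?thesis by (simp add: D_def)
  qed (use \<eta> in simp)
  then show ?thesis using r(1) by (intro exI[of _ "r/8"]) auto
qed

lemma holomorphic_map_remainder_lipschitz:
  assumes z: "z \<in> cspace n" and R: "R > 0"
    and f: "\<And>w i. w \<in> cspace n \<Longrightarrow> cdist n w z < R \<Longrightarrow> i < m \<Longrightarrow> \<exists>b. has_complex_gradient n (\<lambda>w. f w i) b w"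
    and A: "\<And>i. i < m \<Longrightarrow> has_complex_gradient n (\<lambda>w. f w i) (A i) z" and \<eta>: "\<eta> > 0"
  shows "\<exists>\<rho>>0. \<forall>v\<in>cspace n. \<forall>w\<in>cspace n. cdist n v z < \<rho> \<longrightarrow> cdist n w z < \<rho> \<longrightarrow>
     cnorm m (\<lambda>i. f w i - f v i - (\<Sum>j<n. A i j * (w j - v j))) \<le> \<eta> * cdist n w v"
proof -
  define \<eta>' where "\<eta>' = \<eta> / (m + 1)"
  have \<eta>': "\<eta>' > 0" using \<eta> by (simp add: \<eta>'_def)
  have "\<forall>i. \<exists>d. i < m \<longrightarrow> d > 0 \<and> (\<forall>v\<in>cspace n. \<forall>w\<in>cspace n. cdist n v z < d \<longrightarrow> cdist n w z < d \<longrightarrow>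
     cmod (f w i - f v i - (\<Sum>j<n. A i j * (w j - v j))) \<le> \<eta>' * cdist n w v)"
    using holomorphic_remainder_lipschitz[OF z R f A \<eta>'] by simp
  from choice[OF this] obtain d where d': "\<forall>i<m. d i > 0 \<and> (\<forall>v\<in>cspace n. \<forall>w\<in>cspace n. cdist n v z < d i \<longrightarrow> cdist n w z < d i \<longrightarrow>
     cmod (f w i - f v i - (\<Sum>j<n. A i j * (w j - v j))) \<le> \<eta>' * cdist n w v)" by (elim exE)
  note d = conjunct1[OF d'[rule_format]] conjunct2[OF d'[rule_format], rule_format]
  define \<delta> where "\<delta> = Min (insert 1 (d ` {..<m}))"
  have \<delta>: "\<delta> > 0" "\<And>i. i < m \<Longrightarrow> \<delta> \<le> d i"
    unfolding \<delta>_def using d(1) by auto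
  have "cnorm m (\<lambda>i. f w i - f v i - (\<Sum>j<n. A i j * (w j - v j))) \<le> \<eta> * cdist n w v"
    if vw: "v \<in> cspace n" "w \<in> cspace n" "cdist n v z < \<delta>" "cdist n w z < \<delta>" for v w
  proof -
    have "cnorm m (\<lambda>i. f w i - f v i - (\<Sum>j<n. A i j * (w j - v j)))
       \<le> (\<Sum>i<m. cmod (f w i - f v i - (\<Sum>j<n. A i j * (w j - v j))))" by (rule cnorm_le_sum)
    also have "\<dots> \<le> (\<Sum>i<m. \<eta>' * cdist n w v)"
    proof (rule sum_mono)
      fix i assume "i \<in> {..<m}"
      then have "i < m" by simp
      moreover from this have "cdist n w z < d i" "cdist n v z < d i" using vw \<delta>(2)[of i] by linarith+
      ultimately show "cmod (f w i - f v i - (\<Sum>j<n. A i j * (w j - v j))) \<le> \<eta>' * cdist n w v"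
        using d(2) vw by blast
    qed
    also have "\<dots> \<le> \<eta> * cdist n w v"
    proof -
      have "m * \<eta>' \<le> \<eta>" using \<eta> by (simp add: \<eta>'_def field_simps)
      then show ?thesis using mult_right_mono[of "m * \<eta>'" \<eta> "cdist n w v"] by (simp add: mult.assoc)
    qed
    finally show ?thesis .
  qed
  then show ?thesis using \<delta>(1) by (intro exI[of _ \<delta>]) simp
qed

text \<open>\<open>I - M\<close> is a contraction, so \<open>M q = b\<close> is solved by a fixed
  point of \<open>q |-> b + (q - M q)\<close>. Solving for the unit vectors gives a right inverse. A
  vector killed by \<open>M\<close> equals its own image under \<open>I - M\<close> and is therefore
  zero; hence the right inverse is also a left inverse.\<close>

lemma near_identity_left_inverse:
  assumes near: "\<And>q. q \<in> cspace m \<Longrightarrow> cnorm m (\<lambda>i. q i - (\<Sum>k<m. M i k * q k)) \<le> c * cnorm m q"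
    and c: "0 \<le> c" "c < 1"
  shows "\<exists>C. \<forall>q\<in>cspace m. \<forall>i<m. (\<Sum>k<m. C i k * (\<Sum>l<m. M k l * q l)) = q i"
proof -
  have solve: "\<exists>q\<in>cspace m. \<forall>i<m. (\<Sum>k<m. M i k * q k) = b i" if b: "b \<in> cspace m" for b
  proof -
    \<comment> \<open>The ball of radius \<open>s\<close> is mapped into itself because
      \<open>cnorm m b + c * s = s\<close>.\<close>
    define s where "s = cnorm m b / (1 - c)"
    define \<Theta> where "\<Theta> = (\<lambda>q i. if i < m then b i + (q i - (\<Sum>k<m. M i k * q k)) else 0)"
    have cs: "\<Theta> q \<in> cspace m" for q by (simp add: \<Theta>_def cspace_def)
    have "\<exists>v \<in> cspace_cball m s. \<Theta> v = v"
    proof (rule cspace_contraction_fixpoint)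
      show "0 \<le> s" using c by (simp add: s_def)
      show "c < 1" by fact
      fix v assume v: "v \<in> cspace_cball m s"
      have "cnorm m (\<Theta> v) = cnorm m (\<lambda>i. b i + (v i - (\<Sum>k<m. M i k * v k)))"
        by (rule cnorm_cong) (simp add: \<Theta>_def)
      also have "\<dots> \<le> cnorm m b + cnorm m (\<lambda>i. v i - (\<Sum>k<m. M i k * v k))" by (rule cnorm_triangle)
      also have "\<dots> \<le> cnorm m b + c * s"
        using near[of v] v c mult_left_mono[of "cnorm m v" s c] by (simp add: cspace_cball_def)
      also have "\<dots> = s" using c by (simp add: s_def field_simps)
      finally show "\<Theta> v \<in> cspace_cball m s" using cs by (simp add: cspace_cball_def)
      fix w assume w: "w \<in> cspace_cball m s"
      have vw: "(\<lambda>i. v i - w i) \<in> cspace m" using v w by (auto simp: cspace_cball_def cspace_def)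
      have "cdist m (\<Theta> v) (\<Theta> w) = cnorm m (\<lambda>i. (v i - w i) - (\<Sum>k<m. M i k * (v k - w k)))"
        by (rule cnorm_cong) (simp add: \<Theta>_def algebra_simps sum_subtractf)
      also have "\<dots> \<le> c * cdist m v w" by (rule near[OF vw])
      finally show "cdist m (\<Theta> v) (\<Theta> w) \<le> c * cdist m v w" .
    qed
    then obtain v where v: "v \<in> cspace_cball m s" "\<Theta> v = v" by blast
    have "(\<Sum>k<m. M i k * v k) = b i" if "i < m" for i
      using fun_cong[OF v(2), of i] that by (simp add: \<Theta>_def)
    then show ?thesis using v(1) by (auto simp: cspace_cball_def)
  qed
  have "\<exists>q\<in>cspace m. \<forall>i<m. (\<Sum>k<m. M i k * q k) = (if i = l then 1 else 0)" if "l < m" for l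
    using solve[of "\<lambda>i. if i = l then 1 else 0"] that by (auto simp: cspace_def)
  then obtain Q where Q: "\<And>l. l < m \<Longrightarrow> Q l \<in> cspace m"
    "\<And>l i. l < m \<Longrightarrow> i < m \<Longrightarrow> (\<Sum>k<m. M i k * Q l k) = (if i = l then 1 else 0)" by metis
  have "\<forall>i<m. (\<Sum>k<m. Q k i * (\<Sum>l<m. M k l * q l)) = q i" if q: "q \<in> cspace m" for q
  proof -
    define p where "p = (\<lambda>i. if i < m then (\<Sum>k<m. Q k i * (\<Sum>l<m. M k l * q l)) else 0)"
    \<comment> \<open>The defect of the candidate left inverse; it lies in the kernel of
      \<open>M\<close>.\<close>
    define d where "d = (\<lambda>i. p i - q i)"
    have d: "d \<in> cspace m" using q by (auto simp: d_def p_def cspace_def)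
    have "(\<Sum>k<m. M i k * d k) = 0" if i: "i < m" for i
    proof -
      have "(\<Sum>k<m. M i k * p k) = (\<Sum>k<m. \<Sum>k'<m. M i k * (Q k' k * (\<Sum>l<m. M k' l * q l)))"
        by (simp add: p_def sum_distrib_left)
      also have "\<dots> = (\<Sum>k'<m. (\<Sum>k<m. M i k * Q k' k) * (\<Sum>l<m. M k' l * q l))"
        by (subst sum.swap) (simp add: sum_distrib_right mult.assoc)
      also have "\<dots> = (\<Sum>k'<m. (if i = k' then 1 else 0) * (\<Sum>l<m. M k' l * q l))"
        using Q(2) i by simp
      also have "\<dots> = (\<Sum>l<m. M i l * q l)"
        using i by (simp add: if_distrib[of "\<lambda>x. x * _"] cong: if_cong)
      finally show ?thesis by (simp add: d_def algebra_simps sum_subtractf)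
    qed
    then have "cnorm m (\<lambda>i. d i - (\<Sum>k<m. M i k * d k)) = cnorm m d"
      by (intro cnorm_cong) simp
    then have "(1 - c) * cnorm m d \<le> 0" using near[OF d] by (simp add: algebra_simps)
    then have "cnorm m d = 0" using c cnorm_nonneg[of m d] by (simp add: mult_le_0_iff)
    then show ?thesis by (auto simp: cnorm_eq_0_iff d_def p_def)
  qed
  then show ?thesis by (intro exI[of _ "\<lambda>i k. Q k i"]) simp
qed

section \<open>Rules for complex differentiability and the family of local right inverses\<close>

definition complex_differentiable_at :: "nat \<Rightarrow> ((nat \<Rightarrow> complex) \<Rightarrow> complex) \<Rightarrow> (nat \<Rightarrow> complex) \<Rightarrow> bool" where
  "complex_differentiable_at n f z \<longleftrightarrow> (\<exists>a. has_complex_gradient n f a z)"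

lemma has_complex_gradient_add:
  assumes z: "z \<in> cspace n" and f: "has_complex_gradient n f a z" and g: "has_complex_gradient n g b z"
  shows "has_complex_gradient n (\<lambda>w. f w + g w) (\<lambda>j. a j + b j) z"
  unfolding has_complex_gradient_iff[OF z]
proof (intro allI impI)
  fix e :: real assume e: "e > 0"
  obtain d1 where d1: "d1 > 0" "\<forall>w\<in>cspace n. cdist n w z < d1 \<longrightarrow>
       cmod (f w - f z - (\<Sum>j<n. a j * (w j - z j))) \<le> e/2 * cdist n w z"
    using f[unfolded has_complex_gradient_iff[OF z], rule_format, OF half_gt_zero[OF e]] by (elim exE conjE)
  obtain d2 where d2: "d2 > 0" "\<forall>w\<in>cspace n. cdist n w z < d2 \<longrightarrow>
       cmod (g w - g z - (\<Sum>j<n. b j * (w j - z j))) \<le> e/2 * cdist n w z"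
    using g[unfolded has_complex_gradient_iff[OF z], rule_format, OF half_gt_zero[OF e]] by (elim exE conjE)
  show "\<exists>\<delta>>0. \<forall>w\<in>cspace n. cdist n w z < \<delta> \<longrightarrow>
       cmod (f w + g w - (f z + g z) - (\<Sum>j<n. (a j + b j) * (w j - z j))) \<le> e * cdist n w z"
  proof (intro exI[of _ "min d1 d2"] conjI ballI impI)
    fix w assume w: "w \<in> cspace n" "cdist n w z < min d1 d2"
    have "f w + g w - (f z + g z) - (\<Sum>j<n. (a j + b j) * (w j - z j))
      = (f w - f z - (\<Sum>j<n. a j * (w j - z j))) + (g w - g z - (\<Sum>j<n. b j * (w j - z j)))"
      by (simp add: distrib_right sum.distrib)
    also have "cmod \<dots> \<le> e/2 * cdist n w z + e/2 * cdist n w z"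
      using w by (intro norm_triangle_le add_mono d1(2)[rule_format] d2(2)[rule_format]) auto
    finally show "cmod (f w + g w - (f z + g z) - (\<Sum>j<n. (a j + b j) * (w j - z j))) \<le> e * cdist n w z"
      by simp
  qed (use d1 d2 in simp)
qed

lemma complex_differentiable_add:
  "z \<in> cspace n \<Longrightarrow> complex_differentiable_at n f z \<Longrightarrow> complex_differentiable_at n g z \<Longrightarrow>
    complex_differentiable_at n (\<lambda>w. f w + g w) z"
  unfolding complex_differentiable_at_def using has_complex_gradient_add by blast

lemma complex_differentiable_const:
  "z \<in> cspace n \<Longrightarrow> complex_differentiable_at n (\<lambda>w. c) z"
  unfolding complex_differentiable_at_def using has_complex_gradient_const by blast

lemma complex_differentiable_coordinate:
  "z \<in> cspace n \<Longrightarrow> complex_differentiable_at n (\<lambda>w. w i) z"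
proof (cases "i < n")
  case False
  assume z: "z \<in> cspace n"
  have "has_complex_gradient n (\<lambda>w. w i) (\<lambda>_. 0) z"
    using False z by (intro has_complex_gradient_cong[OF has_complex_gradient_const[OF z, of 0] z zero_less_one])
       (simp add: cspace_def)
  then show ?thesis unfolding complex_differentiable_at_def by blast
qed (auto simp: complex_differentiable_at_def dest: has_complex_gradient_coordinate)

lemma complex_differentiable_compose:
  assumes z: "z \<in> cspace n"
    and f: "\<And>i. i < m \<Longrightarrow> complex_differentiable_at n (\<lambda>w. f w i) z"
    and g: "complex_differentiable_at m g (f z)"
    and d: "\<delta> > 0" and fm: "\<And>w. w \<in> cspace n \<Longrightarrow> cdist n w z < \<delta> \<Longrightarrow> f w \<in> cspace m"
  shows "complex_differentiable_at n (\<lambda>w. g (f w)) z"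
proof -
  obtain A where "\<And>i. i < m \<Longrightarrow> has_complex_gradient n (\<lambda>w. f w i) (A i) z"
    using f unfolding complex_differentiable_at_def by metis
  moreover obtain b where "has_complex_gradient m g b (f z)"
    using g unfolding complex_differentiable_at_def by blast
  ultimately have "has_complex_gradient n (\<lambda>w. g (f w)) (\<lambda>j. \<Sum>i<m. b i * A i j) z"
    by (rule has_complex_gradient_compose[OF z _ _ d fm])
  then show ?thesis unfolding complex_differentiable_at_def by blast
qed

lemma complex_differentiable_cmult:
  assumes z: "z \<in> cspace n" and f: "complex_differentiable_at n f z"
  shows "complex_differentiable_at n (\<lambda>w. c * f w) z"
proof -
  \<comment> \<open>Multiplication by \<open>c\<close> is a linear form on C^1; \<open>?f\<close> is
    padded with zeros to land in \<open>cspace 1\<close>.\<close>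
  let ?g = "\<lambda>u::nat \<Rightarrow> complex. c * u 0" and ?f = "\<lambda>w i. if i < (1::nat) then f w else 0"
  have "complex_differentiable_at n (\<lambda>w. ?g (?f w)) z"
  proof (rule complex_differentiable_compose[where g = ?g and f = ?f and m=1, OF z _ _ zero_less_one])
    have "has_complex_gradient 1 (\<lambda>u. 0 + (\<Sum>j<1. (\<lambda>_. c) j * u j)) (\<lambda>_. c) (?f z)"
      by (rule has_complex_gradient_linear) (simp add: cspace_def)
    then show "complex_differentiable_at 1 ?g (?f z)"
      unfolding complex_differentiable_at_def by (auto simp: lessThan_Suc)
  qed (use f in \<open>auto simp: cspace_def\<close>)
  then show ?thesis by simp
qed

lemma complex_differentiable_sum:
  assumes z: "z \<in> cspace n" and "finite I" "\<And>i. i \<in> I \<Longrightarrow> complex_differentiable_at n (\<lambda>w. f i w) z"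
  shows "complex_differentiable_at n (\<lambda>w. \<Sum>i\<in>I. f i w) z"
  using assms(2,3)
  by (induction I rule: finite_induct)
     (auto intro: complex_differentiable_add complex_differentiable_const z)

lemma complex_differentiable_diff:
  "z \<in> cspace n \<Longrightarrow> complex_differentiable_at n f z \<Longrightarrow> complex_differentiable_at n g z \<Longrightarrow>
    complex_differentiable_at n (\<lambda>w. f w - g w) z"
  using complex_differentiable_add[of z n f "\<lambda>w. (-1) * g w"] complex_differentiable_cmult[of z n g "-1"]
  by simp

lemma complex_differentiable_cong:
  assumes f: "complex_differentiable_at n f z" and z: "z \<in> cspace n" and d: "\<delta> > 0"
    and eq: "\<And>w. w \<in> cspace n \<Longrightarrow> cdist n w z < \<delta> \<Longrightarrow> f w = g w"
  shows "complex_differentiable_at n g z"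
proof -
  obtain a where "has_complex_gradient n f a z" using f unfolding complex_differentiable_at_def by blast
  then have "has_complex_gradient n g a z" by (rule has_complex_gradient_cong[OF _ z d eq])
  then show ?thesis unfolding complex_differentiable_at_def by blast
qed

lemma complex_differentiable_imp_lipschitz:
  assumes z: "z \<in> cspace n" and f: "\<And>i. i < m \<Longrightarrow> complex_differentiable_at n (\<lambda>w. f w i) z"
  shows "\<exists>C>0. \<exists>\<delta>>0. \<forall>w\<in>cspace n. cdist n w z < \<delta> \<longrightarrow> cdist m (f w) (f z) \<le> C * cdist n w z"
  using gradient_lipschitz_at[OF z, of m f] f unfolding complex_differentiable_at_def by blast

text \<open>
  \<open>S x y\<close> is \<open>x + B v\<close>, where \<open>v\<close> is the small solution of \<open>h (x + B v) = y\<close>: the map \<open>v \<mapsto> v + y - h (x + B v)\<close> is a contraction, because the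
  remainder \<open>h - A\<close> has a small Lipschitz constant near \<open>z0\<close> by the Cauchy estimates.
\<close>

lemma holomorphic_right_inverse_family:
  assumes z0: "z0 \<in> cspace n" and R: "R > 0"
    and hm: "\<And>w. w \<in> cspace n \<Longrightarrow> cdist n w z0 < R \<Longrightarrow> h w \<in> cspace m"
    and hd: "\<And>w i. w \<in> cspace n \<Longrightarrow> cdist n w z0 < R \<Longrightarrow> i < m \<Longrightarrow> complex_differentiable_at n (\<lambda>w. h w i) w"
    and A: "\<And>i. i < m \<Longrightarrow> has_complex_gradient n (\<lambda>w. h w i) (A i) z0"
    and AB: "\<And>i k. i < m \<Longrightarrow> k < m \<Longrightarrow> (\<Sum>j<n. A i j * B j k) = (if k = i then 1 else 0)"
  obtains \<rho> L S where "\<rho> > 0" "L \<ge> 0"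
    "\<And>x y. x \<in> cspace n \<Longrightarrow> y \<in> cspace m \<Longrightarrow> cdist n x z0 < \<rho> \<Longrightarrow> cdist m y (h z0) < \<rho> \<Longrightarrow>
       S x y \<in> cspace n \<and> cdist n (S x y) z0 < R \<and> h (S x y) = y"
    "\<And>x. x \<in> cspace n \<Longrightarrow> cdist n x z0 < \<rho> \<Longrightarrow> cdist m (h x) (h z0) < \<rho> \<Longrightarrow> S x (h x) = x"
    "\<And>x y x' y'. x \<in> cspace n \<Longrightarrow> y \<in> cspace m \<Longrightarrow> cdist n x z0 < \<rho> \<Longrightarrow> cdist m y (h z0) < \<rho> \<Longrightarrow>
       x' \<in> cspace n \<Longrightarrow> y' \<in> cspace m \<Longrightarrow> cdist n x' z0 < \<rho> \<Longrightarrow> cdist m y' (h z0) < \<rho> \<Longrightarrow>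
       cdist n (S x y) (S x' y') \<le> L * (cdist n x x' + cdist m y y')"
    "\<And>k u X Y \<delta> i. u \<in> cspace k \<Longrightarrow> \<delta> > 0 \<Longrightarrow>
       (\<And>w. w \<in> cspace k \<Longrightarrow> cdist k w u < \<delta> \<Longrightarrow> X w \<in> cspace n \<and> Y w \<in> cspace m \<and>
          cdist n (X w) z0 < \<rho> \<and> cdist m (Y w) (h z0) < \<rho>) \<Longrightarrow>
       (\<And>i. i < n \<Longrightarrow> complex_differentiable_at k (\<lambda>w. X w i) u) \<Longrightarrow>
       (\<And>i. i < m \<Longrightarrow> complex_differentiable_at k (\<lambda>w. Y w i) u) \<Longrightarrow>
       i < n \<Longrightarrow> complex_differentiable_at k (\<lambda>w. S (X w) (Y w) i) u"
proof -
  \<comment> \<open>\<open>lin\<close> is the right inverse \<open>B\<close> of the differential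
    \<open>A\<close> at \<open>z0\<close>, truncated to land in \<open>cspace n\<close>;
    \<open>\<beta>\<close> bounds its norm.\<close>
  define lin where "lin = (\<lambda>v j. if j < n then (\<Sum>k<m. B j k * v k) else (0::complex))"
  define \<beta> where "\<beta> = 1 + (\<Sum>j<n. cnorm m (B j))"
  define \<alpha> where "\<alpha> = (\<Sum>i<m. cnorm n (A i))"
  \<comment> \<open>With this \<open>\<eta>\<close> the contraction factor
    \<open>\<eta> * \<beta>\<close> is \<open>1/2\<close>.\<close>
  define \<eta> where "\<eta> = 1 / (2 * \<beta>)"
  have \<beta>: "\<beta> \<ge> 1" unfolding \<beta>_def by (simp add: sum_nonneg)
  have \<alpha>: "\<alpha> \<ge> 0" unfolding \<alpha>_def by (simp add: sum_nonneg)
  have \<eta>: "\<eta> > 0" "\<eta> * \<beta> = 1/2" using \<beta> by (auto simp: \<eta>_def)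
  have lin_cs: "lin v \<in> cspace n" for v by (simp add: lin_def cspace_def)
  have lin_bound: "cnorm n (lin v) \<le> \<beta> * cnorm m v" for v
  proof -
    have "cnorm n (lin v) \<le> (\<Sum>j<n. cmod (lin v j))" by (rule cnorm_le_sum)
    also have "\<dots> \<le> (\<Sum>j<n. cnorm m (B j) * cnorm m v)"
      by (rule sum_mono) (simp add: lin_def cmod_linear_form_le)
    also have "\<dots> \<le> \<beta> * cnorm m v" by (simp add: \<beta>_def distrib_right sum_distrib_right)
    finally show ?thesis .
  qed
  have lin_diff: "lin v j - lin w j = lin (\<lambda>i. v i - w i) j" for v w j
    by (simp add: lin_def right_diff_distrib sum_subtractf)
  have lin_cdist: "cdist n (lin v) (lin w) \<le> \<beta> * cdist m v w" for v w
    unfolding lin_diff by (rule lin_bound)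
  have A_lin: "(\<Sum>j<n. A i j * lin v j) = v i" if "i < m" for i v
  proof -
    have "(\<Sum>j<n. A i j * lin v j) = (\<Sum>j<n. \<Sum>k<m. A i j * B j k * v k)"
      by (simp add: lin_def sum_distrib_left mult.assoc)
    also have "\<dots> = (\<Sum>k<m. (\<Sum>j<n. A i j * B j k) * v k)"
      by (subst sum.swap) (simp add: sum_distrib_right)
    also have "\<dots> = v i"
      using AB that by (simp add: if_distrib[of "\<lambda>x. x * _"] cong: if_cong)
    finally show ?thesis .
  qed
  have "\<exists>\<rho>>0. \<forall>v\<in>cspace n. \<forall>w\<in>cspace n. cdist n v z0 < \<rho> \<longrightarrow> cdist n w z0 < \<rho> \<longrightarrow>
     cnorm m (\<lambda>i. h w i - h v i - (\<Sum>j<n. A i j * (w j - v j))) \<le> \<eta> * cdist n w v"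
    by (rule holomorphic_map_remainder_lipschitz[OF z0 R _ A \<eta>(1)])
       (use hd in \<open>simp add: complex_differentiable_at_def\<close>)
  then obtain \<rho>0 where \<rho>0: "\<rho>0 > 0" "\<forall>v\<in>cspace n. \<forall>w\<in>cspace n. cdist n v z0 < \<rho>0 \<longrightarrow> cdist n w z0 < \<rho>0 \<longrightarrow>
     cnorm m (\<lambda>i. h w i - h v i - (\<Sum>j<n. A i j * (w j - v j))) \<le> \<eta> * cdist n w v" by (elim exE conjE)
  define \<rho>1 where "\<rho>1 = min \<rho>0 R"
  have \<rho>1: "\<rho>1 > 0" "\<rho>1 \<le> R" "\<rho>1 \<le> \<rho>0" using \<rho>0 R by (auto simp: \<rho>1_def)
  have rem: "cnorm m (\<lambda>i. h w i - h v i - (\<Sum>j<n. A i j * (w j - v j))) \<le> \<eta> * cdist n w v"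
    if "v \<in> cspace n" "w \<in> cspace n" "cdist n v z0 < \<rho>1" "cdist n w z0 < \<rho>1" for v w
    using that \<rho>1 by (intro \<rho>0(2)[rule_format]) auto
  define L2 where "L2 = \<eta> + \<alpha>"
  have L2: "L2 \<ge> 0" using \<eta> \<alpha> by (simp add: L2_def)
  have h_lip: "cdist m (h w) (h v) \<le> L2 * cdist n w v"
    if "v \<in> cspace n" "w \<in> cspace n" "cdist n v z0 < \<rho>1" "cdist n w z0 < \<rho>1" for v w
  proof -
    have "cdist m (h w) (h v) \<le> cnorm m (\<lambda>i. h w i - h v i - (\<Sum>j<n. A i j * (w j - v j)))
        + cnorm m (\<lambda>i. \<Sum>j<n. A i j * (w j - v j))"
      using cnorm_triangle[of m "\<lambda>i. h w i - h v i - (\<Sum>j<n. A i j * (w j - v j))" "\<lambda>i. \<Sum>j<n. A i j * (w j - v j)"]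
      by simp
    also have "cnorm m (\<lambda>i. \<Sum>j<n. A i j * (w j - v j)) \<le> (\<Sum>i<m. cnorm n (A i) * cdist n w v)"
      by (rule order_trans[OF cnorm_le_sum]) (intro sum_mono cmod_linear_form_le)
    also have "\<dots> = \<alpha> * cdist n w v" by (simp add: \<alpha>_def sum_distrib_right)
    finally show ?thesis using rem[OF that] by (simp add: L2_def distrib_right)
  qed
  \<comment> \<open>Vectors of norm up to \<open>2 * s\<close> still give points
    \<open>x + lin v\<close> at distance less than \<open>\<rho>1\<close> from \<open>z0\<close>.
    The solutions have norm at most \<open>s\<close>; the factor two leaves room to perturb them in
    the differentiability argument.\<close>
  define s where "s = \<rho>1 / (4 * \<beta>)"
  have s: "s > 0" "\<beta> * s = \<rho>1 / 4" using \<rho>1 \<beta> by (auto simp: s_def)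
  \<comment> \<open>At \<open>v = 0\<close> the map has norm at most
    \<open>\<rho> * (1 + L2) <= s/2\<close>, and the contraction adds at most \<open>s/2\<close>, so
    the ball of radius \<open>s\<close> is preserved.\<close>
  define \<rho> where "\<rho> = min (\<rho>1 / 4) (s / (2 * (1 + L2)))"
  have \<rho>: "\<rho> > 0" "\<rho> \<le> \<rho>1 / 4" "\<rho> * (1 + L2) \<le> s / 2"
  proof -
    show "\<rho> > 0" "\<rho> \<le> \<rho>1 / 4" using s \<rho>1 L2 by (auto simp: \<rho>_def)
    have "\<rho> \<le> s / (2 * (1 + L2))" by (simp add: \<rho>_def)
    then show "\<rho> * (1 + L2) \<le> s / 2" using L2 by (simp add: field_simps)
  qed
  let ?pt = "\<lambda>x v j. x j + lin v j"
  have pt_cs: "?pt x v \<in> cspace n" if "x \<in> cspace n" for x v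
    using that lin_cs[of v] by (simp add: cspace_def)
  have pt_ball: "cdist n (?pt x v) z0 < \<rho>1" if "cdist n x z0 < \<rho>" "cnorm m v \<le> 2 * s" for x v
  proof -
    have "cdist n (?pt x v) z0 \<le> cdist n x z0 + cnorm n (lin v)"
      using cnorm_triangle[of n "\<lambda>j. x j - z0 j" "lin v"] by (simp add: algebra_simps)
    also have "cnorm n (lin v) \<le> \<beta> * (2 * s)"
      using lin_bound[of v] mult_left_mono[OF that(2), of \<beta>] \<beta> by linarith
    finally show ?thesis using that(1) \<rho> s \<rho>1 by simp
  qed
  define \<Theta> where "\<Theta> = (\<lambda>x y v i. v i + y i - h (?pt x v) i)"
  have \<Theta>_lip: "cdist m (\<Theta> x y v) (\<Theta> x y w) \<le> 1/2 * cdist m v w"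
    if x: "x \<in> cspace n" "cdist n x z0 < \<rho>" and v: "cnorm m v \<le> 2 * s" and w: "cnorm m w \<le> 2 * s"
    for x y v w
  proof -
    have "cdist m (\<Theta> x y v) (\<Theta> x y w) =
      cnorm m (\<lambda>i. - (h (?pt x v) i - h (?pt x w) i - (\<Sum>j<n. A i j * (?pt x v j - ?pt x w j))))"
    proof (rule cnorm_cong)
      fix i assume i: "i < m"
      have "(\<Sum>j<n. A i j * (?pt x v j - ?pt x w j)) = v i - w i"
        using A_lin[OF i, of "\<lambda>i. v i - w i"] by (simp add: lin_diff)
      then show "\<Theta> x y v i - \<Theta> x y w i =
        - (h (?pt x v) i - h (?pt x w) i - (\<Sum>j<n. A i j * (?pt x v j - ?pt x w j)))"
        by (simp add: \<Theta>_def)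
    qed
    also have "\<dots> \<le> \<eta> * cdist n (?pt x v) (?pt x w)"
      unfolding cnorm_minus using x v w by (intro rem pt_cs pt_ball)
    also have "\<dots> \<le> \<eta> * (\<beta> * cdist m v w)"
      using lin_cdist[of v w] \<eta> by (intro mult_left_mono) auto
    also have "\<dots> = 1/2 * cdist m v w" using \<eta>(2) by (simp add: mult.assoc[symmetric])
    finally show ?thesis .
  qed
  have \<Theta>_cs: "\<Theta> x y v \<in> cspace m"
    if x: "x \<in> cspace n" "cdist n x z0 < \<rho>" "y \<in> cspace m" "v \<in> cspace m" "cnorm m v \<le> 2 * s" for x y v
  proof -
    have "h (?pt x v) \<in> cspace m"
      using pt_ball[OF x(2) x(5)] \<rho>1 by (intro hm pt_cs x) auto
    then show ?thesis using x by (simp add: \<Theta>_def cspace_def)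
  qed
  have fix_exists: "\<exists>v \<in> cspace_cball m s. \<Theta> x y v = v"
    if x: "x \<in> cspace n" "cdist n x z0 < \<rho>" and y: "y \<in> cspace m" "cdist m y (h z0) < \<rho>" for x y
  proof (rule cspace_contraction_fixpoint)
    fix v assume v: "v \<in> cspace_cball m s"
    have v': "v \<in> cspace m" "cnorm m v \<le> s" "cnorm m v \<le> 2 * s" using v s by (auto simp: cspace_cball_def)
    have lin0: "lin (\<lambda>_. 0) = (\<lambda>_. 0)" by (simp add: lin_def fun_eq_iff)
    have "cnorm m (\<Theta> x y (\<lambda>_. 0)) = cdist m y (h x)" by (simp add: \<Theta>_def lin0)
    also have "\<dots> \<le> cdist m y (h z0) + cdist m (h z0) (h x)" by (rule cdist_triangle)
    also have "cdist m (h z0) (h x) \<le> L2 * cdist n z0 x"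
      using x \<rho> \<rho>1 z0 by (intro h_lip) auto
    also have "\<dots> \<le> L2 * \<rho>" using x L2 cdist_commute[of n z0 x] by (intro mult_left_mono) auto
    finally have 0: "cnorm m (\<Theta> x y (\<lambda>_. 0)) \<le> s / 2" using y \<rho>(3) by (simp add: algebra_simps)
    have "cnorm m (\<Theta> x y v) \<le> cdist m (\<Theta> x y v) (\<Theta> x y (\<lambda>_. 0)) + cnorm m (\<Theta> x y (\<lambda>_. 0))"
      by (rule cnorm_triangle_diff)
    also have "cdist m (\<Theta> x y v) (\<Theta> x y (\<lambda>_. 0)) \<le> 1/2 * cdist m v (\<lambda>_. 0)"
      using x v' s by (intro \<Theta>_lip) auto
    finally have "cnorm m (\<Theta> x y v) \<le> s" using v' 0 by simp
    then show "\<Theta> x y v \<in> cspace_cball m s" using \<Theta>_cs[OF x y(1) v'(1,3)] by (simp add: cspace_cball_def)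
    fix w assume "w \<in> cspace_cball m s"
    then show "cdist m (\<Theta> x y v) (\<Theta> x y w) \<le> 1/2 * cdist m v w"
      using v' s x by (intro \<Theta>_lip) (auto simp: cspace_cball_def)
  qed (use s in auto)
  define V where "V = (\<lambda>x y. SOME v. v \<in> cspace_cball m s \<and> \<Theta> x y v = v)"
  define S where "S = (\<lambda>x y. ?pt x (V x y))"
  have V: "V x y \<in> cspace m" "cnorm m (V x y) \<le> s" "\<Theta> x y (V x y) = V x y"
    if "x \<in> cspace n" "cdist n x z0 < \<rho>" "y \<in> cspace m" "cdist m y (h z0) < \<rho>" for x y
  proof -
    have "\<exists>v. v \<in> cspace_cball m s \<and> \<Theta> x y v = v" using fix_exists[OF that] by blast
    from someI_ex[OF this] show "V x y \<in> cspace m" "cnorm m (V x y) \<le> s" "\<Theta> x y (V x y) = V x y"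
      unfolding V_def cspace_cball_def by auto
  qed
  \<comment> \<open>Half of the distance returns from the contraction and is absorbed on the left,
    which produces the factor \<open>2\<close>.\<close>
  have V_lip: "cdist m (V x y) (V x' y') \<le> 2 * (cdist m y y' + L2 * cdist n x x')"
    if x: "x \<in> cspace n" "cdist n x z0 < \<rho>" and y: "y \<in> cspace m" "cdist m y (h z0) < \<rho>"
      and x': "x' \<in> cspace n" "cdist n x' z0 < \<rho>" and y': "y' \<in> cspace m" "cdist m y' (h z0) < \<rho>"
    for x y x' y'
  proof -
    let ?v = "V x y" and ?w = "V x' y'"
    have n: "cnorm m ?v \<le> 2 * s" "cnorm m ?w \<le> 2 * s"
      using V(2)[OF x y] V(2)[OF x' y'] s by auto
    have "cdist m ?v ?w = cdist m (\<Theta> x y ?v) (\<Theta> x' y' ?w)"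
      using V(3)[OF x y] V(3)[OF x' y'] by simp
    also have "\<dots> \<le> cdist m (\<Theta> x y ?v) (\<Theta> x y ?w) + cdist m (\<Theta> x y ?w) (\<Theta> x' y' ?w)"
      by (rule cdist_triangle)
    also have "cdist m (\<Theta> x y ?v) (\<Theta> x y ?w) \<le> 1/2 * cdist m ?v ?w"
      using x n by (intro \<Theta>_lip)
    also have "cdist m (\<Theta> x y ?w) (\<Theta> x' y' ?w) = cnorm m (\<lambda>i. (y i - y' i) + (- (h (?pt x ?w) i - h (?pt x' ?w) i)))"
      by (simp add: \<Theta>_def algebra_simps)
    also have "\<dots> \<le> cdist m y y' + cdist m (h (?pt x ?w)) (h (?pt x' ?w))"
      using cnorm_triangle[of m "\<lambda>i. y i - y' i" "\<lambda>i. - (h (?pt x ?w) i - h (?pt x' ?w) i)"]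
      by (simp only: cnorm_minus)
    also have "cdist m (h (?pt x ?w)) (h (?pt x' ?w)) \<le> L2 * cdist n (?pt x ?w) (?pt x' ?w)"
      using x x' n by (intro h_lip pt_cs pt_ball)
    also have "\<dots> = L2 * cdist n x x'" by simp
    finally show ?thesis by simp
  qed
  have S_cs: "S x y \<in> cspace n" "cdist n (S x y) z0 < \<rho>1" "h (S x y) = y"
    if x: "x \<in> cspace n" "cdist n x z0 < \<rho>" and y: "y \<in> cspace m" "cdist m y (h z0) < \<rho>" for x y
  proof -
    show "S x y \<in> cspace n" unfolding S_def by (rule pt_cs[OF x(1)])
    show "cdist n (S x y) z0 < \<rho>1" unfolding S_def using V(2)[OF x y] s by (intro pt_ball x) auto
    have "\<Theta> x y (V x y) i = V x y i" for i using V(3)[OF x y] by simp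
    then show "h (S x y) = y" by (simp add: \<Theta>_def S_def fun_eq_iff)
  qed
  define L where "L = 1 + \<beta> * (2 * (1 + L2))"
  have S_lip: "cdist n (S x y) (S x' y') \<le> L * (cdist n x x' + cdist m y y')"
    if "x \<in> cspace n" "cdist n x z0 < \<rho>" "y \<in> cspace m" "cdist m y (h z0) < \<rho>"
       "x' \<in> cspace n" "cdist n x' z0 < \<rho>" "y' \<in> cspace m" "cdist m y' (h z0) < \<rho>"
    for x y x' y'
  proof -
    let ?a = "cdist n x x'" and ?b = "cdist m y y'"
    have "cdist n (S x y) (S x' y') \<le> ?a + cdist n (lin (V x y)) (lin (V x' y'))"
      using cnorm_triangle[of n "\<lambda>j. x j - x' j" "\<lambda>j. lin (V x y) j - lin (V x' y') j"]
      by (simp add: S_def algebra_simps)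
    also have "cdist n (lin (V x y)) (lin (V x' y')) \<le> \<beta> * cdist m (V x y) (V x' y')" by (rule lin_cdist)
    also have "\<dots> \<le> \<beta> * (2 * (?b + L2 * ?a))"
      using V_lip[OF that] \<beta> by (intro mult_left_mono) auto
    also have "\<dots> \<le> \<beta> * (2 * ((1 + L2) * (?a + ?b)))"
      using \<beta> L2 by (intro mult_left_mono) (auto simp: algebra_simps)
    finally have "cdist n (S x y) (S x' y') \<le> ?a + \<beta> * (2 * ((1 + L2) * (?a + ?b)))" by simp
    also have "\<dots> \<le> L * (?a + ?b)" by (simp add: L_def algebra_simps)
    finally show ?thesis .
  qed
  show thesis
  proof (rule that)
    show "\<rho> > 0" by fact
    show "L \<ge> 0" using \<beta> L2 by (simp add: L_def)
    fix x y assume xy: "x \<in> cspace n" "y \<in> cspace m" "cdist n x z0 < \<rho>" "cdist m y (h z0) < \<rho>"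
    show "S x y \<in> cspace n \<and> cdist n (S x y) z0 < R \<and> h (S x y) = y"
      using S_cs[OF xy(1,3,2,4)] \<rho>1 by auto
    fix x' y' assume xy': "x' \<in> cspace n" "y' \<in> cspace m" "cdist n x' z0 < \<rho>" "cdist m y' (h z0) < \<rho>"
    show "cdist n (S x y) (S x' y') \<le> L * (cdist n x x' + cdist m y y')"
      by (rule S_lip) fact+
  next
    fix x assume x: "x \<in> cspace n" "cdist n x z0 < \<rho>" "cdist m (h x) (h z0) < \<rho>"
    have hx: "h x \<in> cspace m" using x \<rho> \<rho>1 by (intro hm) auto
    let ?v = "V x (h x)"
    have lin0: "lin (\<lambda>_. 0) = (\<lambda>_. 0)" by (simp add: lin_def fun_eq_iff)
    \<comment> \<open>For \<open>y = h x\<close> the zero vector is a fixed point too, so the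
      contraction forces the chosen one to have norm zero.\<close>
    have "cdist m ?v (\<lambda>_. 0) = cdist m (\<Theta> x (h x) ?v) (\<Theta> x (h x) (\<lambda>_. 0))"
      using V(3)[OF x(1,2) hx x(3)] by (simp add: \<Theta>_def lin0)
    also have "\<dots> \<le> 1/2 * cdist m ?v (\<lambda>_. 0)"
      using V(2)[OF x(1,2) hx x(3)] s x by (intro \<Theta>_lip) auto
    finally have "cnorm m ?v \<le> 0" by simp
    then have "cnorm m ?v = 0" using cnorm_nonneg[of m ?v] by linarith
    then have "lin ?v = (\<lambda>_. 0)" by (simp add: cnorm_eq_0_iff lin_def fun_eq_iff)
    then show "S x (h x) = x" by (simp add: S_def)
  next
    fix k u X Y \<delta> i
    assume u: "u \<in> cspace k" and \<delta>: "\<delta> > 0"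
      and XY: "\<And>w. w \<in> cspace k \<Longrightarrow> cdist k w u < \<delta> \<Longrightarrow> X w \<in> cspace n \<and> Y w \<in> cspace m \<and>
          cdist n (X w) z0 < \<rho> \<and> cdist m (Y w) (h z0) < \<rho>"
      and X: "\<And>i. i < n \<Longrightarrow> complex_differentiable_at k (\<lambda>w. X w i) u"
      and Y: "\<And>i. i < m \<Longrightarrow> complex_differentiable_at k (\<lambda>w. Y w i) u" and i: "i < n"
    define v where "v = (\<lambda>w. V (X w) (Y w))"
    define p where "p = (\<lambda>w. S (X w) (Y w))"
    have pv: "p w = ?pt (X w) (v w)" for w by (simp add: p_def v_def S_def)
    have XY0: "X u \<in> cspace n" "Y u \<in> cspace m" "cdist n (X u) z0 < \<rho>" "cdist m (Y u) (h z0) < \<rho>"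
      using XY[OF u] \<delta> by auto
    have p0: "p u \<in> cspace n" "cdist n (p u) z0 < \<rho>1"
      using S_cs[OF XY0(1,3,2,4)] by (auto simp: p_def)
    have "\<exists>a. has_complex_gradient n (\<lambda>w. h w j) a (p u)" if "j < m" for j
      using hd[OF p0(1), of j] p0 \<rho>1 that by (auto simp: complex_differentiable_at_def)
    then obtain A' where A': "\<And>j. j < m \<Longrightarrow> has_complex_gradient n (\<lambda>w. h w j) (A' j) (p u)"
      by metis
    define M where "M = (\<lambda>j k. \<Sum>l<n. A' j l * B l k)"
    have M_lin: "(\<Sum>k<m. M j k * q k) = (\<Sum>l<n. A' j l * lin q l)" for j q
    proof -
      have "(\<Sum>l<n. A' j l * lin q l) = (\<Sum>l<n. \<Sum>k<m. A' j l * B l k * q k)"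
        by (simp add: lin_def sum_distrib_left mult.assoc)
      also have "\<dots> = (\<Sum>k<m. M j k * q k)"
        by (subst sum.swap) (simp add: sum_distrib_right M_def)
      finally show ?thesis by simp
    qed
    \<comment> \<open>\<open>I - M\<close> is the differential of \<open>\<Theta>\<close> in
      \<open>v\<close> at the solution. Its difference quotient is at most \<open>1/2\<close> by the
      contraction estimate, and replacing \<open>h\<close> by its differential \<open>A'\<close> at
      \<open>p u\<close> costs at most \<open>1/4\<close>.\<close>
    have near: "cnorm m (\<lambda>i. q i - (\<Sum>k<m. M i k * q k)) \<le> 3/4 * cnorm m q" if q: "q \<in> cspace m" for q
    proof -
      have e: "1 / (4 * \<beta>) > 0" using \<beta> by simp
      have "\<exists>\<delta>>0. \<forall>w\<in>cspace n. cdist n w (p u) < \<delta> \<longrightarrow>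
         cnorm m (\<lambda>i. h w i - h (p u) i - (\<Sum>j<n. A' i j * (w j - p u j))) \<le> 1 / (4 * \<beta>) * cdist n w (p u)"
        by (rule jacobian_estimate[OF p0(1) A' e])
      then obtain d where d: "d > 0" "\<forall>w\<in>cspace n. cdist n w (p u) < d \<longrightarrow>
         cnorm m (\<lambda>i. h w i - h (p u) i - (\<Sum>j<n. A' i j * (w j - p u j))) \<le> 1 / (4 * \<beta>) * cdist n w (p u)"
        by (elim exE conjE)
      define Q where "Q = cnorm m q + 1"
      have Q: "Q > 0" unfolding Q_def using cnorm_nonneg[of m q] by linarith
      \<comment> \<open>\<open>t\<close> is so small that \<open>v u\<close> perturbed by
        \<open>t\<close> times \<open>q\<close> keeps norm at most \<open>2 * s\<close>, and the
        moved point lies within \<open>d\<close> of \<open>p u\<close>.\<close>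
      define t where "t = min (s / Q) (d / (2 * \<beta> * Q))"
      have t: "t > 0" using s d Q \<beta> by (simp add: t_def)
      have tq: "t * cnorm m q \<le> t * Q" using t by (simp add: Q_def)
      have ts: "t * cnorm m q \<le> s"
      proof -
        have "t * Q \<le> s" using Q by (simp add: t_def min_def field_simps split: if_splits)
        with tq show ?thesis by linarith
      qed
      have td: "\<beta> * (t * cnorm m q) < d"
      proof -
        have "t \<le> d / (2 * \<beta> * Q)" by (simp add: t_def)
        then have "\<beta> * (t * Q) \<le> d / 2" using Q \<beta> by (simp add: field_simps)
        moreover have "\<beta> * (t * cnorm m q) \<le> \<beta> * (t * Q)" using mult_left_mono[OF tq, of \<beta>] \<beta> by linarith
        ultimately show ?thesis using d by linarith
      qed
      define q' where "q' = (\<lambda>i. of_real t * q i)"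
      define v' where "v' = (\<lambda>i. v u i + q' i)"
      have nq': "cnorm m q' = t * cnorm m q" using t by (simp add: q'_def cnorm_scale)
      have vs: "cnorm m (v u) \<le> s" using V(2)[OF XY0(1,3,2,4)] by (simp add: v_def)
      have v's: "cnorm m v' \<le> 2 * s"
        using cnorm_triangle[of m "v u" q'] nq' ts vs by (simp add: v'_def)
      define w' where "w' = ?pt (X u) v'"
      have w': "w' \<in> cspace n" unfolding w'_def by (rule pt_cs[OF XY0(1)])
      have w'p: "w' j - p u j = lin q' j" for j
        using lin_diff[of v' j "v u"] by (simp add: w'_def pv v'_def)
      have cw': "cdist n w' (p u) \<le> \<beta> * (t * cnorm m q)"
        unfolding w'p using lin_bound[of q'] nq' by simp
      have e1: "cnorm m (\<lambda>i. h w' i - h (p u) i - (\<Sum>j<n. A' i j * lin q' j)) \<le> 1/4 * (t * cnorm m q)"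
      proof -
        have "cnorm m (\<lambda>i. h w' i - h (p u) i - (\<Sum>j<n. A' i j * (w' j - p u j))) \<le> 1 / (4 * \<beta>) * cdist n w' (p u)"
          using cw' td by (intro d(2)[rule_format] w') simp
        also have "\<dots> \<le> 1 / (4 * \<beta>) * (\<beta> * (t * cnorm m q))"
          using cw' \<beta> by (intro mult_left_mono) auto
        also have "\<dots> = 1/4 * (t * cnorm m q)" using \<beta> by simp
        finally show ?thesis unfolding w'p .
      qed
      have e2: "cnorm m (\<lambda>i. q' i - (h w' i - h (p u) i)) \<le> 1/2 * (t * cnorm m q)"
      proof -
        have "cnorm m (\<lambda>i. q' i - (h w' i - h (p u) i)) = cdist m (\<Theta> (X u) (Y u) v') (\<Theta> (X u) (Y u) (v u))"
          by (rule cnorm_cong) (simp add: \<Theta>_def w'_def pv v'_def)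
        also have "\<dots> \<le> 1/2 * cdist m v' (v u)" using v's vs s by (intro \<Theta>_lip XY0) auto
        also have "cdist m v' (v u) = t * cnorm m q" using nq' by (simp add: v'_def)
        finally show ?thesis .
      qed
      have "t * cnorm m (\<lambda>i. q i - (\<Sum>k<m. M i k * q k)) = cnorm m (\<lambda>i. of_real t * (q i - (\<Sum>k<m. M i k * q k)))"
        using t by (subst cnorm_scale) simp
      also have "\<dots> = cnorm m (\<lambda>i. q' i - (\<Sum>k<m. M i k * q' k))"
        by (rule cnorm_cong) (simp add: q'_def right_diff_distrib sum_distrib_left mult.left_commute)
      also have "\<dots> = cnorm m (\<lambda>i. (q' i - (h w' i - h (p u) i)) + (h w' i - h (p u) i - (\<Sum>j<n. A' i j * lin q' j)))"
        by (rule cnorm_cong) (simp add: M_lin)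
      also have "\<dots> \<le> 1/2 * (t * cnorm m q) + 1/4 * (t * cnorm m q)"
        by (rule order_trans[OF cnorm_triangle add_mono[OF e2 e1]])
      also have "\<dots> = t * (3/4 * cnorm m q)" by simp
      finally show ?thesis using t by (simp only: mult_le_cancel_left_pos)
    qed
    have "\<exists>C. \<forall>q\<in>cspace m. \<forall>i<m. (\<Sum>k<m. C i k * (\<Sum>l<m. M k l * q l)) = q i"
      by (rule near_identity_left_inverse[OF near]) auto
    then obtain C where C: "\<forall>q\<in>cspace m. \<forall>i<m. (\<Sum>k<m. C i k * (\<Sum>l<m. M k l * q l)) = q i" by blast
    \<comment> \<open>Since \<open>Y w = h (p w)\<close>, this is the error of linearizing
      \<open>h\<close> at \<open>p u\<close>. It is of smaller order than the distance of
      \<open>w\<close> and \<open>u\<close>, because \<open>p\<close> is Lipschitz at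
      \<open>u\<close>; hence it is differentiable at \<open>u\<close> with zero gradient.\<close>
    define r where "r = (\<lambda>w k. Y w k - Y u k - (\<Sum>j<n. A' k j * (p w j - p u j)))"
    have hp: "h (p w) = Y w" if "w \<in> cspace k" "cdist k w u < \<delta>" for w
      unfolding p_def using XY[OF that] by (intro S_cs) auto
    have p_lip: "\<exists>K>0. \<exists>d>0. \<forall>w\<in>cspace k. cdist k w u < d \<longrightarrow> cdist n (p w) (p u) \<le> K * cdist k w u"
    proof -
      obtain K1 d1 where 1: "K1 > 0" "d1 > 0" "\<forall>w\<in>cspace k. cdist k w u < d1 \<longrightarrow> cdist n (X w) (X u) \<le> K1 * cdist k w u"
        using complex_differentiable_imp_lipschitz[of u k n X, OF u] X by auto
      obtain K2 d2 where 2: "K2 > 0" "d2 > 0" "\<forall>w\<in>cspace k. cdist k w u < d2 \<longrightarrow> cdist m (Y w) (Y u) \<le> K2 * cdist k w u"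
        using complex_differentiable_imp_lipschitz[of u k m Y, OF u] Y by auto
      have L: "L > 0" using \<beta> L2 by (simp add: L_def add_pos_nonneg)
      show ?thesis
      proof (rule exI[of _ "L * (K1 + K2)"], rule conjI)
        show "\<exists>d>0. \<forall>w\<in>cspace k. cdist k w u < d \<longrightarrow> cdist n (p w) (p u) \<le> L * (K1 + K2) * cdist k w u"
      proof (intro exI[of _ "min \<delta> (min d1 d2)"] conjI ballI impI)
        fix w assume w: "w \<in> cspace k" "cdist k w u < min \<delta> (min d1 d2)"
        have "cdist n (p w) (p u) \<le> L * (cdist n (X w) (X u) + cdist m (Y w) (Y u))"
          unfolding p_def using XY[of w] w XY0 by (intro S_lip) auto
        also have "\<dots> \<le> L * (K1 * cdist k w u + K2 * cdist k w u)"
          using w L by (intro mult_left_mono add_mono 1(3)[rule_format] 2(3)[rule_format]) auto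
        finally show "cdist n (p w) (p u) \<le> L * (K1 + K2) * cdist k w u" by (simp add: algebra_simps)
      qed (use 1 2 \<delta> in auto)
      qed (use L 1 2 in simp)
    qed
    then obtain K dK where K: "K > 0" "dK > 0" "\<forall>w\<in>cspace k. cdist k w u < dK \<longrightarrow> cdist n (p w) (p u) \<le> K * cdist k w u"
      by (elim exE conjE)
    have r_diff: "complex_differentiable_at k (\<lambda>w. r w l) u" if l: "l < m" for l
    proof -
      have r0: "r u l = 0" by (simp add: r_def)
      have "has_complex_gradient k (\<lambda>w. r w l) (\<lambda>_. 0) u"
        unfolding has_complex_gradient_iff[OF u]
      proof (intro allI impI)
        fix e :: real assume e: "e > 0"
        obtain d where d: "d > 0" "\<forall>w\<in>cspace n. cdist n w (p u) < d \<longrightarrow>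
          cmod (h w l - h (p u) l - (\<Sum>j<n. A' l j * (w j - p u j))) \<le> e / K * cdist n w (p u)"
          using A'[OF l, unfolded has_complex_gradient_iff[OF p0(1)], rule_format, OF divide_pos_pos[OF e K(1)]]
          by (elim exE conjE)
        show "\<exists>\<delta>>0. \<forall>w\<in>cspace k. cdist k w u < \<delta> \<longrightarrow>
           cmod (r w l - r u l - (\<Sum>j<k. 0 * (w j - u j))) \<le> e * cdist k w u"
        proof (intro exI[of _ "min \<delta> (min dK (d / K))"] conjI ballI impI)
          fix w assume w: "w \<in> cspace k" "cdist k w u < min \<delta> (min dK (d / K))"
          have pw: "p w \<in> cspace n" unfolding p_def using XY[of w] w by (intro S_cs) auto
          have le: "cdist n (p w) (p u) \<le> K * cdist k w u" using w by (intro K(3)[rule_format]) auto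
          also have "\<dots> < d" using w K by (simp add: field_simps)
          finally have lt: "cdist n (p w) (p u) < d" .
          have "r w l = h (p w) l - h (p u) l - (\<Sum>j<n. A' l j * (p w j - p u j))"
            using hp[OF w(1)] hp[OF u] w \<delta> by (simp add: r_def)
          then have "cmod (r w l) \<le> e / K * cdist n (p w) (p u)"
            using d(2)[rule_format, OF pw lt] by simp
          also have "\<dots> \<le> e / K * (K * cdist k w u)" using le e K by (intro mult_left_mono) auto
          finally show "cmod (r w l - r u l - (\<Sum>j<k. 0 * (w j - u j))) \<le> e * cdist k w u"
            using K r0 by simp
        qed (use \<delta> K d in auto)
      qed
      then show ?thesis unfolding complex_differentiable_at_def by blast
    qed
    \<comment> \<open>Implicit differentiation: \<open>p w = X w + lin (v w)\<close> turns the
      definition of \<open>r\<close> into a linear equation for \<open>M\<close> applied to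
      \<open>v w\<close>, and the left inverse \<open>C\<close> then expresses \<open>v\<close> by
      differentiable functions.\<close>
    define c where "c = (\<lambda>k. \<Sum>j<n. A' k j * p u j)"
    have v_diff: "complex_differentiable_at k (\<lambda>w. v w l) u" if l: "l < m" for l
    proof (rule complex_differentiable_cong[OF _ u \<delta>])
      show "complex_differentiable_at k
        (\<lambda>w. \<Sum>a<m. C l a * (Y w a - (Y u a + r w a) + c a - (\<Sum>j<n. A' a j * X w j))) u"
        using X Y r_diff
        by (intro complex_differentiable_sum complex_differentiable_cmult complex_differentiable_diff
            complex_differentiable_add complex_differentiable_const u) auto
      fix w assume w: "w \<in> cspace k" "cdist k w u < \<delta>"
      have "Y w a - (Y u a + r w a) + c a - (\<Sum>j<n. A' a j * X w j) = (\<Sum>b<m. M a b * v w b)" for a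
        unfolding M_lin r_def c_def pv[of w]
        by (simp add: algebra_simps sum.distrib sum_subtractf)
      moreover have "v w \<in> cspace m" unfolding v_def using XY[OF w] by (intro V) auto
      ultimately show "(\<Sum>a<m. C l a * (Y w a - (Y u a + r w a) + c a - (\<Sum>j<n. A' a j * X w j))) = v w l"
        using C l by simp
    qed
    have "complex_differentiable_at k (\<lambda>w. X w i + (\<Sum>l<m. B i l * v w l)) u"
      using X[OF i] v_diff
      by (intro complex_differentiable_sum complex_differentiable_cmult complex_differentiable_add u) auto
    moreover have "(\<lambda>w. S (X w) (Y w) i) = (\<lambda>w. X w i + (\<Sum>l<m. B i l * v w l))"
      using i by (simp add: S_def v_def lin_def)
    ultimately show "complex_differentiable_at k (\<lambda>w. S (X w) (Y w) i) u" by simp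
  qed
qed

section \<open>Holomorphic maps in charts\<close>

text \<open>Outside \<open>V\<close> the chart \<open>\<psi>\<close> carries no meaning, so this
  pointwise condition is informative only together with continuity of \<open>f\<close> near
  \<open>x\<close>, with which \<open>holomorphic_map_on_iff\<close> pairs it.\<close>

definition holomorphic_at :: "'a charted_space \<Rightarrow> 'b charted_space \<Rightarrow> ('a \<Rightarrow> 'b) \<Rightarrow> 'a \<Rightarrow> bool" where
  "holomorphic_at M N f x \<longleftrightarrow>
     (\<forall>(n, U, \<phi>) \<in> charts M. x \<in> U \<longrightarrow> (\<forall>(m, V, \<psi>) \<in> charts N. f x \<in> V \<longrightarrow>
        (\<forall>i<m. complex_differentiable_at n (\<lambda>z. \<psi> (f (inv_into U \<phi> z)) i) (\<phi> x))))"

lemma manifold_chart: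
  assumes "complex_manifold M" "(n, U, \<phi>) \<in> charts M"
  shows "openin (mtop M) U" "openin (top_of_set (cspace n)) (\<phi> ` U)"
    "homeomorphic_map (subtopology (mtop M) U) (top_of_set (\<phi> ` U)) \<phi>"
    "inj_on \<phi> U" "\<phi> ` U \<subseteq> cspace n" "U \<subseteq> points M"
proof -
  show 1: "openin (mtop M) U" "openin (top_of_set (cspace n)) (\<phi> ` U)"
    "homeomorphic_map (subtopology (mtop M) U) (top_of_set (\<phi> ` U)) \<phi>"
  proof -
    have "\<forall>(n, U, \<phi>) \<in> charts M.
        openin (mtop M) U \<and> openin (top_of_set (cspace n)) (\<phi> ` U) \<and>
        homeomorphic_map (subtopology (mtop M) U) (top_of_set (\<phi> ` U)) \<phi>"
      using assms(1) unfolding complex_manifold_def by (elim conjE)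
    from bspec[OF this assms(2)] show "openin (mtop M) U" "openin (top_of_set (cspace n)) (\<phi> ` U)"
      "homeomorphic_map (subtopology (mtop M) U) (top_of_set (\<phi> ` U)) \<phi>" by simp_all
  qed
  show U: "U \<subseteq> points M" using 1(1) openin_subset by blast
  show "inj_on \<phi> U"
    using homeomorphic_imp_injective_map[OF 1(3)] inj_on_subset U by fastforce
  show "\<phi> ` U \<subseteq> cspace n" using openin_subset[OF 1(2)] by simp
qed

lemma chart_exists:
  assumes "complex_manifold M" "x \<in> points M"
  obtains n U \<phi> where "(n, U, \<phi>) \<in> charts M" "x \<in> U"
proof -
  have "x \<in> (\<Union>(n, U, \<phi>) \<in> charts M. U)"
    using assms unfolding complex_manifold_def by (elim conjE) (simp only:)
  then show ?thesis using that by auto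
qed

lemma chart_inv [simp]:
  assumes "complex_manifold M" "(n, U, \<phi>) \<in> charts M" "x \<in> U"
  shows "inv_into U \<phi> (\<phi> x) = x"
  using manifold_chart(4)[OF assms(1,2)] assms(3) by simp

text \<open>Differentiability in a chart depends only on values near a point; this supplies the ball
  of chart coordinates whose points come from a prescribed open set \<open>Q\<close>.\<close>

lemma chart_nbhd:
  assumes M: "complex_manifold M" and c: "(n, U, \<phi>) \<in> charts M" and O: "openin (mtop M) Q" and x: "x \<in> Q" "x \<in> U"
  shows "\<exists>\<delta>>0. \<forall>w\<in>cspace n. cdist n w (\<phi> x) < \<delta> \<longrightarrow> w \<in> \<phi> ` U \<and> inv_into U \<phi> w \<in> Q"
proof -
  note ch = manifold_chart[OF M c]
  have "openin (subtopology (mtop M) U) (U \<inter> Q)"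
    using O by (simp add: openin_subtopology_Int2)
  then have "openin (top_of_set (\<phi> ` U)) (\<phi> ` (U \<inter> Q))"
    using homeomorphic_imp_open_map[OF ch(3)] unfolding open_map_def by blast
  then have "openin (top_of_set (cspace n)) (\<phi> ` (U \<inter> Q))"
    using openin_trans ch(2) by blast
  then obtain \<delta> where \<delta>: "\<delta> > 0" "\<forall>w\<in>cspace n. cdist n w (\<phi> x) < \<delta> \<longrightarrow> w \<in> \<phi> ` (U \<inter> Q)"
    unfolding openin_cspace_iff using x by blast
  show ?thesis
  proof (intro exI[of _ \<delta>] conjI ballI impI)
    fix w assume "w \<in> cspace n" "cdist n w (\<phi> x) < \<delta>"
    then obtain y where "y \<in> U" "y \<in> Q" "w = \<phi> y" using \<delta>(2) by blast
    then show "w \<in> \<phi> ` U" "inv_into U \<phi> w \<in> Q" using chart_inv[OF M c] by auto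
  qed (rule \<delta>)
qed

lemma chart_inv_continuous:
  assumes M: "complex_manifold M" and c: "(n, U, \<phi>) \<in> charts M"
  shows "continuous_map (top_of_set (\<phi> ` U)) (mtop M) (inv_into U \<phi>)"
proof -
  note ch = manifold_chart[OF M c]
  obtain g where g: "homeomorphic_maps (subtopology (mtop M) U) (top_of_set (\<phi> ` U)) \<phi> g"
    using ch(3) homeomorphic_map_maps by blast
  then have "continuous_map (top_of_set (\<phi> ` U)) (mtop M) g"
    unfolding homeomorphic_maps_def using continuous_map_into_fulltopology by blast
  moreover have "g z = inv_into U \<phi> z" if "z \<in> topspace (top_of_set (\<phi> ` U))" for z
    using g that ch(4,6) unfolding homeomorphic_maps_def by force
  ultimately show ?thesis by (rule continuous_map_eq)
qed

lemma chart_continuous: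
  assumes M: "complex_manifold M" and c: "(n, U, \<phi>) \<in> charts M"
  shows "continuous_map (subtopology (mtop M) U) euclidean \<phi>"
  using homeomorphic_imp_continuous_map[OF manifold_chart(3)[OF M c]] continuous_map_into_fulltopology by blast

lemma chart_transition:
  assumes M: "complex_manifold M" and c: "(n, U, \<phi>) \<in> charts M" "(m, V, \<psi>) \<in> charts M"
    and x: "x \<in> U" "x \<in> V" and i: "i < m"
  shows "complex_differentiable_at n (\<lambda>z. \<psi> (inv_into U \<phi> z) i) (\<phi> x)"
proof -
  have "holomorphic_function_on M (U \<inter> V) (\<lambda>x. \<psi> x i)"
  proof -
    have "\<forall>(n, U, \<phi>) \<in> charts M. \<forall>(m, V, \<psi>) \<in> charts M. \<forall>i<m. holomorphic_function_on M (U \<inter> V) (\<lambda>x. \<psi> x i)"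
      using M unfolding complex_manifold_def by (elim conjE)
    from bspec[OF this c(1), unfolded prod.case, THEN bspec, OF c(2), unfolded prod.case] i
    show ?thesis by blast
  qed
  then show ?thesis
    using c(1) x unfolding holomorphic_function_on_def complex_differentiable_at_def by fast
qed

text \<open>Continuity makes the preimages of chart domains open, so holomorphy decouples into a
  topological condition and a condition at each point. The pointwise part is what is easy to compose
  and to restrict.\<close>

lemma holomorphic_map_on_iff:
  assumes N: "complex_manifold N"
  shows "holomorphic_map_on M W N f \<longleftrightarrow>
    openin (mtop M) W \<and> continuous_map (subtopology (mtop M) W) (mtop N) f \<and> (\<forall>x\<in>W. holomorphic_at M N f x)"
    (is "?L \<longleftrightarrow> ?R")
proof
  assume L: ?L
  have "holomorphic_at M N f x" if "x \<in> W" for x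
    unfolding holomorphic_at_def
  proof (clarify)
    fix n U \<phi> m V \<psi> i
    assume c: "(n, U, \<phi>) \<in> charts M" "x \<in> U" "(m, V, \<psi>) \<in> charts N" "f x \<in> V" "i < m"
    have "holomorphic_function_on M {x \<in> W. f x \<in> V} (\<lambda>x. \<psi> (f x) i)"
      using L c unfolding holomorphic_map_on_def by fast
    then show "complex_differentiable_at n (\<lambda>z. \<psi> (f (inv_into U \<phi> z)) i) (\<phi> x)"
      unfolding holomorphic_function_on_def complex_differentiable_at_def using c \<open>x \<in> W\<close> by blast
  qed
  then show ?R using L unfolding holomorphic_map_on_def by blast
next
  assume R: ?R
  have "openin (mtop M) {x \<in> W. f x \<in> V}" if V: "openin (mtop N) V" for V
  proof -
    have "openin (subtopology (mtop M) W) {x \<in> topspace (subtopology (mtop M) W). f x \<in> V}"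
      using R V openin_continuous_map_preimage by blast
    moreover have "topspace (subtopology (mtop M) W) = W" using R openin_subset by fastforce
    ultimately have "openin (subtopology (mtop M) W) {x \<in> W. f x \<in> V}" by (simp only:)
    then show ?thesis using R openin_trans_full by blast
  qed
  then have "\<forall>i<m. holomorphic_function_on M {x \<in> W. f x \<in> V} (\<lambda>x. \<psi> (f x) i)" if c: "(m, V, \<psi>) \<in> charts N" for m V \<psi>
    using manifold_chart(1)[OF N c] R c
    unfolding holomorphic_function_on_def holomorphic_at_def complex_differentiable_at_def by fast
  then show ?L using R unfolding holomorphic_map_on_def by blast
qed

lemma holomorphic_map_on_subset:
  assumes "complex_manifold N" "holomorphic_map_on M W N f" "openin (mtop M) W'" "W' \<subseteq> W"
  shows "holomorphic_map_on M W' N f"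
  using assms by (auto simp: holomorphic_map_on_iff elim: continuous_map_from_subtopology_mono)

text \<open>An intermediate chart around \<open>f x\<close> factors the composite into two
  coordinate expressions. Continuity of \<open>f\<close> near \<open>x\<close> keeps nearby values
  in that chart, where inserting \<open>inv_into Z \<kappa>\<close> after \<open>\<kappa>\<close>
  changes nothing.\<close>

lemma holomorphic_at_compose:
  assumes M: "complex_manifold M" and N: "complex_manifold N"
    and f: "holomorphic_at M N f x" and g: "holomorphic_at N P g (f x)"
    and W: "openin (mtop M) W" "x \<in> W" "continuous_map (subtopology (mtop M) W) (mtop N) f"
  shows "holomorphic_at M P (\<lambda>x. g (f x)) x"
  unfolding holomorphic_at_def
proof clarify
  fix n U \<phi> p V \<psi> i
  assume c: "(n, U, \<phi>) \<in> charts M" "x \<in> U" "(p, V, \<psi>) \<in> charts P" "g (f x) \<in> V" "i < p"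
  have "f x \<in> points N"
    using W openin_subset[OF W(1)] continuous_map_image_subset_topspace[OF W(3)] by auto
  then obtain m Z \<kappa> where Z: "(m, Z, \<kappa>) \<in> charts N" "f x \<in> Z" using chart_exists[OF N] by blast
  have "openin (subtopology (mtop M) W) {y \<in> topspace (subtopology (mtop M) W). f y \<in> Z}"
    using W(3) manifold_chart(1)[OF N Z(1)] openin_continuous_map_preimage by blast
  moreover have "topspace (subtopology (mtop M) W) = W" using W(1) openin_subset by fastforce
  ultimately have "openin (subtopology (mtop M) W) {y \<in> W. f y \<in> Z}" by (simp only:)
  then have Q: "openin (mtop M) {y \<in> W. f y \<in> Z}"
    using W(1) openin_trans_full by blast
  obtain \<delta> where \<delta>: "\<delta> > 0" "\<forall>w\<in>cspace n. cdist n w (\<phi> x) < \<delta> \<longrightarrow>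
      w \<in> \<phi> ` U \<and> inv_into U \<phi> w \<in> {y \<in> W. f y \<in> Z}"
    using chart_nbhd[OF M c(1) Q] W c Z by blast
  have px: "\<phi> x \<in> cspace n" using manifold_chart(5)[OF M c(1)] c(2) by blast
  let ?F = "\<lambda>z. \<kappa> (f (inv_into U \<phi> z))" and ?G = "\<lambda>y. \<psi> (g (inv_into Z \<kappa> y)) i"
  have "complex_differentiable_at n (\<lambda>z. ?G (?F z)) (\<phi> x)"
  proof (rule complex_differentiable_compose[where f = ?F and g = ?G, OF px _ _ \<delta>(1)])
    show "complex_differentiable_at n (\<lambda>w. \<kappa> (f (inv_into U \<phi> w)) i) (\<phi> x)" if "i < m" for i
      using f c Z that unfolding holomorphic_at_def by fast
    show "complex_differentiable_at m ?G (?F (\<phi> x))"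
      using g c Z unfolding holomorphic_at_def chart_inv[OF M c(1,2)] by fast
    show "?F w \<in> cspace m" if "w \<in> cspace n" "cdist n w (\<phi> x) < \<delta>" for w
      using \<delta>(2)[rule_format, OF that] manifold_chart(5)[OF N Z(1)] by blast
  qed
  then show "complex_differentiable_at n (\<lambda>z. \<psi> (g (f (inv_into U \<phi> z))) i) (\<phi> x)"
    by (rule complex_differentiable_cong[OF _ px \<delta>(1)]) (use \<delta>(2) chart_inv[OF N Z(1)] in auto)
qed

lemma holomorphic_map_on_compose:
  assumes M: "complex_manifold M" and N: "complex_manifold N" and P: "complex_manifold P"
    and f: "holomorphic_map_on M W N f" and g: "holomorphic_map_on N W' P g" and sub: "\<And>x. x \<in> W \<Longrightarrow> f x \<in> W'"
  shows "holomorphic_map_on M W P (\<lambda>x. g (f x))"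
proof -
  note F = f[unfolded holomorphic_map_on_iff[OF N]] and G = g[unfolded holomorphic_map_on_iff[OF P]]
  have "continuous_map (subtopology (mtop M) W) (subtopology (mtop N) W') f"
    using F sub by (auto simp: continuous_map_in_subtopology)
  then have "continuous_map (subtopology (mtop M) W) (mtop P) (g \<circ> f)"
    using G continuous_map_compose by blast
  moreover have "holomorphic_at M P (\<lambda>x. g (f x)) x" if "x \<in> W" for x
  proof (rule holomorphic_at_compose[OF M N])
    show "openin (mtop M) W" "continuous_map (subtopology (mtop M) W) (mtop N) f" "holomorphic_at M N f x"
      using F that by blast+
    show "holomorphic_at N P g (f x)" using G sub[OF that] by blast
  qed fact
  ultimately show ?thesis using F by (auto simp: holomorphic_map_on_iff[OF P] o_def)
qed

section \<open>Open submanifolds and C^n\<close>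

lemma open_submanifold_simps:
  "mtop (open_submanifold M W) = subtopology (mtop M) W"
  "charts (open_submanifold M W) = (\<lambda>(n, U, \<phi>). (n, U \<inter> W, \<phi>)) ` charts M"
  by (simp_all add: open_submanifold_def)

lemma open_submanifold_twice:
  "V \<subseteq> U \<Longrightarrow> open_submanifold (open_submanifold M U) V = open_submanifold M V"
  unfolding open_submanifold_def charted_space.simps image_image
  by (auto simp: subtopology_subtopology Int_absorb1 Int_assoc intro!: image_cong)

lemma inv_into_subset_eq: "inj_on \<phi> U \<Longrightarrow> z \<in> \<phi> ` (U \<inter> W) \<Longrightarrow> inv_into (U \<inter> W) \<phi> z = inv_into U \<phi> z"
  by (metis (no_types, opaque_lifting) IntD1 Int_lower1 f_inv_into_f inj_on_subset inv_into_f_f inv_into_into)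

text \<open>\<open>inv_into (U \<inter> W) \<phi>\<close> and \<open>inv_into U \<phi>\<close> are
  compared on the image of \<open>U \<inter> W\<close>. That image contains a ball about
  \<open>\<phi> x\<close>, which is all that a derivative sees.\<close>

lemma holomorphic_at_open_submanifold:
  assumes M: "complex_manifold M" and W: "openin (mtop M) W" "x \<in> W"
  shows "holomorphic_at (open_submanifold M W) N f x \<longleftrightarrow> holomorphic_at M N f x"
proof -
  have "complex_differentiable_at n (\<lambda>z. \<psi> (f (inv_into (U \<inter> W) \<phi> z)) i) (\<phi> x) \<longleftrightarrow>
    complex_differentiable_at n (\<lambda>z. \<psi> (f (inv_into U \<phi> z)) i) (\<phi> x)"
    if c: "(n, U, \<phi>) \<in> charts M" and x: "x \<in> U" for n U \<phi> i and \<psi> :: "_ \<Rightarrow> nat \<Rightarrow> complex"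
  proof -
    obtain \<delta> where \<delta>: "\<delta> > 0" "\<forall>w\<in>cspace n. cdist n w (\<phi> x) < \<delta> \<longrightarrow> w \<in> \<phi> ` U \<and> inv_into U \<phi> w \<in> W"
      using chart_nbhd[OF M c W x] by blast
    have px: "\<phi> x \<in> cspace n" using manifold_chart(5)[OF M c] x by blast
    have eq: "inv_into (U \<inter> W) \<phi> w = inv_into U \<phi> w" if "w \<in> cspace n" "cdist n w (\<phi> x) < \<delta>" for w
    proof (rule inv_into_subset_eq[OF manifold_chart(4)[OF M c]])
      have "w = \<phi> (inv_into U \<phi> w)" "inv_into U \<phi> w \<in> U \<inter> W"
        using \<delta>(2)[rule_format, OF that] by (auto simp: f_inv_into_f inv_into_into)
      then show "w \<in> \<phi> ` (U \<inter> W)" by blast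
    qed
    show ?thesis
      by (rule iffI; erule complex_differentiable_cong[OF _ px \<delta>(1)]) (simp_all add: eq)
  qed
  note eq = this
  show ?thesis
  proof
    assume L: "holomorphic_at (open_submanifold M W) N f x"
    show "holomorphic_at M N f x" unfolding holomorphic_at_def
    proof clarify
      fix n U \<phi> m V \<psi> i
      assume c: "(n, U, \<phi>) \<in> charts M" "x \<in> U" "(m, V, \<psi>) \<in> charts N" "f x \<in> V" "i < m"
      have "(n, U \<inter> W, \<phi>) \<in> charts (open_submanifold M W)" "x \<in> U \<inter> W"
        using c W by (auto simp: open_submanifold_simps intro!: image_eqI)
      then have "complex_differentiable_at n (\<lambda>z. \<psi> (f (inv_into (U \<inter> W) \<phi> z)) i) (\<phi> x)"
        using L c unfolding holomorphic_at_def by fast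
      then show "complex_differentiable_at n (\<lambda>z. \<psi> (f (inv_into U \<phi> z)) i) (\<phi> x)"
        using eq[OF c(1,2)] by blast
    qed
  next
    assume R: "holomorphic_at M N f x"
    show "holomorphic_at (open_submanifold M W) N f x" unfolding holomorphic_at_def
    proof clarify
      fix n U' \<phi> m V \<psi> i
      assume c': "(n, U', \<phi>) \<in> charts (open_submanifold M W)" "x \<in> U'" "(m, V, \<psi>) \<in> charts N" "f x \<in> V" "i < m"
      then obtain U where c: "(n, U, \<phi>) \<in> charts M" "U' = U \<inter> W" by (auto simp: open_submanifold_simps)
      have "complex_differentiable_at n (\<lambda>z. \<psi> (f (inv_into U \<phi> z)) i) (\<phi> x)"
        using R c c' unfolding holomorphic_at_def by fast
      then show "complex_differentiable_at n (\<lambda>z. \<psi> (f (inv_into U' \<phi> z)) i) (\<phi> x)"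
        using eq[OF c(1)] c' unfolding c(2) by blast
    qed
  qed
qed

lemma holomorphic_at_into_open_submanifold:
  assumes "f x \<in> W"
  shows "holomorphic_at M (open_submanifold N W) f x \<longleftrightarrow> holomorphic_at M N f x"
  using assms unfolding holomorphic_at_def open_submanifold_simps by fastforce

lemma holomorphic_function_on_iff_at:
  "holomorphic_function_on M W f \<longleftrightarrow> openin (mtop M) W \<and>
     (\<forall>(n, U, \<phi>) \<in> charts M. \<forall>x \<in> W \<inter> U. complex_differentiable_at n (\<lambda>z. f (inv_into U \<phi> z)) (\<phi> x))"
  unfolding holomorphic_function_on_def complex_differentiable_at_def ..

lemma complex_manifold_open_submanifold:
  assumes M: "complex_manifold M" and W: "openin (mtop M) W"
  shows "complex_manifold (open_submanifold M W)"
  unfolding complex_manifold_def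
proof (intro conjI)
  have Wp: "W \<subseteq> points M" using openin_subset[OF W] .
  show "Hausdorff_space (mtop (open_submanifold M W))" "second_countable (mtop (open_submanifold M W))"
    using M unfolding complex_manifold_def open_submanifold_simps
    by (simp_all add: Hausdorff_space_subtopology second_countable_subtopology)
  show "(\<Union>(n, U, \<phi>)\<in>charts (open_submanifold M W). U) = points (open_submanifold M W)"
  proof -
    have "(\<Union>(n, U, \<phi>)\<in>charts (open_submanifold M W). U) = (\<Union>(n, U, \<phi>)\<in>charts M. U) \<inter> W"
      unfolding open_submanifold_simps by force
    also have "(\<Union>(n, U, \<phi>)\<in>charts M. U) = points M" using M unfolding complex_manifold_def by blast
    finally show ?thesis by (simp add: open_submanifold_simps)
  qed
  have ch: "openin (mtop (open_submanifold M W)) (U \<inter> W)"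
       "openin (top_of_set (cspace n)) (\<phi> ` (U \<inter> W))"
       "homeomorphic_map (subtopology (mtop (open_submanifold M W)) (U \<inter> W)) (top_of_set (\<phi> ` (U \<inter> W))) \<phi>"
    if c: "(n, U, \<phi>) \<in> charts M" for n U \<phi>
  proof -
    note ch = manifold_chart[OF M c]
    show "openin (mtop (open_submanifold M W)) (U \<inter> W)"
      unfolding open_submanifold_simps using ch(1) by (simp add: openin_subtopology_Int)
    have "openin (subtopology (mtop M) U) (U \<inter> W)"
      using W by (simp add: openin_subtopology_Int2)
    then have "openin (top_of_set (\<phi> ` U)) (\<phi> ` (U \<inter> W))"
      using homeomorphic_imp_open_map[OF ch(3)] unfolding open_map_def by blast
    then show "openin (top_of_set (cspace n)) (\<phi> ` (U \<inter> W))"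
      using openin_trans ch(2) by blast
    have "homeomorphic_map (subtopology (subtopology (mtop M) U) (U \<inter> W)) (subtopology (top_of_set (\<phi> ` U)) (\<phi> ` (U \<inter> W))) \<phi>"
      using ch(6) by (intro homeomorphic_map_subtopologies[OF ch(3)]) auto
    then show "homeomorphic_map (subtopology (mtop (open_submanifold M W)) (U \<inter> W)) (top_of_set (\<phi> ` (U \<inter> W))) \<phi>"
      unfolding open_submanifold_simps subtopology_subtopology
      by (simp add: Int_absorb1 Int_absorb2 image_mono inf_commute inf_left_commute)
  qed
  then show "\<forall>(n, U, \<phi>)\<in>charts (open_submanifold M W).
       openin (mtop (open_submanifold M W)) U \<and>
       openin (top_of_set (cspace n)) (\<phi> ` U) \<and>
       homeomorphic_map (subtopology (mtop (open_submanifold M W)) U) (top_of_set (\<phi> ` U)) \<phi>"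
    unfolding open_submanifold_simps(2) by (auto simp del: image_Int)
  show "\<forall>(n, U, \<phi>)\<in>charts (open_submanifold M W). \<forall>(m, V, \<psi>)\<in>charts (open_submanifold M W). \<forall>i<m.
          holomorphic_function_on (open_submanifold M W) (U \<inter> V) (\<lambda>x. \<psi> x i)"
  proof (clarify)
    fix n U' \<phi> m V' \<psi> i
    assume c': "(n, U', \<phi>)\<in>charts (open_submanifold M W)" "(m, V', \<psi>)\<in>charts (open_submanifold M W)" "i < m"
    obtain V where V: "(m, V, \<psi>) \<in> charts M" "V' = V \<inter> W" using c' by (auto simp: open_submanifold_simps)
    obtain U where U: "(n, U, \<phi>) \<in> charts M" "U' = U \<inter> W" using c' by (auto simp: open_submanifold_simps)
    show "holomorphic_function_on (open_submanifold M W) (U' \<inter> V') (\<lambda>x. \<psi> x i)"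
      unfolding holomorphic_function_on_iff_at
    proof (intro conjI)
      show "openin (mtop (open_submanifold M W)) (U' \<inter> V')"
        using ch(1)[OF U(1)] ch(1)[OF V(1)] U V by auto
      show "\<forall>(n, U, \<phi>)\<in>charts (open_submanifold M W).
       \<forall>x\<in>U' \<inter> V' \<inter> U. complex_differentiable_at n (\<lambda>z. \<psi> (inv_into U \<phi> z) i) (\<phi> x)"
      proof clarify
        fix k Z' \<kappa> x assume Z': "(k, Z', \<kappa>) \<in> charts (open_submanifold M W)" and x: "x \<in> U'" "x \<in> V'" "x \<in> Z'"
        obtain Z where Z: "(k, Z, \<kappa>) \<in> charts M" "Z' = Z \<inter> W" using Z' by (auto simp: open_submanifold_simps)
        \<comment> \<open>A transition function is the identity map read in two charts, so
          compatibility of the restricted charts is holomorphy of the identity on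
          \<open>W\<close>.\<close>
        have "holomorphic_at M M (\<lambda>x. x) x"
          unfolding holomorphic_at_def using chart_transition[OF M] by blast
        then have "holomorphic_at (open_submanifold M W) M (\<lambda>x. x) x"
          using holomorphic_at_open_submanifold[OF M W] x U by blast
        then show "complex_differentiable_at k (\<lambda>z. \<psi> (inv_into Z' \<kappa> z) i) (\<kappa> x)"
          unfolding holomorphic_at_def using Z' V x c' by fast
      qed
    qed
  qed
qed

lemma points_cspace_manifold [simp]: "mtop (cspace_manifold n) = top_of_set (cspace n)"
  "charts (cspace_manifold n) = {(n, cspace n, \<lambda>z. z)}"
  by (simp_all add: cspace_manifold_def)

lemma second_countable_euclidean: "second_countable (euclidean :: 'a::second_countable_topology topology)"
proof -
  obtain B :: "'a set set" where B: "countable B" "topological_basis B" using ex_countable_basis by blast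
  show ?thesis unfolding second_countable_def
  proof (intro exI[of _ B] conjI allI ballI impI)
    fix U and x :: 'a assume "openin euclidean U \<and> x \<in> U"
    then show "\<exists>V\<in>B. x \<in> V \<and> V \<subseteq> U" using topological_basisE[OF B(2), of U x] by (metis open_openin)
  qed (use B in \<open>auto simp: topological_basis_open\<close>)
qed

lemma inv_into_id: "w \<in> S \<Longrightarrow> inv_into S (\<lambda>z. z) w = w"
  by (metis f_inv_into_f image_ident)

lemma complex_manifold_cspace: "complex_manifold (cspace_manifold n)"
  unfolding complex_manifold_def
proof (intro conjI)
  show "Hausdorff_space (mtop (cspace_manifold n))"
    by (simp add: Hausdorff_space_subtopology)
  show "second_countable (mtop (cspace_manifold n))"
    by (simp add: second_countable_subtopology second_countable_euclidean)
  have "complex_differentiable_at n (\<lambda>z. inv_into (cspace n) (\<lambda>z. z) z i) x" if "x \<in> cspace n" for x i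
    by (rule complex_differentiable_cong[OF complex_differentiable_coordinate[OF that] that zero_less_one])
      (simp add: inv_into_id)
  then show "\<forall>(na, U, \<phi>)\<in>charts (cspace_manifold n). \<forall>(m, V, \<psi>)\<in>charts (cspace_manifold n). \<forall>i<m.
          holomorphic_function_on (cspace_manifold n) (U \<inter> V) (\<lambda>x. \<psi> x i)"
    by (auto simp: holomorphic_function_on_iff_at)
qed (auto simp: homeomorphic_map_id[unfolded id_def] subtopology_subtopology)

lemma holomorphic_at_cspace:
  assumes z: "z \<in> cspace n"
  shows "holomorphic_at (cspace_manifold n) N f z \<longleftrightarrow>
    (\<forall>(m, V, \<psi>) \<in> charts N. f z \<in> V \<longrightarrow> (\<forall>i<m. complex_differentiable_at n (\<lambda>w. \<psi> (f w) i) z))"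
proof -
  have "complex_differentiable_at n (\<lambda>w. \<psi> (f (inv_into (cspace n) (\<lambda>z. z) w)) i) z \<longleftrightarrow>
     complex_differentiable_at n (\<lambda>w. \<psi> (f w) i) z" for i and \<psi> :: "_ \<Rightarrow> nat \<Rightarrow> complex"
    by (rule iffI; erule complex_differentiable_cong[OF _ z zero_less_one]) (simp_all add: inv_into_id)
  then show ?thesis unfolding holomorphic_at_def using z by simp
qed

section \<open>Local sections of submersions\<close>

lemma openin_cdist_less:
  assumes "continuous_map T euclidean f"
  shows "openin T {q \<in> topspace T. cdist n (f q) c < e}"
proof -
  have "openin euclidean {w. cdist n w c < e}" using open_cdist_ball by simp
  then have "openin T {q \<in> topspace T. f q \<in> {w. cdist n w c < e}}"
    by (rule openin_continuous_map_preimage[OF assms])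
  then show ?thesis by simp
qed

lemma continuous_map_into_cspace:
  assumes cs: "\<And>p. p \<in> topspace T \<Longrightarrow> f p \<in> cspace n"
    and ct: "\<And>p e. p \<in> topspace T \<Longrightarrow> e > 0 \<Longrightarrow> \<exists>Q. openin T Q \<and> p \<in> Q \<and> (\<forall>q\<in>Q. cdist n (f q) (f p) < e)"
  shows "continuous_map T (top_of_set (cspace n)) f"
  unfolding continuous_map
proof (intro conjI allI impI)
  show "f ` topspace T \<subseteq> topspace (top_of_set (cspace n))" using cs by auto
  fix U assume U: "openin (top_of_set (cspace n)) U"
  show "openin T {x \<in> topspace T. f x \<in> U}"
  proof (subst openin_subopen, clarify)
    fix p assume p: "p \<in> topspace T" "f p \<in> U"
    obtain \<delta> where \<delta>: "\<delta> > 0" "\<forall>w\<in>cspace n. cdist n w (f p) < \<delta> \<longrightarrow> w \<in> U"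
      using U p(2) unfolding openin_cspace_iff by blast
    obtain Q where Q: "openin T Q" "p \<in> Q" "\<forall>q\<in>Q. cdist n (f q) (f p) < \<delta>" using ct[OF p(1) \<delta>(1)] by blast
    have "Q \<subseteq> {x \<in> topspace T. f x \<in> U}"
    proof
      fix q assume q: "q \<in> Q"
      then have "q \<in> topspace T" using openin_subset[OF Q(1)] by blast
      then show "q \<in> {x \<in> topspace T. f x \<in> U}" using \<delta>(2) Q(3) q cs by blast
    qed
    then show "\<exists>Q. openin T Q \<and> p \<in> Q \<and> Q \<subseteq> {x \<in> topspace T. f x \<in> U}" using Q by blast
  qed
qed

text \<open>
  \<open>T\<close> moves the point \<open>a\<close> to the nearby fibre over \<open>b\<close>; for fixed \<open>a\<close> it is a local section of \<open>h\<close>.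
\<close>

lemma submersion_local_lift:
  assumes X: "complex_manifold X" and Y: "complex_manifold Y" and h: "holomorphic_map X Y h"
    and x: "x \<in> points X" and sd: "surjective_differential_at X Y h x"
  obtains Q T where "openin (prod_topology (mtop X) (mtop Y)) Q" "(x, h x) \<in> Q"
    "continuous_map (subtopology (prod_topology (mtop X) (mtop Y)) Q) (mtop X) (\<lambda>(a, b). T a b)"
    "\<And>a b. (a, b) \<in> Q \<Longrightarrow> h (T a b) = b"
    "\<And>a. (a, h a) \<in> Q \<Longrightarrow> T a (h a) = a"
    "\<And>k W F G. holomorphic_map_on (cspace_manifold k) W X F \<Longrightarrow> holomorphic_map_on (cspace_manifold k) W Y G \<Longrightarrow>
      (\<And>u. u \<in> W \<Longrightarrow> (F u, G u) \<in> Q) \<Longrightarrow> holomorphic_map_on (cspace_manifold k) W X (\<lambda>u. T (F u) (G u))"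
proof -
  obtain n U \<phi> where c: "(n, U, \<phi>) \<in> charts X" "x \<in> U" using chart_exists[OF X x] by blast
  note hh = h[unfolded holomorphic_map_on_iff[OF Y]]
  have hc: "continuous_map (mtop X) (mtop Y) h" using hh by simp
  have "h x \<in> points Y" using hc x unfolding continuous_map_def by blast
  then obtain m V \<psi> where d: "(m, V, \<psi>) \<in> charts Y" "h x \<in> V" using chart_exists[OF Y] by blast
  note cX = manifold_chart[OF X c(1)] and cY = manifold_chart[OF Y d(1)]
  have "\<exists>A. (\<forall>i<m. has_complex_gradient n (\<lambda>z. \<psi> (h (inv_into U \<phi> z)) i) (A i) (\<phi> x)) \<and>
             (\<forall>v \<in> cspace m. \<exists>u \<in> cspace n. \<forall>i<m. (\<Sum>j<n. A i j * u j) = v i)"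
    using sd c d unfolding surjective_differential_at_def by fast
  then obtain A where A: "\<forall>i<m. has_complex_gradient n (\<lambda>z. \<psi> (h (inv_into U \<phi> z)) i) (A i) (\<phi> x)"
    and surj: "\<forall>v \<in> cspace m. \<exists>u \<in> cspace n. \<forall>i<m. (\<Sum>j<n. A i j * u j) = v i" by blast
  \<comment> \<open>Preimages of the unit vectors are the columns of a right inverse of the
    Jacobian.\<close>
  have "\<exists>u. \<forall>i<m. (\<Sum>j<n. A i j * u j) = (if k = i then 1 else 0)" if "k < m" for k
  proof -
    have "(\<lambda>i. if k = i then 1 else 0) \<in> cspace m" using that by (auto simp: cspace_def)
    from bspec[OF surj this] show ?thesis by blast
  qed
  then obtain B' where B': "\<And>k i. k < m \<Longrightarrow> i < m \<Longrightarrow> (\<Sum>j<n. A i j * B' k j) = (if k = i then 1 else 0)" by metis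
  define H where "H = (\<lambda>z. \<psi> (h (inv_into U \<phi> z)))"
  define z0 where "z0 = \<phi> x"
  have z0: "z0 \<in> cspace n" using cX(5) c(2) by (auto simp: z0_def)
  have Hphi: "H (\<phi> a) = \<psi> (h a)" if "a \<in> U" for a using chart_inv[OF X c(1) that] by (simp add: H_def)
  have "openin (mtop X) {a \<in> points X. h a \<in> V}"
    using openin_continuous_map_preimage[OF hc cY(1)] .
  then obtain R where R: "R > 0" "\<forall>w\<in>cspace n. cdist n w z0 < R \<longrightarrow> w \<in> \<phi> ` U \<and> inv_into U \<phi> w \<in> {a \<in> points X. h a \<in> V}"
    using chart_nbhd[OF X c(1) _ _ c(2)] x d(2) unfolding z0_def by blast
  obtain \<rho> L S where S: "\<rho> > 0" "L \<ge> 0"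
    "\<And>x y. x \<in> cspace n \<Longrightarrow> y \<in> cspace m \<Longrightarrow> cdist n x z0 < \<rho> \<Longrightarrow> cdist m y (H z0) < \<rho> \<Longrightarrow>
       S x y \<in> cspace n \<and> cdist n (S x y) z0 < R \<and> H (S x y) = y"
    "\<And>x. x \<in> cspace n \<Longrightarrow> cdist n x z0 < \<rho> \<Longrightarrow> cdist m (H x) (H z0) < \<rho> \<Longrightarrow> S x (H x) = x"
    "\<And>x y x' y'. x \<in> cspace n \<Longrightarrow> y \<in> cspace m \<Longrightarrow> cdist n x z0 < \<rho> \<Longrightarrow> cdist m y (H z0) < \<rho> \<Longrightarrow>
       x' \<in> cspace n \<Longrightarrow> y' \<in> cspace m \<Longrightarrow> cdist n x' z0 < \<rho> \<Longrightarrow> cdist m y' (H z0) < \<rho> \<Longrightarrow>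
       cdist n (S x y) (S x' y') \<le> L * (cdist n x x' + cdist m y y')"
    "\<And>k u X Y \<delta> i. u \<in> cspace k \<Longrightarrow> \<delta> > 0 \<Longrightarrow>
       (\<And>w. w \<in> cspace k \<Longrightarrow> cdist k w u < \<delta> \<Longrightarrow> X w \<in> cspace n \<and> Y w \<in> cspace m \<and>
          cdist n (X w) z0 < \<rho> \<and> cdist m (Y w) (H z0) < \<rho>) \<Longrightarrow>
       (\<And>i. i < n \<Longrightarrow> complex_differentiable_at k (\<lambda>w. X w i) u) \<Longrightarrow>
       (\<And>i. i < m \<Longrightarrow> complex_differentiable_at k (\<lambda>w. Y w i) u) \<Longrightarrow>
       i < n \<Longrightarrow> complex_differentiable_at k (\<lambda>w. S (X w) (Y w) i) u"
  proof (rule holomorphic_right_inverse_family[where h = H and m = m and A = A and B = "\<lambda>j k. B' k j", OF z0 R(1)])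
    show "H w \<in> cspace m" if "w \<in> cspace n" "cdist n w z0 < R" for w
      using R(2)[rule_format, OF that] cY(5) by (auto simp: H_def)
    show "complex_differentiable_at n (\<lambda>w. H w i) w" if "w \<in> cspace n" "cdist n w z0 < R" "i < m" for w i
    proof -
      let ?a = "inv_into U \<phi> w"
      have a: "?a \<in> U" "\<phi> ?a = w" "h ?a \<in> V" "?a \<in> points X"
        using R(2)[rule_format, OF that(1,2)] by (auto simp: inv_into_into f_inv_into_f)
      have "holomorphic_at X Y h ?a" using hh a by blast
      then have "complex_differentiable_at n (\<lambda>z. \<psi> (h (inv_into U \<phi> z)) i) (\<phi> ?a)"
        using a c d that unfolding holomorphic_at_def by fast
      then show ?thesis unfolding H_def a(2) .
    qed
    show "has_complex_gradient n (\<lambda>w. H w i) (A i) z0" if "i < m" for i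
      using A that by (simp add: H_def z0_def)
    show "(\<Sum>j<n. A i j * B' k j) = (if k = i then 1 else 0)" if "i < m" "k < m" for i k
      using B' that by blast
  qed blast
  let ?P = "prod_topology (mtop X) (mtop Y)"
  \<comment> \<open>\<open>S\<close> solves the equation in coordinates and \<open>T\<close> carries
    the solution back to \<open>X\<close>. That \<open>T a b\<close> lies over \<open>b\<close>
    follows from equal chart values inside \<open>V\<close>, where \<open>\<psi>\<close> is
    injective.\<close>
  define T where "T = (\<lambda>a b. inv_into U \<phi> (S (\<phi> a) (\<psi> b)))"
  define QX where "QX = {a \<in> U. cdist n (\<phi> a) z0 < \<rho>}"
  define QY where "QY = {b \<in> V. cdist m (\<psi> b) (H z0) < \<rho>}"
  define Q where "Q = QX \<times> QY"
  have "openin (subtopology (mtop X) U) QX"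
    using openin_cdist_less[OF chart_continuous[OF X c(1)], of n z0 \<rho>] cX(6)
    by (simp add: QX_def Int_absorb1)
  then have QX: "openin (mtop X) QX" using openin_trans_full[OF _ cX(1)] by blast
  have "openin (subtopology (mtop Y) V) QY"
    using openin_cdist_less[OF chart_continuous[OF Y d(1)], of m "H z0" \<rho>] cY(6)
    by (simp add: QY_def Int_absorb1)
  then have QY: "openin (mtop Y) QY" using openin_trans_full[OF _ cY(1)] by blast
  have Q: "openin ?P Q" unfolding Q_def using QX QY by (simp add: openin_prod_Times_iff)
  have inQ: "\<phi> a \<in> cspace n" "\<psi> b \<in> cspace m" "cdist n (\<phi> a) z0 < \<rho>" "cdist m (\<psi> b) (H z0) < \<rho>" "a \<in> U" "b \<in> V"
    if "(a, b) \<in> Q" for a b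
    using that cX(5) cY(5) by (auto simp: Q_def QX_def QY_def)
  have SQ: "S (\<phi> a) (\<psi> b) \<in> \<phi> ` U" "h (T a b) \<in> V" "T a b \<in> U" "\<psi> (h (T a b)) = \<psi> b" "\<phi> (T a b) = S (\<phi> a) (\<psi> b)"
    if "(a, b) \<in> Q" for a b
  proof -
    have s: "S (\<phi> a) (\<psi> b) \<in> cspace n" "cdist n (S (\<phi> a) (\<psi> b)) z0 < R" "H (S (\<phi> a) (\<psi> b)) = \<psi> b"
      using S(3)[OF inQ(1-4)[OF that]] by auto
    show "S (\<phi> a) (\<psi> b) \<in> \<phi> ` U" "h (T a b) \<in> V" using R(2)[rule_format, OF s(1,2)] by (auto simp: T_def)
    then show "T a b \<in> U" "\<phi> (T a b) = S (\<phi> a) (\<psi> b)" by (auto simp: T_def inv_into_into f_inv_into_f)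
    show "\<psi> (h (T a b)) = \<psi> b" using s(3) by (simp add: H_def T_def)
  qed
  have Scont: "continuous_map (subtopology ?P Q) (top_of_set (cspace n)) (\<lambda>(a, b). S (\<phi> a) (\<psi> b))"
  proof (rule continuous_map_into_cspace)
    have tQ: "topspace (subtopology ?P Q) = Q" using openin_subset[OF Q] by auto
    fix p assume p: "p \<in> topspace (subtopology ?P Q)"
    obtain a b where ab: "p = (a, b)" by force
    then have abQ: "(a, b) \<in> Q" using p by auto
    show "(case p of (a, b) \<Rightarrow> S (\<phi> a) (\<psi> b)) \<in> cspace n"
      using S(3)[OF inQ(1-4)[OF abQ]] ab by auto
    fix e :: real assume e: "e > 0"
    \<comment> \<open>\<open>L\<close> may be zero, hence the \<open>+ 1\<close>; it also makes the
      final estimate strict.\<close>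
    define e' where "e' = e / (2 * (L + 1))"
    have e': "e' > 0" using e S(2) by (simp add: e'_def)
    let ?A = "{q \<in> U. cdist n (\<phi> q) (\<phi> a) < e'}" and ?B = "{q \<in> V. cdist m (\<psi> q) (\<psi> b) < e'}"
    have "openin (subtopology (mtop X) U) ?A"
      using openin_cdist_less[OF chart_continuous[OF X c(1)], of n "\<phi> a" e'] cX(6)
      by (simp add: Int_absorb1)
    then have oA: "openin (mtop X) ?A" using openin_trans_full[OF _ cX(1)] by blast
    have "openin (subtopology (mtop Y) V) ?B"
      using openin_cdist_less[OF chart_continuous[OF Y d(1)], of m "\<psi> b" e'] cY(6)
      by (simp add: Int_absorb1)
    then have oB: "openin (mtop Y) ?B" using openin_trans_full[OF _ cY(1)] by blast
    have o: "openin (subtopology ?P Q) (Q \<inter> (?A \<times> ?B))"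
      using oA oB by (intro openin_subtopology_Int2) (simp add: openin_prod_Times_iff)
    have "cdist n (S (\<phi> a') (\<psi> b')) (S (\<phi> a) (\<psi> b)) < e" if q: "(a', b') \<in> Q \<inter> (?A \<times> ?B)" for a' b'
    proof -
      have "cdist n (S (\<phi> a') (\<psi> b')) (S (\<phi> a) (\<psi> b)) \<le> L * (cdist n (\<phi> a') (\<phi> a) + cdist m (\<psi> b') (\<psi> b))"
        using q by (intro S(5) inQ[OF abQ] inQ[of a' b']) auto
      also have "\<dots> \<le> L * (e' + e')" using q S(2) by (intro mult_left_mono) auto
      also have "\<dots> < (L + 1) * (e' + e')" using e' by (intro mult_strict_right_mono) auto
      also have "e' + e' = e / (L + 1)" using S(2) by (simp add: e'_def divide_simps)
      also have "(L + 1) * (e / (L + 1)) = e" using S(2) by simp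
      finally show ?thesis .
    qed
    then show "\<exists>Q'. openin (subtopology ?P Q) Q' \<and> p \<in> Q' \<and>
       (\<forall>q\<in>Q'. cdist n (case q of (a, b) \<Rightarrow> S (\<phi> a) (\<psi> b)) (case p of (a, b) \<Rightarrow> S (\<phi> a) (\<psi> b)) < e)"
      using o abQ e' inQ(5,6)[OF abQ] unfolding ab
      by (intro exI[of _ "Q \<inter> (?A \<times> ?B)"]) auto
  qed
  have Tcont: "continuous_map (subtopology ?P Q) (mtop X) (\<lambda>(a, b). T a b)"
  proof -
    have "continuous_map (subtopology ?P Q) (top_of_set (\<phi> ` U)) (\<lambda>(a, b). S (\<phi> a) (\<psi> b))"
      using Scont SQ(1) by (auto simp: continuous_map_in_subtopology)
    from continuous_map_compose[OF this chart_inv_continuous[OF X c(1)]]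
    show ?thesis by (simp add: o_def T_def case_prod_unfold)
  qed
  show thesis
  proof (rule that[OF Q _ Tcont])
    show "(x, h x) \<in> Q" using S(1) c d Hphi[OF c(2)] by (auto simp: Q_def QX_def QY_def z0_def)
    show "h (T a b) = b" if "(a, b) \<in> Q" for a b
      using SQ(2,4)[OF that] inQ(6)[OF that] cY(4) by (auto dest: inj_onD)
    show "T a (h a) = a" if q: "(a, h a) \<in> Q" for a
    proof -
      have "S (\<phi> a) (H (\<phi> a)) = \<phi> a"
        using inQ[OF q] Hphi by (intro S(4)) auto
      then show ?thesis using Hphi[OF inQ(5)[OF q]] chart_inv[OF X c(1) inQ(5)[OF q]] by (simp add: T_def)
    qed
    fix k W F G assume F: "holomorphic_map_on (cspace_manifold k) W X F" and G: "holomorphic_map_on (cspace_manifold k) W Y G"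
      and FG: "\<And>u. u \<in> W \<Longrightarrow> (F u, G u) \<in> Q"
    note F' = F[unfolded holomorphic_map_on_iff[OF X]] and G' = G[unfolded holomorphic_map_on_iff[OF Y]]
    have W: "openin (top_of_set (cspace k)) W" using F' by simp
    have Wc: "W \<subseteq> cspace k" using openin_subset[OF W] by simp
    show "holomorphic_map_on (cspace_manifold k) W X (\<lambda>u. T (F u) (G u))"
      unfolding holomorphic_map_on_iff[OF X]
    proof (intro conjI ballI)
      show "openin (mtop (cspace_manifold k)) W" using F' by blast
      have "continuous_map (subtopology (mtop (cspace_manifold k)) W) ?P (\<lambda>u. (F u, G u))"
        using F' G' by (auto simp: continuous_map_pairwise o_def)
      then have "continuous_map (subtopology (mtop (cspace_manifold k)) W) (subtopology ?P Q) (\<lambda>u. (F u, G u))"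
        using FG by (auto simp: continuous_map_in_subtopology)
      from continuous_map_compose[OF this Tcont]
      show "continuous_map (subtopology (mtop (cspace_manifold k)) W) (mtop X) (\<lambda>u. T (F u) (G u))"
        by (simp add: o_def)
      fix u assume u: "u \<in> W"
      then have uc: "u \<in> cspace k" using Wc by blast
      obtain \<delta> where \<delta>: "\<delta> > 0" "\<forall>w\<in>cspace k. cdist k w u < \<delta> \<longrightarrow> w \<in> W"
        using W u unfolding openin_cspace_iff by blast
      have Fd: "complex_differentiable_at k (\<lambda>w. \<phi> (F w) i) u" if "i < n" for i
        using F' u c(1) inQ(5)[OF FG[OF u]] that holomorphic_at_cspace[OF uc] by fast
      have Gd: "complex_differentiable_at k (\<lambda>w. \<psi> (G w) i) u" if "i < m" for i
        using G' u d(1) inQ(6)[OF FG[OF u]] that holomorphic_at_cspace[OF uc] by fast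
      have Sd: "complex_differentiable_at k (\<lambda>w. S (\<phi> (F w)) (\<psi> (G w)) i) u" if "i < n" for i
      proof (rule S(6)[OF uc \<delta>(1) _ Fd Gd that])
        fix w assume "w \<in> cspace k" "cdist k w u < \<delta>"
        then have "(F w, G w) \<in> Q" using \<delta>(2) FG by blast
        from inQ[OF this] show "\<phi> (F w) \<in> cspace n \<and> \<psi> (G w) \<in> cspace m \<and> cdist n (\<phi> (F w)) z0 < \<rho> \<and> cdist m (\<psi> (G w)) (H z0) < \<rho>"
          by blast
      qed
      show "holomorphic_at (cspace_manifold k) X (\<lambda>u. T (F u) (G u)) u"
        unfolding holomorphic_at_cspace[OF uc]
      proof clarify
        fix l Z \<kappa> i assume Z: "(l, Z, \<kappa>) \<in> charts X" "T (F u) (G u) \<in> Z" "i < l"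
        let ?f = "\<lambda>w. S (\<phi> (F w)) (\<psi> (G w))" and ?g = "\<lambda>z. \<kappa> (inv_into U \<phi> z) i"
        have "complex_differentiable_at k (\<lambda>w. ?g (?f w)) u"
        proof (rule complex_differentiable_compose[where f = ?f and g = ?g, OF uc Sd _ \<delta>(1)])
          show "complex_differentiable_at n ?g (?f u)"
            using chart_transition[OF X c(1) Z(1) SQ(3)[OF FG[OF u]] Z(2,3)] unfolding SQ(5)[OF FG[OF u]] .
          show "?f w \<in> cspace n" if "w \<in> cspace k" "cdist k w u < \<delta>" for w
            using SQ(1)[OF FG] \<delta>(2) that cX(5) by blast
        qed
        then show "complex_differentiable_at k (\<lambda>w. \<kappa> (T (F w) (G w)) i) u" by (simp add: T_def)
      qed
    qed
  qed
qed

section \<open>Metrizability\<close>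

text \<open>Urysohn's metrization theorem; the metric is pulled back from a countable product of lines.\<close>

lemma regular_second_countable_metrizable:
  assumes reg: "regular_space X" and sc: "second_countable X" and hd: "Hausdorff_space X"
  shows "\<exists>d. metric_of X d"
proof -
  obtain B where B: "countable B" "\<And>V. V \<in> B \<Longrightarrow> openin X V"
    "\<And>U x. openin X U \<Longrightarrow> x \<in> U \<Longrightarrow> \<exists>V\<in>B. x \<in> V \<and> V \<subseteq> U"
    using sc unfolding second_countable_def by metis
  have normal: "normal_space X"
    using reg sc second_countable_imp_Lindelof_space regular_Lindelof_imp_normal_space by blast
  \<comment> \<open>For each such pair a Urysohn function vanishes on the closure of the first set
    and is \<open>1\<close> off the second. There are countably many pairs, so these functions can
    serve as the coordinates of a map into a countable product of lines.\<close>
  define P where "P = {p \<in> B \<times> B. X closure_of (fst p) \<subseteq> snd p}"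
  have "countable P" unfolding P_def using B(1) by (intro countable_Collect countable_SIGMA) auto
  have "\<exists>f. continuous_map X euclideanreal f \<and> f ` (X closure_of (fst p)) \<subseteq> {0} \<and> f ` (topspace X - snd p) \<subseteq> {1}"
    if "p \<in> P" for p
  proof -
    have "closedin X (X closure_of (fst p))" "closedin X (topspace X - snd p)"
      "disjnt (X closure_of (fst p)) (topspace X - snd p)"
      using that B(2) by (auto simp: P_def disjnt_def)
    then show ?thesis using normal unfolding normal_space_iff_Urysohn_alt by blast
  qed
  then obtain F0 where F0: "\<And>p. p \<in> P \<Longrightarrow> continuous_map X euclideanreal (F0 p) \<and>
     F0 p ` (X closure_of (fst p)) \<subseteq> {0} \<and> F0 p ` (topspace X - snd p) \<subseteq> {1}" by metis
  \<comment> \<open>When \<open>P\<close> is empty, \<open>from_nat_into P\<close> returns a value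
    outside \<open>P\<close>; the zero function keeps the coordinates continuous then.\<close>
  define F where "F = (\<lambda>p. if p \<in> P then F0 p else (\<lambda>_. 0))"
  have Fc: "continuous_map X euclideanreal (F p)" for p using F0 by (simp add: F_def)
  define e where "e = (\<lambda>x k. F (from_nat_into P k) x)"
  have ec: "continuous_map X euclidean e"
  proof -
    have "continuous_map X (product_topology (\<lambda>k. euclideanreal) UNIV) e"
      by (intro continuous_map_coordinatewise_then_product) (auto simp: e_def Fc[unfolded eta_contract_eq])
    then show ?thesis by (simp add: euclidean_product_topology)
  qed
  \<comment> \<open>One coordinate separates a point from the complement of a neighbourhood. This
    gives injectivity of \<open>e\<close> and shows that the pulled-back metric is as fine as the
    topology.\<close>
  have sep: "\<exists>k. e x k = 0 \<and> (\<forall>y\<in>topspace X. e y k < 1 \<longrightarrow> y \<in> U)" if U: "openin X U" "x \<in> U" for x U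
  proof -
    obtain V where V: "V \<in> B" "x \<in> V" "V \<subseteq> U" using B(3)[OF U] by blast
    have "neighbourhood_base_of (closedin X) X" using reg neighbourhood_base_of_closedin by blast
    then obtain U' C where U': "openin X U'" "closedin X C" "x \<in> U'" "U' \<subseteq> C" "C \<subseteq> V"
      using B(2)[OF V(1)] V(2) unfolding neighbourhood_base_of by meson
    obtain W where W: "W \<in> B" "x \<in> W" "W \<subseteq> U'" using B(3)[OF U'(1,3)] by blast
    have "X closure_of W \<subseteq> C" using W U' by (intro closure_of_minimal) auto
    then have WV: "(W, V) \<in> P" using W V U' by (auto simp: P_def)
    then obtain k where k: "from_nat_into P k = (W, V)"
      using from_nat_into_surj[OF \<open>countable P\<close>] by blast
    have "x \<in> X closure_of W" using W B(2) closure_of_subset openin_subset by (metis subsetD)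
    then have "e x k = 0" using F0[OF WV] WV by (auto simp: e_def k F_def)
    moreover have "y \<in> U" if "y \<in> topspace X" "e y k < 1" for y
    proof (rule ccontr)
      assume "y \<notin> U"
      then have "y \<in> topspace X - V" using that V by blast
      then have "F0 (W, V) y = 1" using F0[OF WV] by auto
      then show False using that WV by (simp add: e_def k F_def)
    qed
    ultimately show ?thesis by blast
  qed
  define d where "d = (\<lambda>x y. dist (e x) (e y))"
  have inj: "x = y" if xy: "x \<in> topspace X" "y \<in> topspace X" "e x = e y" for x y
  proof (rule ccontr)
    assume "x \<noteq> y"
    then obtain U V where "openin X U" "openin X V" "x \<in> U" "y \<in> V" "disjnt U V"
      using hd xy unfolding Hausdorff_space_def by blast
    then show False using sep[of U x] xy by (auto simp: disjnt_iff)
  qed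
  have ms: "Metric_space (topspace X) d"
    by unfold_locales (auto simp: d_def dist_commute dist_triangle inj)
  interpret Metric_space "topspace X" d by (rule ms)
  have "mtopology = X"
    unfolding topology_eq
  proof (intro allI iffI)
    fix U assume U: "openin mtopology U"
    show "openin X U"
    proof (subst openin_subopen, clarify)
      fix x assume x: "x \<in> U"
      then obtain r where r: "r > 0" "mball x r \<subseteq> U" using U by (auto simp: openin_mtopology)
      have xX: "x \<in> topspace X" using U x by (auto simp: openin_mtopology)
      have "openin X {y \<in> topspace X. e y \<in> ball (e x) r}"
        by (rule openin_continuous_map_preimage[OF ec]) simp
      moreover have "{y \<in> topspace X. e y \<in> ball (e x) r} \<subseteq> U"
      proof
        fix y assume "y \<in> {y \<in> topspace X. e y \<in> ball (e x) r}"
        then have "y \<in> topspace X" "d x y < r" by (simp_all add: d_def)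
        then have "y \<in> mball x r" using xX by simp
        then show "y \<in> U" using r(2) by blast
      qed
      moreover have "x \<in> {y \<in> topspace X. e y \<in> ball (e x) r}" using xX r by simp
      ultimately show "\<exists>T. openin X T \<and> x \<in> T \<and> T \<subseteq> U" by blast
    qed
  next
    fix U assume U: "openin X U"
    show "openin mtopology U"
      unfolding openin_mtopology
    proof (intro conjI allI impI)
      show "U \<subseteq> topspace X" using openin_subset[OF U] .
      fix x assume x: "x \<in> U"
      obtain k where k: "e x k = 0" "\<forall>y\<in>topspace X. e y k < 1 \<longrightarrow> y \<in> U" using sep[OF U x] by blast
      have "open {g :: nat \<Rightarrow> real. g k < 1}"
        by (intro open_Collect_less continuous_on_coordinate continuous_intros)
      then obtain r where r: "r > 0" "ball (e x) r \<subseteq> {g. g k < 1}"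
        using k(1) by (metis mem_Collect_eq open_contains_ball zero_less_one)
      have "mball x r \<subseteq> U"
      proof
        fix y assume y: "y \<in> mball x r"
        then have "d x y < r" by simp
        then have "e y \<in> ball (e x) r" by (simp add: d_def)
        then have "e y k < 1" using r(2) by blast
        then show "y \<in> U" using k(2) y by simp
      qed
      then show "\<exists>r>0. mball x r \<subseteq> U" using r(1) by blast
    qed
  qed
  then show ?thesis unfolding metric_of_def using ms by blast
qed

section \<open>Metrics on complex manifolds and closeness on compact sets\<close>

lemma compact_cdist_cball: "compact {w \<in> cspace n. cdist n w z \<le> r}"
proof -
  have "{w \<in> cspace n. cdist n w z \<le> r} = cspace_cball n (r + cnorm n z) \<inter> {w. cdist n w z \<le> r}"
  proof -
    have "cnorm n w \<le> r + cnorm n z" if "cdist n w z \<le> r" for w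
      using cnorm_triangle_diff[of n w z] that by linarith
    then show ?thesis by (auto simp: cspace_cball_def)
  qed
  moreover have "closed {w. cdist n w z \<le> r}"
  proof -
    have "continuous_on UNIV (\<lambda>w. cdist n w z)"
      by (intro continuous_on_cnorm continuous_intros continuous_on_coordinate)
    then show ?thesis by (intro closed_Collect_le) auto
  qed
  ultimately show ?thesis using compact_Int_closed[OF compact_cspace_cball[of n "r + cnorm n z"]] by simp
qed

text \<open>LSAP quantifies over all metrics inducing the topology, so it yields an approximation
  only once a metric is known to exist. Charts give local compactness, and local compactness with
  the Hausdorff property gives regularity.\<close>

lemma complex_manifold_metrizable:
  assumes M: "complex_manifold M"
  shows "\<exists>d. metric_of (mtop M) d"
proof -
  have hd: "Hausdorff_space (mtop M)" and sc: "second_countable (mtop M)"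
    using M unfolding complex_manifold_def by blast+
  have "locally_compact_space (mtop M)"
    unfolding locally_compact_space_def
  proof
    fix x assume x: "x \<in> points M"
    obtain n U \<phi> where c: "(n, U, \<phi>) \<in> charts M" "x \<in> U" using chart_exists[OF M x] .
    note ch = manifold_chart[OF M c(1)]
    obtain \<delta> where \<delta>: "\<delta> > 0" "\<forall>w\<in>cspace n. cdist n w (\<phi> x) < \<delta> \<longrightarrow> w \<in> \<phi> ` U \<and> inv_into U \<phi> w \<in> U"
      using chart_nbhd[OF M c(1) ch(1) c(2) c(2)] by blast
    \<comment> \<open>With half of \<open>\<delta>\<close> the closed ball, which is compact, still
      lies in the image of the chart.\<close>
    define C where "C = {w \<in> cspace n. cdist n w (\<phi> x) \<le> \<delta>/2}"
    have C: "C \<subseteq> \<phi> ` U"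
    proof
      fix w assume "w \<in> C"
      then have "w \<in> cspace n" "cdist n w (\<phi> x) < \<delta>" using \<delta>(1) by (auto simp: C_def)
      then show "w \<in> \<phi> ` U" using \<delta>(2) by blast
    qed
    have "compactin (top_of_set (\<phi> ` U)) C"
      using C compact_cdist_cball[of n "\<phi> x" "\<delta>/2", folded C_def] by (simp add: compactin_subtopology)
    then have 1: "compactin (mtop M) (inv_into U \<phi> ` C)"
      using image_compactin chart_inv_continuous[OF M c(1)] by blast
    let ?V = "{y \<in> U. cdist n (\<phi> y) (\<phi> x) < \<delta>/2}"
    have "openin (subtopology (mtop M) U) ?V"
      using openin_cdist_less[OF chart_continuous[OF M c(1)], of n "\<phi> x" "\<delta>/2"] ch(6)
      by (simp add: Int_absorb1)
    then have 2: "openin (mtop M) ?V" using openin_trans_full[OF _ ch(1)] by blast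
    have "?V \<subseteq> inv_into U \<phi> ` C"
    proof
      fix y assume y: "y \<in> ?V"
      then have "\<phi> y \<in> C" using ch(5) by (auto simp: C_def)
      moreover have "y = inv_into U \<phi> (\<phi> y)" using y chart_inv[OF M c(1)] by simp
      ultimately show "y \<in> inv_into U \<phi> ` C" by blast
    qed
    then show "\<exists>U K. openin (mtop M) U \<and> compactin (mtop M) K \<and> x \<in> U \<and> U \<subseteq> K"
      using 1 2 c(2) \<delta>(1) by (intro exI[of _ ?V] exI[of _ "inv_into U \<phi> ` C"]) auto
  qed
  then have "regular_space (mtop M)" using hd locally_compact_Hausdorff_imp_regular_space by blast
  then show ?thesis using regular_second_countable_metrizable sc hd by blast
qed

text \<open>Each graph point over \<open>K\<close> has a box inside \<open>P\<close>, finitely many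
  boxes suffice, and the least of their radii serves. An open condition on pairs thus holds for
  every map close to \<open>f\<close> on \<open>K\<close>, which converts closeness in one manifold
  into closeness in another.\<close>

lemma compact_graph_neighbourhood:
  assumes K: "compactin Z K" and f: "continuous_map Z T f" and P: "openin (prod_topology Z T) P"
    and KP: "\<And>u. u \<in> K \<Longrightarrow> (u, f u) \<in> P" and d: "metric_of T d"
  shows "\<exists>\<eta>>0. \<forall>u\<in>K. \<forall>b\<in>topspace T. d (f u) b < \<eta> \<longrightarrow> (u, b) \<in> P"
proof -
  interpret Metric_space "topspace T" d using d unfolding metric_of_def by blast
  have mt: "mtopology = T" using d unfolding metric_of_def by blast
  have KZ: "K \<subseteq> topspace Z" using K compactin_subset_topspace by blast
  have fT: "f u \<in> topspace T" if "u \<in> topspace Z" for u using f that unfolding continuous_map_def by blast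
  have "\<exists>A r. openin Z A \<and> u \<in> A \<and> r > 0 \<and> (\<forall>v\<in>A. \<forall>b\<in>topspace T. d (f v) b < r \<longrightarrow> (v, b) \<in> P)" if u: "u \<in> K" for u
  proof -
    obtain A B where AB: "openin Z A" "openin T B" "u \<in> A" "f u \<in> B" "A \<times> B \<subseteq> P"
      using P KP[OF u] unfolding openin_prod_topology_alt by meson
    then obtain r where r: "r > 0" "mball (f u) r \<subseteq> B" using openin_mtopology[unfolded mt] by blast
    \<comment> \<open>One half of the radius is spent on moving from \<open>f u\<close> to
      \<open>f v\<close>, the other on moving from \<open>f v\<close> to \<open>b\<close>.\<close>
    have "openin T (mball (f u) (r/2))" using openin_mball[of "f u" "r/2"] unfolding mt .
    then have o: "openin Z {v \<in> topspace Z. f v \<in> mball (f u) (r/2)}"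
      by (rule openin_continuous_map_preimage[OF f])
    let ?A = "A \<inter> {v \<in> topspace Z. f v \<in> mball (f u) (r/2)}"
    have "(v, b) \<in> P" if v: "v \<in> ?A" "b \<in> topspace T" "d (f v) b < r/2" for v b
    proof -
      have "d (f u) b \<le> d (f u) (f v) + d (f v) b" using v fT u KZ by (intro triangle) auto
      then have "b \<in> mball (f u) r" using v by auto
      then show ?thesis using v r AB by blast
    qed
    then show ?thesis using AB o r u KZ fT
      by (intro exI[of _ ?A] exI[of _ "r/2"] conjI ballI impI) auto
  qed
  then obtain A r where Ar: "\<And>u. u \<in> K \<Longrightarrow> openin Z (A u)" "\<And>u. u \<in> K \<Longrightarrow> u \<in> A u" "\<And>u. u \<in> K \<Longrightarrow> r u > 0"
    "\<And>u v b. u \<in> K \<Longrightarrow> v \<in> A u \<Longrightarrow> b \<in> topspace T \<Longrightarrow> d (f v) b < r u \<Longrightarrow> (v, b) \<in> P" by metis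
  obtain \<F> where \<F>: "finite \<F>" "\<F> \<subseteq> A ` K" "K \<subseteq> \<Union>\<F>"
    using compactinD[OF K, of "A ` K"] Ar by blast
  obtain I where I: "finite I" "I \<subseteq> K" "\<F> = A ` I" using finite_subset_image[OF \<F>(1,2)] by blast
  define \<eta> where "\<eta> = Min (insert 1 (r ` I))"
  have \<eta>: "\<eta> > 0" "\<And>u. u \<in> I \<Longrightarrow> \<eta> \<le> r u" using I Ar by (auto simp: \<eta>_def)
  have "(v, b) \<in> P" if vb: "v \<in> K" "b \<in> topspace T" "d (f v) b < \<eta>" for v b
  proof -
    obtain u where "u \<in> I" "v \<in> A u" using \<F>(3) I(3) vb(1) by blast
    then show ?thesis using Ar(4)[of u v b] I(2) \<eta>(2)[of u] vb by force
  qed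
  then show ?thesis using \<eta>(1) by blast
qed

lemma metric_of_subtopology:
  assumes "metric_of T d" "S \<subseteq> topspace T"
  shows "metric_of (subtopology T S) d"
proof -
  interpret Metric_space "topspace T" d using assms unfolding metric_of_def by blast
  interpret Submetric "topspace T" d S by unfold_locales (rule assms)
  have "topspace (subtopology T S) = S" using assms by auto
  then show ?thesis using assms mtopology_submetric sub.Metric_space_axioms unfolding metric_of_def by metis
qed

lemma continuous_map_metric_of:
  assumes d: "metric_of T d" and f: "continuous_map Z T f" and g: "continuous_map Z T g"
  shows "continuous_map Z euclideanreal (\<lambda>x. d (f x) (g x))"
proof -
  interpret Metric_space "topspace T" d using d unfolding metric_of_def by blast
  have "mtopology_of (metric (topspace T, d)) = T" using d unfolding metric_of_def by simp
  then show ?thesis using continuous_map_mdist[of Z "metric (topspace T, d)" f g] f g by simp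
qed

section \<open>Products of discs and balls\<close>

lemma continuous_on_shift: "continuous_on S (\<lambda>u i. u (Suc i))"
  by (intro continuous_on_coordinatewise_then_product continuous_on_coordinate)

lemma cprod_subset_cspace: "B \<subseteq> cspace N \<Longrightarrow> cprod A B \<subseteq> cspace (Suc N)"
proof
  fix u assume B: "B \<subseteq> cspace N" and u: "u \<in> cprod A B"
  have "(\<lambda>i. u (Suc i)) \<in> cspace N" using B u by (auto simp: cprod_def)
  then have "u (Suc i) = 0" if "i \<ge> N" for i using that by (simp add: cspace_def)
  then show "u \<in> cspace (Suc N)" unfolding cspace_def by (auto dest: Suc_le_D)
qed

lemma cspace_ball_subset: "cspace_ball n r \<subseteq> cspace n" "cspace_cball n r \<subseteq> cspace n"
  by (auto simp: cspace_ball_def cspace_cball_def)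

lemma shift_in_cspace: "u \<in> cspace (Suc N) \<Longrightarrow> (\<lambda>i. u (Suc i)) \<in> cspace N"
  by (simp add: cspace_def)

lemma openin_cspace_ball: "openin (top_of_set (cspace n)) (cspace_ball n r)"
proof -
  have "cspace_ball n r = cspace n \<inter> {w. cdist n w (\<lambda>_. 0) < r}" by (auto simp: cspace_ball_def)
  then show ?thesis by (simp only:) (rule openin_open_Int[OF open_cdist_ball])
qed

lemma openin_cprod:
  assumes "open A" "openin (top_of_set (cspace N)) B"
  shows "openin (top_of_set (cspace (Suc N))) (cprod A B)"
proof -
  obtain B' where B': "open B'" "B = cspace N \<inter> B'" using assms(2) by (auto simp: openin_open)
  have "cprod A B = cspace (Suc N) \<inter> ((\<lambda>u. u 0) -` A \<inter> (\<lambda>u i. u (Suc i)) -` B')"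
    using cprod_subset_cspace[of B N A] B' by (auto simp: cprod_def shift_in_cspace)
  moreover have "open ((\<lambda>u. u 0) -` A)"
    using assms(1) continuous_on_coordinate[of UNIV] by (intro open_vimage) auto
  moreover have "open ((\<lambda>u i. u (Suc i)) -` B')"
    using B'(1) continuous_on_shift by (intro open_vimage) auto
  ultimately show ?thesis by (simp only:) (intro openin_open_Int open_Int)
qed

lemma continuous_on_case_nat:
  assumes "continuous_on S f" "continuous_on S g"
  shows "continuous_on S (\<lambda>x. case_nat (f x) (g x))"
proof (rule continuous_on_coordinatewise_then_product)
  fix i show "continuous_on S (\<lambda>x. case_nat (f x) (g x) i)"
    using assms continuous_on_product_then_coordinatewise[OF assms(2)] by (cases i) simp_all
qed

lemma cprod_eq_image: "cprod A B = (\<lambda>(c, b). case_nat c b) ` (A \<times> B)"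
proof -
  have "u = case_nat (u 0) (\<lambda>i. u (Suc i))" for u :: "nat \<Rightarrow> complex"
    by (auto simp: fun_eq_iff split: nat.split)
  then have 1: "u = (\<lambda>(c, b). case_nat c b) (u 0, \<lambda>i. u (Suc i))" for u :: "nat \<Rightarrow> complex" by simp
  have "u \<in> (\<lambda>(c, b). case_nat c b) ` (A \<times> B)" if "u \<in> cprod A B" for u
  proof (rule image_eqI[where x = "(u 0, \<lambda>i. u (Suc i))"])
    show "u = (\<lambda>(c, b). case_nat c b) (u 0, \<lambda>i. u (Suc i))" by (rule 1)
    show "(u 0, \<lambda>i. u (Suc i)) \<in> A \<times> B" using that by (simp add: cprod_def)
  qed
  moreover have "case_nat c b \<in> cprod A B" if "c \<in> A" "b \<in> B" for c b
    using that by (simp add: cprod_def)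
  ultimately show ?thesis by auto
qed

lemma compact_cprod:
  assumes "compact A" "compact B" shows "compact (cprod A B)"
  unfolding cprod_eq_image
proof (rule compact_continuous_image)
  show "continuous_on (A \<times> B) (\<lambda>(c, b). case_nat c b)"
    unfolding case_prod_unfold by (intro continuous_on_case_nat continuous_intros)
qed (intro compact_Times assms)

lemma cprod_mono: "A \<subseteq> A' \<Longrightarrow> B \<subseteq> B' \<Longrightarrow> cprod A B \<subseteq> cprod A' B'"
  by (auto simp: cprod_def)

lemma cspace_cball_subset_ball: "r < s \<Longrightarrow> cspace_cball n r \<subseteq> cspace_ball n s"
  by (auto simp: cspace_ball_def cspace_cball_def)

lemma holomorphic_map_on_open_submanifold_iff:
  assumes N: "complex_manifold N" and V: "openin (mtop N) V"
  shows "holomorphic_map_on M W (open_submanifold N V) f \<longleftrightarrow> holomorphic_map_on M W N f \<and> f ` W \<subseteq> V"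
proof -
  note N' = complex_manifold_open_submanifold[OF N V]
  have "openin (mtop M) W \<Longrightarrow> topspace (subtopology (mtop M) W) = W"
    using openin_subset by fastforce
  then show ?thesis
    unfolding holomorphic_map_on_iff[OF N] holomorphic_map_on_iff[OF N'] open_submanifold_simps(1)
      continuous_map_in_subtopology
    using holomorphic_at_into_open_submanifold[of f _ V M N] by (auto simp: image_subset_iff Pi_iff)
qed

lemma holomorphic_map_on_const:
  assumes N: "complex_manifold N" and W: "openin (mtop M) W" and y: "y \<in> points N" and M: "complex_manifold M"
  shows "holomorphic_map_on M W N (\<lambda>_. y)"
  unfolding holomorphic_map_on_iff[OF N] holomorphic_at_def
  using W y manifold_chart(5)[OF M] by (fastforce intro!: complex_differentiable_const)

lemma closed_disc_compact: "closed_disc D \<Longrightarrow> compact D"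
  unfolding closed_disc_def using homeomorphic_compactness compact_cball by blast

lemma special_pair_compact:
  assumes "special_pair D D'" shows "compact D" "compact D'" "D \<subseteq> D'"
  using assms unfolding special_pair_def by (auto intro: closed_disc_compact)

section \<open>LSAP of dominated manifolds\<close>

text \<open>A local section of \<open>h\<close> moves sprays into the LSAP manifold, and \<open>h\<close> moves the approximations back.\<close>

lemma LSAP_at_dominated:
  fixes X :: "'x charted_space" and Y :: "'y charted_space"
  assumes X: "complex_manifold X" and Y: "LSAP_manifold Y" and h: "holomorphic_map Y X h"
    and y: "y \<in> points Y" "h y = x" and sd: "surjective_differential_at Y X h y"
  shows "LSAP_at X x"
proof -
  have Ym: "complex_manifold Y" and "LSAP_at Y y" using Y y unfolding LSAP_manifold_def by blast+
  obtain Q T where Q: "openin (prod_topology (mtop Y) (mtop X)) Q" "(y, h y) \<in> Q"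
    and Tc: "continuous_map (subtopology (prod_topology (mtop Y) (mtop X)) Q) (mtop Y) (\<lambda>(a, b). T a b)"
    and hT: "\<And>a b. (a, b) \<in> Q \<Longrightarrow> h (T a b) = b" and Th: "\<And>a. (a, h a) \<in> Q \<Longrightarrow> T a (h a) = a"
    and Thol: "\<And>k W F G. holomorphic_map_on (cspace_manifold k) W Y F \<Longrightarrow> holomorphic_map_on (cspace_manifold k) W X G \<Longrightarrow>
      (\<And>u. u \<in> W \<Longrightarrow> (F u, G u) \<in> Q) \<Longrightarrow> holomorphic_map_on (cspace_manifold k) W Y (\<lambda>u. T (F u) (G u))"
    by (rule submersion_local_lift[OF Ym X h y(1) sd]) blast
  from \<open>LSAP_at Y y\<close>[unfolded LSAP_at_def] obtain VY where VY: "openin (mtop Y) VY" "y \<in> VY"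
    and app: "\<forall>D D' N F. special_pair D D' \<and> holomorphic_spray D N (open_submanifold Y VY) F \<longrightarrow>
       (\<exists>r. 0 < r \<and> r < 1 \<and> (\<forall>d \<epsilon>. metric_of (mtop Y) d \<and> 0 < \<epsilon> \<longrightarrow>
         (\<exists>G. holomorphic_near (cspace_manifold (Suc N)) (cprod D' (cspace_cball N r)) Y G \<and>
                      (\<forall>u \<in> cprod D (cspace_cball N r). d (F u) (G u) < \<epsilon>))))"
    by (elim exE conjE)
  \<comment> \<open>\<open>V0\<close> is the domain of the section \<open>T y\<close>; the points
    that it sends into the neighbourhood \<open>VY\<close> from LSAP at \<open>y\<close> will form
    \<open>V\<close>.\<close>
  define V0 where "V0 = {b \<in> points X. (y, b) \<in> Q}"
  have pc: "continuous_map (mtop X) (prod_topology (mtop Y) (mtop X)) (\<lambda>b. (y, b))"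
    using y(1) by (auto simp: continuous_map_pairwise o_def)
  have V0: "openin (mtop X) V0" unfolding V0_def by (rule openin_continuous_map_preimage[OF pc Q(1)])
  define V where "V = {b \<in> V0. T y b \<in> VY}"
  have "continuous_map (subtopology (mtop X) V0) (subtopology (prod_topology (mtop Y) (mtop X)) Q) (\<lambda>b. (y, b))"
    using pc by (auto simp: continuous_map_in_subtopology V0_def intro: continuous_map_from_subtopology)
  from continuous_map_compose[OF this Tc]
  have "continuous_map (subtopology (mtop X) V0) (mtop Y) (\<lambda>b. T y b)" by (simp add: o_def)
  from openin_continuous_map_preimage[OF this VY(1)]
  have "openin (subtopology (mtop X) V0) V"
    unfolding V_def using openin_subset[OF V0] by (simp add: Int_absorb1)
  then have V: "openin (mtop X) V" using V0 openin_trans_full by blast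
  have hc: "continuous_map (mtop Y) (mtop X) h" using h unfolding holomorphic_map_on_def by simp
  have hy: "h y \<in> points X" using hc y(1) unfolding continuous_map_def by blast
  have xV: "x \<in> V" using Q(2) Th[OF Q(2)] VY(2) y(2) hy by (auto simp: V_def V0_def)
  have VQ: "(y, b) \<in> Q" "T y b \<in> VY" if "b \<in> V" for b using that by (auto simp: V_def V0_def)
  show ?thesis unfolding LSAP_at_def
  proof (intro exI[of _ V] conjI allI impI V xV)
    fix D D' N F assume a: "special_pair D D' \<and> holomorphic_spray D N (open_submanifold X V) F"
    then obtain \<Omega> where \<Omega>: "open \<Omega>" "D \<subseteq> \<Omega>"
      and F: "holomorphic_map_on (cspace_manifold (Suc N)) (cprod \<Omega> (cspace_ball N 1)) (open_submanifold X V) F"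
      unfolding holomorphic_spray_def by blast
    define W where "W = cprod \<Omega> (cspace_ball N 1)"
    have W: "openin (top_of_set (cspace (Suc N))) W"
      unfolding W_def by (intro openin_cprod \<Omega> openin_cspace_ball)
    have FX: "holomorphic_map_on (cspace_manifold (Suc N)) W X F" and FV: "F ` W \<subseteq> V"
      using F unfolding W_def holomorphic_map_on_open_submanifold_iff[OF X V] by blast+
    define F' where "F' = (\<lambda>u. T y (F u))"
    have F'Y: "holomorphic_map_on (cspace_manifold (Suc N)) W Y F'"
      unfolding F'_def
    proof (rule Thol[OF holomorphic_map_on_const[OF Ym _ y(1)] FX])
      show "openin (mtop (cspace_manifold (Suc N))) W" using W by simp
      show "(y, F u) \<in> Q" if "u \<in> W" for u using VQ FV that by blast
    qed (rule complex_manifold_cspace)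
    have "F' ` W \<subseteq> VY" using FV VQ by (auto simp: F'_def)
    then have "holomorphic_spray D N (open_submanifold Y VY) F'"
      unfolding holomorphic_spray_def holomorphic_map_on_open_submanifold_iff[OF Ym VY(1)]
      using \<Omega> F'Y by (intro exI[of _ \<Omega>]) (simp add: W_def)
    with app[rule_format, of D D' N F'] a
    obtain r where r: "0 < r" "r < 1" and appr: "\<forall>d \<epsilon>. metric_of (mtop Y) d \<and> 0 < \<epsilon> \<longrightarrow>
         (\<exists>G. holomorphic_near (cspace_manifold (Suc N)) (cprod D' (cspace_cball N r)) Y G \<and>
                      (\<forall>u \<in> cprod D (cspace_cball N r). d (F' u) (G u) < \<epsilon>))"
      by blast
    \<comment> \<open>The radius of the lifted spray is taken over: it was obtained before any
      metric or error was chosen.\<close>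
    show "\<exists>r. 0 < r \<and> r < 1 \<and> (\<forall>d \<epsilon>. metric_of (mtop X) d \<and> 0 < \<epsilon> \<longrightarrow>
         (\<exists>G. holomorphic_near (cspace_manifold (Suc N)) (cprod D' (cspace_cball N r)) X G \<and>
                      (\<forall>u \<in> cprod D (cspace_cball N r). d (F u) (G u) < \<epsilon>)))"
    proof (intro exI[of _ r] conjI r allI impI)
      fix d and \<epsilon> :: real assume "metric_of (mtop X) d \<and> 0 < \<epsilon>"
      then have d: "metric_of (mtop X) d" and \<epsilon>: "0 < \<epsilon>" by blast+
      obtain dY where dY: "metric_of (mtop Y) dY" using complex_manifold_metrizable[OF Ym] by blast
      interpret d: Metric_space "points X" d using d unfolding metric_of_def by blast
      define K where "K = cprod D (cspace_cball N r)"
      have KW: "K \<subseteq> W" unfolding K_def W_def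
        by (intro cprod_mono \<Omega> cspace_cball_subset_ball r)
      let ?Z = "subtopology (top_of_set (cspace (Suc N))) W"
      have Wc: "W \<subseteq> cspace (Suc N)" using openin_subset[OF W] by simp
      have tZ: "topspace ?Z = W" using Wc by auto
      have K: "compactin ?Z K"
        using KW Wc compact_cprod[OF special_pair_compact(1) compact_cspace_cball] a
        by (auto simp: K_def compactin_subtopology)
      have Fc: "continuous_map ?Z (mtop X) F" using FX unfolding holomorphic_map_on_def by simp
      have F'c: "continuous_map ?Z (mtop Y) F'" using F'Y unfolding holomorphic_map_on_def by simp
      \<comment> \<open>Pairs \<open>(u, b)\<close> with \<open>h b\<close> close to
        \<open>F u\<close>. The set is open and contains the graph of \<open>F'\<close> over
        \<open>K\<close>, because \<open>T y\<close> is a section; hence \<open>G\<close> close to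
        \<open>F'\<close> gives \<open>h \<circ> G\<close> close to \<open>F\<close>.\<close>
      define P where "P = {p \<in> topspace (prod_topology ?Z (mtop Y)). d (F (fst p)) (h (snd p)) < \<epsilon>}"
      have "continuous_map (prod_topology ?Z (mtop Y)) euclideanreal (\<lambda>p. d (F (fst p)) (h (snd p)))"
        using continuous_map_compose[OF continuous_map_fst Fc] continuous_map_compose[OF continuous_map_snd hc]
        by (intro continuous_map_metric_of[OF d]) (simp_all add: o_def)
      from openin_continuous_map_preimage[OF this, of "{..<\<epsilon>}"]
      have P: "openin (prod_topology ?Z (mtop Y)) P" by (simp add: P_def)
      have KP: "(u, F' u) \<in> P" if "u \<in> K" for u
      proof -
        have u: "u \<in> W" using that KW by blast
        have "h (F' u) = F u" unfolding F'_def using FV VQ u by (intro hT) blast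
        moreover have "F' u \<in> points Y" "F u \<in> points X"
          using F'c Fc u tZ unfolding continuous_map_def by blast+
        ultimately show ?thesis using u \<epsilon> Wc by (auto simp: P_def)
      qed
      obtain \<eta> where \<eta>: "\<eta> > 0" "\<forall>u\<in>K. \<forall>b\<in>points Y. dY (F' u) b < \<eta> \<longrightarrow> (u, b) \<in> P"
        using compact_graph_neighbourhood[OF K F'c P KP dY] by blast
      obtain G where G: "holomorphic_near (cspace_manifold (Suc N)) (cprod D' (cspace_cball N r)) Y G"
        "\<forall>u \<in> K. dY (F' u) (G u) < \<eta>" using appr dY \<eta>(1) unfolding K_def by blast
      obtain W' where W': "cprod D' (cspace_cball N r) \<subseteq> W'" "holomorphic_map_on (cspace_manifold (Suc N)) W' Y G"
        using G(1) unfolding holomorphic_near_def by blast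
      have GW: "G u \<in> points Y" if "u \<in> W'" for u
        using W'(2) that openin_subset[of "mtop (cspace_manifold (Suc N))" W']
        unfolding holomorphic_map_on_def continuous_map_def by auto
      have "holomorphic_map_on (cspace_manifold (Suc N)) W' X (\<lambda>u. h (G u))"
        by (rule holomorphic_map_on_compose[OF complex_manifold_cspace Ym X W'(2) h GW])
      then have "holomorphic_near (cspace_manifold (Suc N)) (cprod D' (cspace_cball N r)) X (\<lambda>u. h (G u))"
        using W'(1) unfolding holomorphic_near_def by blast
      moreover have "d (F u) (h (G u)) < \<epsilon>" if u: "u \<in> K" for u
      proof -
        have "u \<in> W'" using u W'(1) special_pair_compact(3) a unfolding K_def by (auto simp: cprod_def)
        then have "(u, G u) \<in> P" using \<eta>(2) G(2) GW u by blast
        then show ?thesis by (simp add: P_def)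
      qed
      ultimately show "\<exists>G. holomorphic_near (cspace_manifold (Suc N)) (cprod D' (cspace_cball N r)) X G \<and>
                      (\<forall>u \<in> cprod D (cspace_cball N r). d (F u) (G u) < \<epsilon>)"
        unfolding K_def by blast
    qed
  qed
qed

text \<open>A neighbourhood and approximations found in \<open>U\<close> serve in \<open>X\<close>.
  The point to check is the metric: each one inducing the topology of \<open>X\<close> restricts to
  one inducing that of \<open>U\<close>.\<close>

lemma LSAP_at_open_submanifold:
  assumes X: "complex_manifold X" and U: "openin (mtop X) U" and x: "LSAP_at (open_submanifold X U) x"
  shows "LSAP_at X x"
proof -
  from x[unfolded LSAP_at_def open_submanifold_simps(1)]
  obtain V where V: "openin (subtopology (mtop X) U) V" "x \<in> V"
    and app: "\<forall>D D' N F. special_pair D D' \<and> holomorphic_spray D N (open_submanifold (open_submanifold X U) V) F \<longrightarrow>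
       (\<exists>r. 0 < r \<and> r < 1 \<and> (\<forall>d \<epsilon>. metric_of (subtopology (mtop X) U) d \<and> 0 < \<epsilon> \<longrightarrow>
         (\<exists>G. holomorphic_near (cspace_manifold (Suc N)) (cprod D' (cspace_cball N r)) (open_submanifold X U) G \<and>
                      (\<forall>u \<in> cprod D (cspace_cball N r). d (F u) (G u) < \<epsilon>))))"
    by (elim exE conjE)
  have VX: "openin (mtop X) V" using V U openin_trans_full by blast
  have VU: "V \<subseteq> U" using openin_subset[OF V(1)] by simp
  have near: "holomorphic_near M K X G" if "holomorphic_near M K (open_submanifold X U) G" for M K G
    using that unfolding holomorphic_near_def holomorphic_map_on_open_submanifold_iff[OF X U] by blast
  have sub: "metric_of (subtopology (mtop X) U) d" if "metric_of (mtop X) d" for d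
    using metric_of_subtopology[OF that] openin_subset[OF U] by blast
  show ?thesis unfolding LSAP_at_def
  proof (intro exI[of _ V] conjI allI impI VX V(2))
    fix D D' N F assume a: "special_pair D D' \<and> holomorphic_spray D N (open_submanifold X V) F"
    with app[rule_format, of D D' N F, unfolded open_submanifold_twice[OF VU]]
    obtain r where r: "0 < r" "r < 1" "\<forall>d \<epsilon>. metric_of (subtopology (mtop X) U) d \<and> 0 < \<epsilon> \<longrightarrow>
         (\<exists>G. holomorphic_near (cspace_manifold (Suc N)) (cprod D' (cspace_cball N r)) (open_submanifold X U) G \<and>
                      (\<forall>u \<in> cprod D (cspace_cball N r). d (F u) (G u) < \<epsilon>))"
      by blast
    show "\<exists>r. 0 < r \<and> r < 1 \<and> (\<forall>d \<epsilon>. metric_of (mtop X) d \<and> 0 < \<epsilon> \<longrightarrow>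
         (\<exists>G. holomorphic_near (cspace_manifold (Suc N)) (cprod D' (cspace_cball N r)) X G \<and>
                      (\<forall>u \<in> cprod D (cspace_cball N r). d (F u) (G u) < \<epsilon>)))"
    proof (intro exI[of _ r] conjI r(1,2) allI impI)
      fix d and \<epsilon> :: real assume "metric_of (mtop X) d \<and> 0 < \<epsilon>"
      then show "\<exists>G. holomorphic_near (cspace_manifold (Suc N)) (cprod D' (cspace_cball N r)) X G \<and>
                      (\<forall>u \<in> cprod D (cspace_cball N r). d (F u) (G u) < \<epsilon>)"
        using r(3)[rule_format, of d \<epsilon>] sub[of d] near by blast
    qed
  qed
qed

section \<open>Stein domains and polynomial convexity\<close>

text \<open>
  The points outside \<open>D\<close> that are separated from \<open>D\<close> by an entire function form a relatively closed
  set: if \<open>q a = 1\<close> and \<open>q\<close> is small on \<open>D\<close>, then with the entire function \<open>w z = (b - a) (1 - q z) / (z - a)\<close>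
  the function \<open>w\<^sup>2 + q (1 + w)\<close> separates every \<open>b\<close> close to \<open>a\<close>.
\<close>

lemma entire_separation_step:
  fixes a b :: complex
  assumes q: "q holomorphic_on UNIV" "q a = 1" "\<And>z. z \<in> D \<Longrightarrow> cmod (q z) \<le> 1/9"
    and ab: "a \<noteq> b" and D: "\<And>z. z \<in> D \<Longrightarrow> 2 * cmod (b - a) \<le> cmod (z - a)"
  shows "\<exists>Q. Q holomorphic_on UNIV \<and> Q b = 1 \<and> (\<forall>z\<in>D. cmod (Q z) \<le> 39/81)"
proof -
  \<comment> \<open>The difference quotient of \<open>q\<close> at \<open>a\<close>, completed by
    the derivative to an entire function.\<close>
  define p where "p = (\<lambda>z. if z = a then deriv q a else (q z - q a) / (z - a))"
  have p: "p holomorphic_on UNIV" unfolding p_def by (intro pole_lemma_open q) auto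
  define w where "w = (\<lambda>z. (a - b) * p z)"
  \<comment> \<open>With \<open>w b = 1 - q b\<close> the value at \<open>b\<close> is
    \<open>(1 - q b)^2 + q b * (2 - q b) = 1\<close>. On \<open>D\<close> the modulus of
    \<open>w\<close> is at most \<open>1/2 * 10/9 = 5/9\<close>, which leaves
    \<open>25/81 + 14/81\<close> for \<open>Q\<close>.\<close>
  define Q where "Q = (\<lambda>z. (w z)\<^sup>2 + q z * (1 + w z))"
  have "Q holomorphic_on UNIV" unfolding Q_def w_def by (intro holomorphic_intros p q)
  moreover have "Q b = 1"
  proof -
    have "(a - b) * ((q b - 1) / (b - a)) = 1 - q b" using ab by (simp add: divide_simps) (simp add: algebra_simps)
    then have "w b = 1 - q b" using ab q(2) by (simp add: w_def p_def)
    then have "Q b = (1 - q b)\<^sup>2 + q b * (1 + (1 - q b))" by (simp add: Q_def)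
    then show ?thesis by (simp add: power2_eq_square algebra_simps)
  qed
  moreover have "cmod (Q z) \<le> 39/81" if z: "z \<in> D" for z
  proof -
    have za: "z \<noteq> a" using D[OF z] ab by auto
    have "cmod (w z) = cmod (b - a) * cmod (1 - q z) / cmod (z - a)"
      using za q(2) by (simp add: w_def p_def norm_mult norm_divide norm_minus_commute)
    also have "\<dots> \<le> cmod (b - a) * (10/9) / cmod (z - a)"
      using norm_triangle_ineq4[of 1 "q z"] q(3)[OF z] by (intro divide_right_mono mult_left_mono) auto
    also have "\<dots> \<le> 5/9" using D[OF z] za by (simp add: field_simps)
    finally have w: "cmod (w z) \<le> 5/9" .
    have "cmod (Q z) \<le> cmod (w z) * cmod (w z) + cmod (q z) * (1 + cmod (w z))"
      unfolding Q_def power2_eq_square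
      by (intro norm_triangle_le add_mono) (auto simp: norm_mult intro!: mult_left_mono order_trans[OF norm_triangle_ineq])
    also have "\<dots> \<le> 5/9 * (5/9) + 1/9 * (1 + 5/9)"
      using w q(3)[OF z] by (intro add_mono mult_mono) auto
    finally show ?thesis by simp
  qed
  ultimately show ?thesis by blast
qed

text \<open>The separated points form a set that is open (divide \<open>q\<close> by its value at
  the new point), nonempty (a linear function separates a far point) and closed in the complement of
  \<open>D\<close> by the preceding step; connectedness finishes. The bound \<open>1/2\<close> in
  \<open>A\<close> lies above \<open>39/81\<close>, and fourth powers bring it below the
  \<open>1/9\<close> that the step consumes.\<close>

lemma entire_separation:
  fixes D :: "complex set"
  assumes D: "compact D" "connected (- D)" and z: "z \<notin> D"
  shows "\<exists>q. q holomorphic_on UNIV \<and> q z = 1 \<and> (\<forall>w\<in>D. cmod (q w) \<le> 1/9)"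
proof -
  define A where "A = {a. \<exists>q. q holomorphic_on UNIV \<and> q a = 1 \<and> (\<forall>w\<in>D. cmod (q w) \<le> 1/2)}"
  have powr: "\<exists>q. q holomorphic_on UNIV \<and> q a = 1 \<and> (\<forall>w\<in>D. cmod (q w) \<le> 1/9)" if aA: "a \<in> A" for a
  proof -
    obtain q where q: "q holomorphic_on UNIV" "q a = 1" "\<forall>w\<in>D. cmod (q w) \<le> 1/2" using aA unfolding A_def by blast
    have "cmod (q w ^ 4) \<le> 1/9" if "w \<in> D" for w
      using power_mono[of "cmod (q w)" "1/2" 4] q(3) that by (auto simp: norm_power power_divide)
    then show ?thesis using q by (intro exI[of _ "\<lambda>z. q z ^ 4"]) (auto intro!: holomorphic_intros)
  qed
  have far: "\<exists>a. a \<in> A"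
  proof -
    obtain B where B: "B > 0" "\<forall>x\<in>D. cmod x \<le> B" using compact_imp_bounded[OF D(1)] bounded_pos by blast
    have "(\<lambda>z. z / (2 * of_real B)) holomorphic_on UNIV" using B by (intro holomorphic_intros) auto
    moreover have "\<forall>w\<in>D. cmod (w / (2 * of_real B)) \<le> 1/2" using B by (auto simp: norm_divide field_simps)
    ultimately have "2 * of_real B \<in> A" using B unfolding A_def by (intro CollectI exI[of _ "\<lambda>z. z / (2 * of_real B)"]) auto
    then show ?thesis by blast
  qed
  have AD: "A \<subseteq> - D" unfolding A_def by force
  have Aop: "open A"
    unfolding open_contains_ball
  proof
    fix a assume "a \<in> A"
    then obtain q where q: "q holomorphic_on UNIV" "q a = 1" "\<forall>w\<in>D. cmod (q w) \<le> 1/9" using powr by blast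
    have "continuous_on UNIV q" using q(1) holomorphic_on_imp_continuous_on by blast
    then have "open {b. cmod (q b) > 1/2}" by (intro open_Collect_less continuous_intros)
    then obtain e where e: "e > 0" "ball a e \<subseteq> {b. cmod (q b) > 1/2}"
    proof -
      have "a \<in> {b. cmod (q b) > 1/2}" using q(2) by simp
      then show ?thesis using \<open>open {b. cmod (q b) > 1/2}\<close> that unfolding open_contains_ball by blast
    qed
    have "b \<in> A" if "b \<in> ball a e" for b
    proof -
      have qb: "cmod (q b) > 1/2" using e that by blast
      have "cmod (q w / q b) \<le> 1/2" if "w \<in> D" for w
      proof -
        have "cmod (q w) \<le> 1/2 * cmod (q b)" using q(3) that qb by force
        moreover have "cmod (q b) > 0" using qb by linarith
        ultimately show ?thesis by (simp only: norm_divide pos_divide_le_eq)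
      qed
      moreover have "(\<lambda>z. q z / q b) holomorphic_on UNIV" using q(1) qb by (intro holomorphic_intros) auto
      ultimately show ?thesis using qb unfolding A_def by (intro CollectI exI[of _ "\<lambda>z. q z / q b"]) auto
    qed
    then show "\<exists>e>0. ball a e \<subseteq> A" using e(1) by (intro exI[of _ e]) blast
  qed
  have Acl: "open (- D - A)"
    unfolding open_contains_ball
  proof
    fix b assume b: "b \<in> - D - A"
    obtain \<delta> where \<delta>: "\<delta> > 0" "\<forall>x\<in>D. \<delta> \<le> dist b x"
      using separate_point_closed[of D b] compact_imp_closed[OF D(1)] b by blast
    \<comment> \<open>Within a third of \<open>\<delta>\<close> from \<open>b\<close>, every point
      of \<open>D\<close> is at least twice as far from \<open>a\<close> as \<open>b\<close> is, as
      the separation step requires.\<close>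
    have "a \<in> - D - A" if a: "a \<in> ball b (\<delta>/3)" for a
    proof -
      have ba: "cmod (b - a) < \<delta>/3" using a by (simp add: dist_norm)
      have far: "2 * cmod (b - a) \<le> cmod (z - a)" if "z \<in> D" for z
      proof -
        have "\<delta> \<le> cmod (b - z)" using \<delta>(2) that by (simp add: dist_norm)
        also have "\<dots> \<le> cmod (b - a) + cmod (a - z)" using norm_triangle_ineq[of "b - a" "a - z"] by simp
        finally show ?thesis using ba by (simp add: norm_minus_commute)
      qed
      have "a \<notin> D" using \<delta> ba by (auto simp: dist_norm)
      moreover have "a \<notin> A"
      proof
        assume "a \<in> A"
        then obtain q where q: "q holomorphic_on UNIV" "q a = 1" "\<forall>w\<in>D. cmod (q w) \<le> 1/9" using powr by blast
        have "b \<noteq> a" using b \<open>a \<in> A\<close> by blast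
        then obtain Q where Q: "Q holomorphic_on UNIV" "Q b = 1" "\<forall>z\<in>D. cmod (Q z) \<le> 39/81"
          using entire_separation_step[of q a D b] q far by auto
        have "\<forall>z\<in>D. cmod (Q z) \<le> 1/2" using Q(3) by force
        then show False using b Q unfolding A_def by blast
      qed
      ultimately show ?thesis by blast
    qed
    then show "\<exists>e>0. ball b e \<subseteq> - D - A" using \<delta>(1) by (intro exI[of _ "\<delta>/3"]) auto
  qed
  have "- D - A = {}"
    using D(2) Aop Acl far AD unfolding connected_def by blast
  then show ?thesis using powr z by blast
qed

section \<open>Open subsets of C^n as manifolds, their hulls and the Stein property\<close>

abbreviation cdomain :: "nat \<Rightarrow> (nat \<Rightarrow> complex) set \<Rightarrow> (nat \<Rightarrow> complex) charted_space" where
  "cdomain n W \<equiv> open_submanifold (cspace_manifold n) W"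

lemma cdomain_simps:
  assumes "openin (top_of_set (cspace n)) W"
  shows "mtop (cdomain n W) = top_of_set W" "charts (cdomain n W) = {(n, W, \<lambda>z. z)}"
  using openin_subset[OF assms] by (auto simp: open_submanifold_simps subtopology_subtopology Int_absorb1)

lemma complex_manifold_cdomain:
  "openin (top_of_set (cspace n)) W \<Longrightarrow> complex_manifold (cdomain n W)"
  by (intro complex_manifold_open_submanifold complex_manifold_cspace) simp

lemma complex_differentiable_inv_into_cdomain:
  assumes W: "openin (top_of_set (cspace n)) W" and z: "z \<in> W"
  shows "complex_differentiable_at n (\<lambda>w. f (inv_into W (\<lambda>z. z) w)) z \<longleftrightarrow> complex_differentiable_at n f z"
proof -
  obtain \<delta> where \<delta>: "\<delta> > 0" "\<forall>w\<in>cspace n. cdist n w z < \<delta> \<longrightarrow> w \<in> W"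
    using W z unfolding openin_cspace_iff by blast
  have zc: "z \<in> cspace n" using openin_subset[OF W] z by auto
  show ?thesis
    by (rule iffI; erule complex_differentiable_cong[OF _ zc \<delta>(1)]) (use \<delta>(2) in \<open>simp_all add: inv_into_id\<close>)
qed

lemma holomorphic_function_on_cdomain:
  assumes W: "openin (top_of_set (cspace n)) W"
  shows "holomorphic_function_on (cdomain n W) W f \<longleftrightarrow> (\<forall>z\<in>W. complex_differentiable_at n f z)"
  unfolding holomorphic_function_on_iff_at cdomain_simps[OF W]
  by (simp add: complex_differentiable_inv_into_cdomain[OF W])

lemma holomorphic_map_on_cdomain:
  assumes W: "openin (top_of_set (cspace n)) W" and N: "complex_manifold N" and W': "W' \<subseteq> W"
  shows "holomorphic_map_on (cdomain n W) W' N f \<longleftrightarrow> holomorphic_map_on (cspace_manifold n) W' N f"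
proof -
  have Wc: "W \<subseteq> cspace n" using openin_subset[OF W] by simp
  have 1: "subtopology (top_of_set W) W' = subtopology (top_of_set (cspace n)) W'"
    using W' Wc by (simp add: subtopology_subtopology Int_absorb1)
  have 2: "openin (top_of_set W) W' \<longleftrightarrow> openin (top_of_set (cspace n)) W'"
    using W W' Wc openin_trans openin_subset_trans by blast
  have "holomorphic_at (cdomain n W) N f x \<longleftrightarrow> holomorphic_at (cspace_manifold n) N f x" if "x \<in> W'" for x
    using that W' W by (intro holomorphic_at_open_submanifold complex_manifold_cspace) auto
  then show ?thesis unfolding holomorphic_map_on_iff[OF N] using 1 2
    by (simp add: cdomain_simps[OF W])
qed

lemma complex_differentiable_imp_continuous_on:
  assumes W: "W \<subseteq> cspace n" and f: "\<And>z. z \<in> W \<Longrightarrow> complex_differentiable_at n f z"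
  shows "continuous_on W f"
proof (rule continuous_on_cspaceI[where n = n])
  fix z and e :: real assume z: "z \<in> W" and e: "e > 0"
  then have zc: "z \<in> cspace n" using W by blast
  obtain C \<delta> where C: "C > 0" "\<delta> > 0" "\<forall>w\<in>cspace n. cdist n w z < \<delta> \<longrightarrow> cdist 1 (\<lambda>_. f w) (\<lambda>_. f z) \<le> C * cdist n w z"
    using complex_differentiable_imp_lipschitz[of z n 1 "\<lambda>w _. f w", OF zc f[OF z]] by blast
  show "\<exists>\<delta>>0. \<forall>w\<in>W. cdist n w z < \<delta> \<longrightarrow> dist (f w) (f z) < e"
  proof (intro exI[of _ "min \<delta> (e / C)"] conjI ballI impI)
    fix w assume w: "w \<in> W" "cdist n w z < min \<delta> (e / C)"
    have "dist (f w) (f z) \<le> cdist 1 (\<lambda>_. f w) (\<lambda>_. f z)"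
      using component_le_cnorm[of 0 1 "\<lambda>_. f w - f z"] by (simp add: dist_norm)
    also have "\<dots> \<le> C * cdist n w z" using C(3) w W by auto
    also have "\<dots> < e" using w C by (simp add: field_simps)
    finally show "dist (f w) (f z) < e" .
  qed (use C e in auto)
qed

lemma holomorphic_function_differentiable_at_coordinate:
  assumes z: "z \<in> cspace (Suc N)" and f: "(f has_field_derivative d) (at (z 0))"
  shows "complex_differentiable_at (Suc N) (\<lambda>u. f (u 0)) z"
proof -
  have "has_complex_gradient (Suc N) (\<lambda>u. f (u 0)) (\<lambda>j. if j = 0 then d else 0) z"
    unfolding has_complex_gradient_iff[OF z]
  proof (intro allI impI)
    fix e :: real assume e: "e > 0"
    obtain \<delta> where \<delta>: "\<delta> > 0" "\<forall>y. cmod (y - z 0) < \<delta> \<longrightarrow> cmod (f y - f (z 0) - d * (y - z 0)) \<le> e * cmod (y - z 0)"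
      using f e unfolding has_field_derivative_def has_derivative_at_alt by blast
    show "\<exists>\<delta>>0. \<forall>w\<in>cspace (Suc N). cdist (Suc N) w z < \<delta> \<longrightarrow>
      cmod (f (w 0) - f (z 0) - (\<Sum>j<Suc N. (if j = 0 then d else 0) * (w j - z j))) \<le> e * cdist (Suc N) w z"
    proof (intro exI[of _ \<delta>] conjI ballI impI \<delta>(1))
      fix w assume "w \<in> cspace (Suc N)" "cdist (Suc N) w z < \<delta>"
      moreover have le: "cmod (w 0 - z 0) \<le> cdist (Suc N) w z"
        using component_le_cnorm[of 0 "Suc N" "\<lambda>j. w j - z j"] by simp
      ultimately have "cmod (f (w 0) - f (z 0) - d * (w 0 - z 0)) \<le> e * cmod (w 0 - z 0)"
        using \<delta>(2) by simp
      also have "\<dots> \<le> e * cdist (Suc N) w z" using le e by (intro mult_left_mono) auto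
      also have "d * (w 0 - z 0) = (\<Sum>j<Suc N. (if j = 0 then d else 0) * (w j - z j))"
        by (simp add: if_distrib[of "\<lambda>x. x * _"] cong: if_cong)
      finally show "cmod (f (w 0) - f (z 0) - (\<Sum>j<Suc N. (if j = 0 then d else 0) * (w j - z j))) \<le> e * cdist (Suc N) w z" .
    qed
  qed
  then show ?thesis unfolding complex_differentiable_at_def by blast
qed

lemma complex_differentiable_linear_form:
  "z \<in> cspace n \<Longrightarrow> complex_differentiable_at n (\<lambda>w. \<Sum>i<(m::nat). c i * w (s i)) z"
  by (intro complex_differentiable_sum complex_differentiable_cmult complex_differentiable_coordinate finite_lessThan) auto

text \<open>The linear form with coefficients \<open>cnj (z i)\<close> takes the squared norm of
  \<open>z\<close> as its value at \<open>z\<close>, so a bound for it over a ball of radius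
  \<open>r\<close> pulls \<open>z\<close> into that ball. Cancelling the norm causes the second
  alternative.\<close>

lemma cnorm_le_of_linear_forms:
  assumes "cmod (\<Sum>i<n. cnj (z i) * z i) \<le> cnorm n z * r"
  shows "cnorm n z \<le> r \<or> cnorm n z = 0"
proof -
  have "(\<Sum>i<n. cnj (z i) * z i) = of_real (\<Sum>i<n. (cmod (z i))\<^sup>2)"
    unfolding of_real_sum complex_norm_square by (intro sum.cong refl) (simp add: mult.commute)
  also have "(\<Sum>i<n. (cmod (z i))\<^sup>2) = (cnorm n z)\<^sup>2"
    by (simp add: cnorm_def L2_set_def sum_nonneg)
  finally have "cmod (\<Sum>i<n. cnj (z i) * z i) = (cnorm n z)\<^sup>2" by (simp add: norm_power del: of_real_power)
  then have "cnorm n z * cnorm n z \<le> cnorm n z * r" using assms by (simp add: power2_eq_square)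
  then show ?thesis using cnorm_nonneg[of n z] by (cases "cnorm n z = 0") (auto simp: mult_le_cancel_left)
qed

lemma holomorphic_hullD:
  assumes W: "openin (top_of_set (cspace n)) W" and z: "z \<in> holomorphic_hull (cdomain n W) K"
    and f: "\<And>w. w \<in> W \<Longrightarrow> complex_differentiable_at n f w" and B: "\<And>w. w \<in> K \<Longrightarrow> cmod (f w) \<le> B"
  shows "cmod (f z) \<le> B"
proof -
  have "holomorphic_function_on (cdomain n W) (points (cdomain n W)) f"
    using holomorphic_function_on_cdomain[OF W] f by (simp add: cdomain_simps[OF W])
  then show ?thesis using z B unfolding holomorphic_hull_def by blast
qed

text \<open>Coordinate functions separate points and are local coordinates, and a hull is closed in
  \<open>W\<close> as an intersection of closed sets. What depends on \<open>W\<close> is that hulls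
  stay away from its boundary, and this is the assumption \<open>hull\<close>.\<close>

lemma stein_cdomain:
  assumes W: "openin (top_of_set (cspace n)) W"
    and hull: "\<And>K. compact K \<Longrightarrow> K \<subseteq> W \<Longrightarrow> \<exists>C. compact C \<and> C \<subseteq> W \<and> holomorphic_hull (cdomain n W) K \<subseteq> C"
  shows "stein_manifold (cdomain n W)"
  unfolding stein_manifold_def
proof (intro conjI)
  have Wc: "W \<subseteq> cspace n" using openin_subset[OF W] by simp
  note S = cdomain_simps[OF W]
  have P: "points (cdomain n W) = W" by (simp add: S)
  show "complex_manifold (cdomain n W)" by (rule complex_manifold_cdomain[OF W])
  show "\<forall>x\<in>points (cdomain n W). \<forall>y\<in>points (cdomain n W). x \<noteq> y \<longrightarrow>
        (\<exists>f. holomorphic_function_on (cdomain n W) (points (cdomain n W)) f \<and> f x \<noteq> f y)"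
    unfolding P holomorphic_function_on_cdomain[OF W]
  proof (intro ballI impI)
    fix x y assume "x \<in> W" "y \<in> W" "x \<noteq> y"
    then obtain i where "x i \<noteq> y i" by (auto simp: fun_eq_iff)
    then show "\<exists>f. (\<forall>z\<in>W. complex_differentiable_at n f z) \<and> f x \<noteq> f y"
      using Wc by (intro exI[of _ "\<lambda>z. z i"]) (auto intro: complex_differentiable_coordinate)
  qed
  have id: "holomorphic_map (cdomain n W) (cspace_manifold n) (\<lambda>z. z)"
  proof -
    have "complex_differentiable_at n (\<lambda>w. w i) x" if "x \<in> W" for x i
      using that Wc by (auto intro: complex_differentiable_coordinate)
    moreover have "continuous_map (subtopology (top_of_set (cspace n)) W) euclidean (\<lambda>z. z)"
      by (simp add: subtopology_subtopology)
    ultimately have "holomorphic_map_on (cspace_manifold n) W (cspace_manifold n) (\<lambda>z. z)"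
      unfolding holomorphic_map_on_iff[OF complex_manifold_cspace]
      using W Wc holomorphic_at_cspace[of _ n "cspace_manifold n"]
      by (auto simp: continuous_map_in_subtopology subset_iff)
    then show ?thesis unfolding P using holomorphic_map_on_cdomain[OF W complex_manifold_cspace] by blast
  qed
  have "surjective_differential_at (cdomain n W) (cspace_manifold n) (\<lambda>z. z) x" if x: "x \<in> W" for x
  proof -
    have xc: "x \<in> cspace n" using x Wc by blast
    obtain \<delta> where \<delta>: "\<delta> > 0" "\<forall>w\<in>cspace n. cdist n w x < \<delta> \<longrightarrow> w \<in> W"
      using W x unfolding openin_cspace_iff by blast
    define A :: "nat \<Rightarrow> nat \<Rightarrow> complex" where "A = (\<lambda>i j. if j = i then 1 else 0)"
    have "has_complex_gradient n (\<lambda>z. inv_into W (\<lambda>z. z) z i) (A i) x" if "i < n" for i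
      unfolding A_def
      by (rule has_complex_gradient_cong[OF has_complex_gradient_coordinate[OF xc that] xc \<delta>(1)])
        (use \<delta>(2) in \<open>simp add: inv_into_id\<close>)
    moreover have "(\<Sum>j<n. A i j * v j) = v i" if "i < n" for i and v :: "nat \<Rightarrow> complex"
      unfolding A_def using that by (simp add: if_distrib[of "\<lambda>x. x * _"] cong: if_cong)
    ultimately have "\<exists>A. (\<forall>i<n. has_complex_gradient n (\<lambda>z. inv_into W (\<lambda>z. z) z i) (A i) x) \<and>
            (\<forall>v\<in>cspace n. \<exists>u\<in>cspace n. \<forall>i<n. (\<Sum>j<n. A i j * u j) = v i)"
      by (intro exI[of _ A]) blast
    then show ?thesis
      unfolding surjective_differential_at_def S(2) points_cspace_manifold(2) by simp
  qed
  then show "\<forall>(na, U, \<phi>)\<in>charts (cdomain n W). \<forall>x\<in>U. \<exists>f. holomorphic_map (cdomain n W) (cspace_manifold na) f \<and>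
             surjective_differential_at (cdomain n W) (cspace_manifold na) f x"
    unfolding S(2) using id by auto
  show "\<forall>K. compactin (mtop (cdomain n W)) K \<longrightarrow> compactin (mtop (cdomain n W)) (holomorphic_hull (cdomain n W) K)"
  proof (intro allI impI)
    fix K assume "compactin (mtop (cdomain n W)) K"
    then have "compact K" "K \<subseteq> W" by (auto simp: S compactin_subtopology)
    then obtain C where C: "compact C" "C \<subseteq> W" "holomorphic_hull (cdomain n W) K \<subseteq> C" using hull by blast
    define \<F> where "\<F> = {(f, B). (\<forall>z\<in>W. complex_differentiable_at n f z) \<and> (\<forall>y\<in>K. cmod (f y) \<le> B)}"
    have eq: "holomorphic_hull (cdomain n W) K = (\<Inter>(f, B)\<in>\<F>. {x \<in> W. cmod (f x) \<le> B})"
    proof -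
      \<comment> \<open>The family must have a member for its intersection to lie in
        \<open>W\<close>.\<close>
      have "((\<lambda>_. 0), 0) \<in> \<F>" using Wc by (auto simp: \<F>_def intro: complex_differentiable_const)
      then show ?thesis unfolding holomorphic_hull_def P holomorphic_function_on_cdomain[OF W]
        by (auto simp: \<F>_def)
    qed
    have "closedin (top_of_set W) {x \<in> W. cmod (f x) \<le> B}" if "(f, B) \<in> \<F>" for f B
    proof -
      have "continuous_on W (\<lambda>x. cmod (f x))"
        using that Wc by (intro continuous_intros complex_differentiable_imp_continuous_on) (auto simp: \<F>_def)
      then have "closedin (top_of_set W) (W \<inter> (\<lambda>x. cmod (f x)) -` {..B})"
        by (rule continuous_closedin_preimage) simp
      moreover have "W \<inter> (\<lambda>x. cmod (f x)) -` {..B} = {x \<in> W. cmod (f x) \<le> B}" by auto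
      ultimately show ?thesis by simp
    qed
    moreover have "((\<lambda>_. 0), 0) \<in> \<F>" using Wc by (auto simp: \<F>_def intro: complex_differentiable_const)
    ultimately have "closedin (top_of_set W) (holomorphic_hull (cdomain n W) K)"
      unfolding eq by (intro closedin_INT) auto
    moreover have "compactin (top_of_set W) C" using C by (simp add: compactin_subtopology)
    ultimately show "compactin (mtop (cdomain n W)) (holomorphic_hull (cdomain n W) K)"
      unfolding S using C(3) closed_compactin by blast
  qed
qed

text \<open>The norm attains its maximum on \<open>K\<close>. The gap between this maximum and
  \<open>\<rho>\<close> is what keeps hulls in a compact part of the open ball.\<close>

lemma compact_cnorm_bound:
  assumes K: "compact K" and lt: "\<And>z. z \<in> K \<Longrightarrow> cnorm n (s z) < \<rho>" and s: "continuous_on K s" and \<rho>: "\<rho> > 0"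
  shows "\<exists>r. 0 \<le> r \<and> r < \<rho> \<and> (\<forall>z\<in>K. cnorm n (s z) \<le> r)"
proof (cases "K = {}")
  case False
  have "continuous_on K (\<lambda>z. cnorm n (s z))"
    by (intro continuous_on_cnorm continuous_on_product_then_coordinatewise[OF s])
  then obtain z where "z \<in> K" "\<forall>w\<in>K. cnorm n (s w) \<le> cnorm n (s z)"
    using continuous_attains_sup[OF K False] by blast
  then show ?thesis using lt by (intro exI[of _ "cnorm n (s z)"]) auto
qed (use \<rho> in auto)

text \<open>Linear forms recover the norm, so the hull of a compact set stays in each closed ball
  about the origin that contains the set.\<close>

lemma stein_ball:
  assumes \<rho>: "\<rho> > 0" shows "stein_manifold (cdomain n (cspace_ball n \<rho>))"
proof (rule stein_cdomain[OF openin_cspace_ball])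
  fix K assume K: "compact K" "K \<subseteq> cspace_ball n \<rho>"
  obtain r where r: "0 \<le> r" "r < \<rho>" "\<forall>z\<in>K. cnorm n z \<le> r"
    using compact_cnorm_bound[of K n "\<lambda>z. z" \<rho>] K \<rho> by (auto simp: cspace_ball_def continuous_on_id)
  have "z \<in> cspace_cball n r" if z: "z \<in> holomorphic_hull (cdomain n (cspace_ball n \<rho>)) K" for z
  proof -
    have "cmod (\<Sum>i<n. cnj (z i) * z i) \<le> cnorm n z * r"
    proof (rule holomorphic_hullD[OF openin_cspace_ball z, where f = "\<lambda>w. \<Sum>i<n. cnj (z i) * w i"])
      show "complex_differentiable_at n (\<lambda>w. \<Sum>i<n. cnj (z i) * w i) w" if "w \<in> cspace_ball n \<rho>" for w
        using that complex_differentiable_linear_form[of w n "\<lambda>i. cnj (z i)" "\<lambda>i. i" n] by (simp add: cspace_ball_def)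
      show "cmod (\<Sum>i<n. cnj (z i) * w i) \<le> cnorm n z * r" if "w \<in> K" for w
      proof -
        have "cnorm n (\<lambda>i. cnj (z i)) = cnorm n z" by (simp add: cnorm_def)
        then show ?thesis
          using cmod_linear_form_le[of "\<lambda>i. cnj (z i)" w n] mult_left_mono[of "cnorm n w" r "cnorm n z"] r(3) that
          by simp
      qed
    qed
    then have "cnorm n z \<le> r" using cnorm_le_of_linear_forms r(1) by fastforce
    moreover have "z \<in> cspace n" using z cspace_ball_subset(1)
      unfolding holomorphic_hull_def cdomain_simps[OF openin_cspace_ball] by auto
    ultimately show ?thesis by (simp add: cspace_cball_def)
  qed
  then show "\<exists>C. compact C \<and> C \<subseteq> cspace_ball n \<rho> \<and> holomorphic_hull (cdomain n (cspace_ball n \<rho>)) K \<subseteq> C"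
    using compact_cspace_cball cspace_cball_subset_ball[OF r(2)] by (intro exI[of _ "cspace_cball n r"]) auto
qed

lemma hull_cprod_second_factor:
  assumes U: "open U" and z: "z \<in> holomorphic_hull (cdomain (Suc N) (cprod U (cspace_ball N \<rho>))) K"
    and r: "0 \<le> r" "\<And>w. w \<in> K \<Longrightarrow> cnorm N (\<lambda>i. w (Suc i)) \<le> r"
  shows "(\<lambda>i. z (Suc i)) \<in> cspace_cball N r"
proof -
  have W: "openin (top_of_set (cspace (Suc N))) (cprod U (cspace_ball N \<rho>))"
    by (intro openin_cprod U openin_cspace_ball)
  let ?z = "\<lambda>i. z (Suc i)"
  have "cmod (\<Sum>i<N. cnj (?z i) * ?z i) \<le> cnorm N ?z * r"
  proof (rule holomorphic_hullD[OF W z, where f = "\<lambda>w. \<Sum>i<N. cnj (?z i) * w (Suc i)"])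
    show "complex_differentiable_at (Suc N) (\<lambda>w. \<Sum>i<N. cnj (?z i) * w (Suc i)) w" if "w \<in> cprod U (cspace_ball N \<rho>)" for w
      using that openin_subset[OF W] by (intro complex_differentiable_linear_form) auto
    show "cmod (\<Sum>i<N. cnj (?z i) * w (Suc i)) \<le> cnorm N ?z * r" if "w \<in> K" for w
    proof -
      have "cnorm N (\<lambda>i. cnj (?z i)) = cnorm N ?z" by (simp add: cnorm_def)
      then show ?thesis
        using cmod_linear_form_le[of "\<lambda>i. cnj (?z i)" "\<lambda>i. w (Suc i)" N] r(2)[OF that]
          mult_left_mono[of "cnorm N (\<lambda>i. w (Suc i))" r "cnorm N ?z"]
        by simp
    qed
  qed
  then have "cnorm N ?z \<le> r" using cnorm_le_of_linear_forms r(1) by fastforce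
  moreover have "?z \<in> cspace N" using z cspace_ball_subset(1)
    unfolding holomorphic_hull_def cdomain_simps[OF W] by (auto simp: cprod_def)
  ultimately show ?thesis by (simp add: cspace_cball_def)
qed

text \<open>The functions \<open>inverse (u 0 - a)\<close> with \<open>a\<close> outside
  \<open>U\<close> keep the first coordinate of a hull point at distance \<open>\<delta>\<close>
  from the complement of \<open>U\<close>, the first coordinate itself bounds it, and linear forms
  keep the others in a smaller closed ball.\<close>

lemma stein_cprod:
  assumes U: "open U" and \<rho>: "\<rho> > 0"
  shows "stein_manifold (cdomain (Suc N) (cprod U (cspace_ball N \<rho>)))"
proof -
  let ?W = "cprod U (cspace_ball N \<rho>)"
  have W: "openin (top_of_set (cspace (Suc N))) ?W"
    by (intro openin_cprod U openin_cspace_ball)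
  have Wc: "?W \<subseteq> cspace (Suc N)" using openin_subset[OF W] by simp
  show ?thesis
  proof (rule stein_cdomain[OF W])
    fix K assume K: "compact K" "K \<subseteq> ?W"
    obtain r where r: "0 \<le> r" "r < \<rho>" "\<forall>z\<in>K. cnorm N (\<lambda>i. z (Suc i)) \<le> r"
      using compact_cnorm_bound[of K N "\<lambda>z i. z (Suc i)" \<rho>] K \<rho> continuous_on_shift
      by (auto simp: cprod_def cspace_ball_def subset_iff)
    define K0 where "K0 = (\<lambda>z. z 0) ` K"
    have K0: "compact K0" "K0 \<subseteq> U"
      using K compact_continuous_image[OF continuous_on_coordinate K(1)] by (auto simp: K0_def cprod_def)
    obtain \<delta> where \<delta>: "\<delta> > 0" "\<forall>x\<in>K0. \<forall>y\<in>-U. \<delta> \<le> dist x y"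
      using separate_compact_closed[OF K0(1), of "-U"] U K0(2) by blast
    obtain B where B: "B > 0" "\<forall>x\<in>K0. cmod x \<le> B" using compact_imp_bounded[OF K0(1)] bounded_pos by blast
    define C0 where "C0 = cball 0 B \<inter> (\<Inter>a\<in>-U. {c. \<delta> \<le> cmod (c - a)})"
    have "compact C0" unfolding C0_def
      by (intro compact_Int_closed compact_cball closed_INT ballI closed_Collect_le continuous_intros)
    have "C0 \<subseteq> U" using \<delta>(1) by (force simp: C0_def)
    have "z \<in> cprod C0 (cspace_cball N r)" if z: "z \<in> holomorphic_hull (cdomain (Suc N) ?W) K" for z
    proof -
      have zW: "z \<in> ?W" using z unfolding holomorphic_hull_def cdomain_simps[OF W] by auto
      have "cmod (z 0) \<le> B"
        by (rule holomorphic_hullD[OF W z, where f = "\<lambda>u. u 0"])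
          (use B Wc in \<open>auto simp: K0_def intro: complex_differentiable_coordinate\<close>)
      moreover have "\<delta> \<le> cmod (z 0 - a)" if a: "a \<notin> U" for a
      proof -
        have ne: "w 0 - a \<noteq> 0" if "w \<in> ?W" for w using that a by (auto simp: cprod_def)
        have "cmod (inverse (z 0 - a)) \<le> inverse \<delta>"
        proof (rule holomorphic_hullD[OF W z, where f = "\<lambda>u. inverse (u 0 - a)"])
          fix w assume w: "w \<in> ?W"
          have "((\<lambda>c. inverse (c - a)) has_field_derivative - (inverse (w 0 - a) ^ 2)) (at (w 0))"
            using ne[OF w] by (auto intro!: derivative_eq_intros simp: power2_eq_square)
          then show "complex_differentiable_at (Suc N) (\<lambda>u. inverse (u 0 - a)) w"
            using w Wc holomorphic_function_differentiable_at_coordinate by blast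
        next
          fix w assume w: "w \<in> K"
          then have "\<delta> \<le> cmod (w 0 - a)" using \<delta>(2) a by (auto simp: K0_def dist_norm)
          then show "cmod (inverse (w 0 - a)) \<le> inverse \<delta>"
            using \<delta>(1) by (simp add: norm_inverse le_imp_inverse_le)
        qed
        then show ?thesis using ne[OF zW] \<delta>(1) by (simp add: norm_inverse)
      qed
      moreover have "(\<lambda>i. z (Suc i)) \<in> cspace_cball N r"
        using r by (intro hull_cprod_second_factor[OF U z]) auto
      ultimately show ?thesis by (auto simp: C0_def cprod_def)
    qed
    moreover have "compact (cprod C0 (cspace_cball N r))"
      by (intro compact_cprod \<open>compact C0\<close> compact_cspace_cball)
    moreover have "cprod C0 (cspace_cball N r) \<subseteq> ?W"
      by (intro cprod_mono \<open>C0 \<subseteq> U\<close> cspace_cball_subset_ball r)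
    ultimately show "\<exists>C. compact C \<and> C \<subseteq> ?W \<and> holomorphic_hull (cdomain (Suc N) ?W) K \<subseteq> C" by blast
  qed
qed

text \<open>Entire functions of the first coordinate exclude points off \<open>D\<close>, thanks to
  the connected complement, and linear forms confine the other coordinates.\<close>

lemma holomorphic_hull_cprod:
  assumes U: "open U" and D: "compact D" "connected (- D)" "D \<subseteq> U" and r: "0 \<le> r" "r < \<rho>"
  shows "holomorphic_hull (cdomain (Suc N) (cprod U (cspace_ball N \<rho>))) (cprod D (cspace_cball N r))
     = cprod D (cspace_cball N r)" (is "holomorphic_hull ?S ?K = ?K")
proof
  let ?W = "cprod U (cspace_ball N \<rho>)"
  have W: "openin (top_of_set (cspace (Suc N))) ?W"
    by (intro openin_cprod U openin_cspace_ball)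
  have Wc: "?W \<subseteq> cspace (Suc N)" using openin_subset[OF W] by simp
  have "?K \<subseteq> points ?S"
    using cprod_mono[OF D(3) cspace_cball_subset_ball[OF r(2)]] by (simp add: cdomain_simps[OF W])
  then show "?K \<subseteq> holomorphic_hull ?S ?K" by (auto simp: holomorphic_hull_def)
  show "holomorphic_hull ?S ?K \<subseteq> ?K"
  proof
    fix z assume z: "z \<in> holomorphic_hull ?S ?K"
    have 2: "(\<lambda>i. z (Suc i)) \<in> cspace_cball N r"
      using r by (intro hull_cprod_second_factor[OF U z]) (auto simp: cprod_def cspace_cball_def)
    have "z 0 \<in> D"
    proof (rule ccontr)
      assume "z 0 \<notin> D"
      then obtain q where q: "q holomorphic_on UNIV" "q (z 0) = 1" "\<forall>w\<in>D. cmod (q w) \<le> 1/9"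
        using entire_separation[OF D(1,2)] by blast
      have "cmod (q (z 0)) \<le> 1/9"
      proof (rule holomorphic_hullD[OF W z, where f = "\<lambda>u. q (u 0)"])
        fix w assume "w \<in> ?W"
        then show "complex_differentiable_at (Suc N) (\<lambda>u. q (u 0)) w"
          using Wc holomorphic_derivI[OF q(1) open_UNIV] holomorphic_function_differentiable_at_coordinate by blast
      qed (use q in \<open>auto simp: cprod_def\<close>)
      then show False using q(2) by simp
    qed
    then show "z \<in> ?K" using 2 by (simp add: cprod_def)
  qed
qed

section \<open>Oka maps are submersions\<close>

lemma unit_cube_eq: "unit_cube k = top_of_set {x. (\<forall>i\<ge>k. x i = 0) \<and> (\<forall>i<k. 0 \<le> x i \<and> x i \<le> 1)}"
  unfolding unit_cube_def Euclidean_space_def euclidean_product_topology subtopology_subtopology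
  by (intro arg_cong[where f = "subtopology euclidean"]) auto

text \<open>Real and imaginary parts are bounded separately so that, for \<open>M > 0\<close>, the
  set is up to affine scaling a real cube of dimension \<open>2 * n\<close>, the shape for which the
  Serre property is stated.\<close>

definition complex_box :: "nat \<Rightarrow> real \<Rightarrow> (nat \<Rightarrow> complex) set" where
  "complex_box n M = {z \<in> cspace n. \<forall>i<n. \<bar>Re (z i)\<bar> \<le> M \<and> \<bar>Im (z i)\<bar> \<le> M}"

lemma serre_lift_complex_box:
  assumes h: "serre_fibration E B h" and M: "M > 0"
    and H: "continuous_map (prod_topology (top_of_set (complex_box n M)) (top_of_set {0..1::real})) B H"
    and f: "continuous_map (top_of_set (complex_box n M)) E f"
    and hf: "\<And>z. z \<in> complex_box n M \<Longrightarrow> h (f z) = H (z, 0)"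
  shows "\<exists>L. continuous_map (prod_topology (top_of_set (complex_box n M)) (top_of_set {0..1})) E L \<and>
     (\<forall>z\<in>complex_box n M. L (z, 0) = f z) \<and> (\<forall>z\<in>complex_box n M. \<forall>t\<in>{0..1}. h (L (z, t)) = H (z, t))"
proof -
  \<comment> \<open>Real coordinate \<open>2 * i\<close> carries the real part of \<open>z i\<close>
    and \<open>2 * i + 1\<close> the imaginary part; the unit interval is rescaled to the interval
    from \<open>- M\<close> to \<open>M\<close>.\<close>
  define \<kappa> where "\<kappa> = (\<lambda>(q::nat\<Rightarrow>real) i. if i < n then Complex (M * (2 * q (2*i) - 1)) (M * (2 * q (2*i+1) - 1)) else 0)"
  define \<iota> where "\<iota> = (\<lambda>(z::nat\<Rightarrow>complex) j. if j < 2*n then ((if even j then Re (z (j div 2)) else Im (z (j div 2))) / M + 1) / 2 else 0)"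
  let ?Q = "{x::nat\<Rightarrow>real. (\<forall>i\<ge>2*n. x i = 0) \<and> (\<forall>i<2*n. 0 \<le> x i \<and> x i \<le> 1)}"
  let ?C = "complex_box n M"
  have cont\<kappa>: "continuous_on S \<kappa>" for S
  proof (rule continuous_on_coordinatewise_then_product)
    fix i show "continuous_on S (\<lambda>x. \<kappa> x i)"
      unfolding \<kappa>_def Complex_eq by (cases "i < n") (auto intro!: continuous_intros continuous_on_coordinate)
  qed
  have cont\<iota>: "continuous_on S \<iota>" for S
  proof (rule continuous_on_coordinatewise_then_product)
    fix i show "continuous_on S (\<lambda>x. \<iota> x i)"
      unfolding \<iota>_def using M by (cases "i < 2*n"; cases "even i") (auto intro!: continuous_intros continuous_on_coordinate)
  qed
  have m1: "\<bar>M * (2 * q - 1)\<bar> \<le> M" if "0 \<le> q" "q \<le> 1" for q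
  proof -
    have "\<bar>2 * q - 1\<bar> \<le> 1" using that by linarith
    then show ?thesis using M mult_left_mono[of "\<bar>2 * q - 1\<bar>" 1 M] by (simp add: abs_mult)
  qed
  have \<kappa>C: "\<kappa> q \<in> ?C" if "q \<in> ?Q" for q
    using that m1 by (auto simp: \<kappa>_def complex_box_def cspace_def)
  have \<iota>Q: "\<iota> z \<in> ?Q" if z: "z \<in> ?C" for z
  proof -
    have "0 \<le> (r / M + 1) / 2 \<and> (r / M + 1) / 2 \<le> 1" if "\<bar>r\<bar> \<le> M" for r
      using that M by (auto simp: field_simps abs_le_iff)
    moreover have "\<bar>Re (z (j div 2))\<bar> \<le> M \<and> \<bar>Im (z (j div 2))\<bar> \<le> M" if "j < 2*n" for j
      using z that by (simp add: complex_box_def less_mult_imp_div_less mult.commute)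
    ultimately show ?thesis by (auto simp: \<iota>_def)
  qed
  have \<kappa>\<iota>: "\<kappa> (\<iota> z) = z" if z: "z \<in> ?C" for z
  proof
    have *: "M * ((2 * r / M + 2) / 2 - 1) = r" for r using M by (simp add: field_simps)
    fix i show "\<kappa> (\<iota> z) i = z i"
      using z M by (cases "i < n") (auto simp: \<kappa>_def \<iota>_def complex_box_def cspace_def complex_eq_iff *)
  qed
  have c\<kappa>: "continuous_map (unit_cube (2*n)) (top_of_set ?C) \<kappa>"
    unfolding unit_cube_eq using cont\<kappa> \<kappa>C by (auto simp: continuous_map_subtopology_eu)
  have c\<iota>: "continuous_map (top_of_set ?C) (unit_cube (2*n)) \<iota>"
    unfolding unit_cube_eq using cont\<iota> \<iota>Q by (auto simp: continuous_map_subtopology_eu)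
  have tQ: "topspace (unit_cube (2*n)) = ?Q" by (simp add: unit_cube_eq)
  let ?I = "top_of_set {0..1::real}"
  have "continuous_map (prod_topology (unit_cube (2*n)) ?I) (prod_topology (top_of_set ?C) ?I) (\<lambda>(q, t). (\<kappa> q, t))"
    using c\<kappa> by (intro iffD2[OF continuous_map_prod_top]) simp
  from continuous_map_compose[OF this H]
  have "continuous_map (prod_topology (unit_cube (2*n)) ?I) B (H \<circ> (\<lambda>(q, t). (\<kappa> q, t)))" .
  moreover have "continuous_map (unit_cube (2*n)) E (f \<circ> \<kappa>)" by (rule continuous_map_compose[OF c\<kappa> f])
  moreover have "\<forall>q\<in>topspace (unit_cube (2*n)). h ((f \<circ> \<kappa>) q) = (H \<circ> (\<lambda>(q, t). (\<kappa> q, t))) (q, 0)"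
    using hf \<kappa>C unfolding tQ by simp
  ultimately obtain L where L: "continuous_map (prod_topology (unit_cube (2*n)) ?I) E L"
      "\<forall>q\<in>topspace (unit_cube (2*n)). L (q, 0) = (f \<circ> \<kappa>) q"
      "\<forall>q\<in>topspace (unit_cube (2*n)). \<forall>t\<in>{0..1}. h (L (q, t)) = (H \<circ> (\<lambda>(q, t). (\<kappa> q, t))) (q, t)"
    using h unfolding serre_fibration_def by blast
  have "continuous_map (prod_topology (top_of_set ?C) ?I) (prod_topology (unit_cube (2*n)) ?I) (\<lambda>(z, t). (\<iota> z, t))"
    using c\<iota> by (intro iffD2[OF continuous_map_prod_top]) simp
  from continuous_map_compose[OF this L(1)]
  have "continuous_map (prod_topology (top_of_set ?C) ?I) E (L \<circ> (\<lambda>(z, t). (\<iota> z, t)))" .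
  then show ?thesis
    using L(2,3) \<iota>Q \<kappa>\<iota> unfolding tQ by (intro exI[of _ "L \<circ> (\<lambda>(z, t). (\<iota> z, t))"]) auto
qed

text \<open>For \<open>\<tau> >= 0\<close>, the projection of the plane onto the square of half-side
  \<open>\<tau>\<close>. It is continuous in both arguments together, so letting
  \<open>\<tau>\<close> grow from zero contracts a box to its centre through maps defined on the
  whole box.\<close>

definition clip :: "real \<Rightarrow> complex \<Rightarrow> complex" where
  "clip \<tau> c = Complex (max (-\<tau>) (min \<tau> (Re c))) (max (-\<tau>) (min \<tau> (Im c)))"

lemma clip_eq: "cmod c \<le> \<tau> \<Longrightarrow> clip \<tau> c = c"
  using abs_Re_le_cmod[of c] abs_Im_le_cmod[of c] by (simp add: clip_def complex_eq_iff)

lemma cmod_clip: "0 \<le> \<tau> \<Longrightarrow> cmod (clip \<tau> c) \<le> 2 * \<tau>"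
proof -
  assume "0 \<le> \<tau>"
  then have "\<bar>max (- \<tau>) (min \<tau> r)\<bar> \<le> \<tau>" for r by (simp add: abs_le_iff)
  from add_mono[OF this this] show ?thesis
    using cmod_le[of "clip \<tau> c"] unfolding clip_def complex.sel by (rule order_trans[rotated, THEN order_trans[OF _ eq_refl]]) simp
qed

lemma continuous_on_clip [continuous_intros]:
  "continuous_on S f \<Longrightarrow> continuous_on S g \<Longrightarrow> continuous_on S (\<lambda>x. clip (f x) (g x))"
  unfolding clip_def Complex_eq by (intro continuous_intros)

lemma clip_0 [simp]: "clip 0 c = 0"
  by (simp add: clip_def complex_eq_iff max_def min_def)

section \<open>Holomorphic sections of Oka maps\<close>

lemma holomorphic_map_on_into_cspace:
  assumes W: "openin (top_of_set (cspace k)) W" and f: "\<And>u. u \<in> W \<Longrightarrow> f u \<in> cspace m"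
    and d: "\<And>u i. u \<in> W \<Longrightarrow> i < m \<Longrightarrow> complex_differentiable_at k (\<lambda>w. f w i) u"
  shows "holomorphic_map_on (cspace_manifold k) W (cspace_manifold m) f"
  unfolding holomorphic_map_on_iff[OF complex_manifold_cspace]
proof (intro conjI ballI)
  have Wc: "W \<subseteq> cspace k" using openin_subset[OF W] by simp
  show "openin (mtop (cspace_manifold k)) W" using W by simp
  have "continuous_on W f"
  proof (rule continuous_on_coordinatewise_then_product)
    fix i show "continuous_on W (\<lambda>x. f x i)"
    proof (cases "i < m")
      case True
      then show ?thesis using complex_differentiable_imp_continuous_on[OF Wc] d by blast
    next
      case False
      then have "f x i = 0" if "x \<in> W" for x using f[OF that] by (simp add: cspace_def)
      then show ?thesis using continuous_on_cong[of W W "\<lambda>x. f x i" "\<lambda>_. 0"] by simp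
    qed
  qed
  then show "continuous_map (subtopology (mtop (cspace_manifold k)) W) (mtop (cspace_manifold m)) f"
    using Wc f by (auto simp: subtopology_subtopology Int_absorb1 continuous_map_subtopology_eu)
  fix u assume "u \<in> W"
  then show "holomorphic_at (cspace_manifold k) (cspace_manifold m) f u"
    using d Wc by (subst holomorphic_at_cspace) auto
qed

lemma chart_inverse_holomorphic:
  assumes M: "complex_manifold M" and c: "(n, U, \<phi>) \<in> charts M"
  shows "holomorphic_map_on (cspace_manifold n) (\<phi> ` U) M (inv_into U \<phi>)"
  unfolding holomorphic_map_on_iff[OF M]
proof (intro conjI ballI)
  note ch = manifold_chart[OF M c]
  show "openin (mtop (cspace_manifold n)) (\<phi> ` U)" using ch(2) by simp
  show "continuous_map (subtopology (mtop (cspace_manifold n)) (\<phi> ` U)) (mtop M) (inv_into U \<phi>)"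
    using chart_inv_continuous[OF M c] ch(5) by (simp add: subtopology_subtopology Int_absorb1)
  fix z assume "z \<in> \<phi> ` U"
  then obtain a where a: "a \<in> U" "z = \<phi> a" by blast
  then have zc: "z \<in> cspace n" using ch(5) by blast
  show "holomorphic_at (cspace_manifold n) M (inv_into U \<phi>) z"
    unfolding holomorphic_at_cspace[OF zc]
    using chart_transition[OF M c] a chart_inv[OF M c a(1)] by auto
qed

text \<open>The parametric property is specialized to a one-point parameter space and an empty
  \<open>P0\<close>, and the end of the homotopy is retained.\<close>

lemma oka_lifting:
  fixes X :: "'x charted_space" and Y :: "'y charted_space" and S :: "(nat \<Rightarrow> complex) charted_space"
  assumes X: "complex_manifold X" and pop: "parametric_oka_property X Y h"
    and S: "stein_manifold S" and K: "compactin (mtop S) K" "holomorphic_hull S K = K"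
    and S': "complex_subvariety S S'" and g: "holomorphic_map S Y g"
    and f0: "continuous_map (mtop S) (mtop X) f0" "\<And>s. s \<in> points S \<Longrightarrow> h (f0 s) = g s"
    and f0K: "\<exists>W. K \<subseteq> W \<and> holomorphic_map_on S W X f0" and f0S': "holomorphic_on_subvariety S S' X f0"
    and d: "metric_of (mtop X) d" and e: "0 < e"
  shows "\<exists>f. holomorphic_map S X f \<and> (\<forall>s\<in>points S. h (f s) = g s) \<and>
      (\<forall>s\<in>points S. s \<in> S' \<longrightarrow> f s = f0 s) \<and> (\<forall>s\<in>K. d (f s) (f0 s) < e)"
proof -
  define o' where "o' = (\<lambda>_::nat. 0::real)"
  define P where "P = {o'}"
  have "\<exists>f :: real \<Rightarrow> (nat \<Rightarrow> real) \<Rightarrow> (nat \<Rightarrow> complex) \<Rightarrow> 'x.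
           continuous_map
             (prod_topology (top_of_set {0..1})
                (prod_topology (subtopology (Euclidean_space 0) P) (mtop S)))
             (mtop X) (\<lambda>(t, p, s). f t p s) \<and>
           (\<forall>t \<in> {0..1}. lifting (subtopology (Euclidean_space 0) P) (mtop S) (mtop X) h (\<lambda>_. g) (f t)) \<and>
           (\<forall>p \<in> P. \<forall>s \<in> points S. f 0 p s = f0 s) \<and>
           (\<forall>t \<in> {0..1}. \<forall>p \<in> P. \<forall>s \<in> points S. p \<in> {} \<or> s \<in> S' \<longrightarrow> f t p s = f0 s) \<and>
           (\<forall>t \<in> {0..1}. \<forall>p \<in> P. holomorphic_near S K X (f t p)) \<and>
           (\<forall>t \<in> {0..1}. \<forall>p \<in> P. \<forall>s \<in> K. d (f t p s) (f0 s) < e) \<and>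
           (\<forall>p \<in> P. holomorphic_map S X (f 1 p))"
  proof (rule pop[unfolded parametric_oka_property_def, rule_format, where f\<^sub>0 = "\<lambda>_. f0"], intro conjI)
    show "stein_manifold S" "compactin (mtop S) K" "holomorphic_hull S K = K" "complex_subvariety S S'"
      "metric_of (mtop X) d" "0 < e" by fact+
    show "{} \<subseteq> P" "compactin (Euclidean_space 0) {}" "\<forall>p\<in>{}. holomorphic_map S X f0" by simp_all
    show "compactin (Euclidean_space 0) P"
      by (rule finite_imp_compactin) (auto simp: P_def o'_def topspace_Euclidean_space)
    have gc: "continuous_map (mtop S) (mtop Y) g"
      using g unfolding holomorphic_map_on_def by simp
    show "continuous_map (prod_topology (subtopology (Euclidean_space 0) P) (mtop S)) (mtop Y) (\<lambda>(p, s). g s)"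
      using continuous_map_compose[OF continuous_map_snd gc] by (simp add: o_def case_prod_unfold)
    show "\<forall>p\<in>P. holomorphic_map S Y g" using g by blast
    from continuous_map_compose[OF continuous_map_snd f0(1)]
    show "lifting (subtopology (Euclidean_space 0) P) (mtop S) (mtop X) h (\<lambda>_. g) (\<lambda>_. f0)"
      unfolding lifting_def using f0(2) by (simp add: o_def case_prod_unfold)
    show "\<exists>W. K \<subseteq> W \<and> (\<forall>p\<in>P. holomorphic_map_on S W X f0)" using f0K by blast
    show "\<forall>p\<in>P. holomorphic_on_subvariety S S' X f0" using f0S' by blast
  qed
  then obtain f :: "real \<Rightarrow> (nat \<Rightarrow> real) \<Rightarrow> (nat \<Rightarrow> complex) \<Rightarrow> 'x" where
    f: "\<forall>t \<in> {0..1}. lifting (subtopology (Euclidean_space 0) P) (mtop S) (mtop X) h (\<lambda>_. g) (f t)"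
       "\<forall>t \<in> {0..1}. \<forall>p \<in> P. \<forall>s \<in> points S. p \<in> {} \<or> s \<in> S' \<longrightarrow> f t p s = f0 s"
       "\<forall>t \<in> {0..1}. \<forall>p \<in> P. \<forall>s \<in> K. d (f t p s) (f0 s) < e"
       "\<forall>p \<in> P. holomorphic_map S X (f 1 p)" by (elim exE conjE)
  have "\<forall>s\<in>points S. h (f 1 o' s) = g s"
    using f(1) unfolding lifting_def by (simp add: P_def o'_def topspace_Euclidean_space)
  then show ?thesis using f(2-4) by (intro exI[of _ "f 1 o'"]) (simp add: P_def)
qed

text \<open>By the chain rule, the Jacobian of a holomorphic local section through \<open>x\<close>
  is a right inverse of the Jacobian of \<open>h\<close> at \<open>x\<close>.\<close>

lemma oka_surjective_differential:
  fixes X :: "'x charted_space" and Y :: "'y charted_space"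
  assumes X: "complex_manifold X" and Y: "complex_manifold Y" and oka: "oka_map X Y h" and x: "x \<in> points X"
  shows "surjective_differential_at X Y h x"
  unfolding surjective_differential_at_def
proof (clarify)
  fix n U \<phi> m V \<psi>
  assume c: "(n, U, \<phi>) \<in> charts X" "x \<in> U" and d: "(m, V, \<psi>) \<in> charts Y" "h x \<in> V"
  note cX = manifold_chart[OF X c(1)] and cY = manifold_chart[OF Y d(1)]
  have h: "holomorphic_map X Y h" and serre: "serre_fibration (mtop X) (mtop Y) h"
    and pop: "parametric_oka_property X Y h" using oka unfolding oka_map_def by blast+
  define c0 where "c0 = \<psi> (h x)"
  have c0: "c0 \<in> cspace m" using cY(5) d(2) by (auto simp: c0_def)
  obtain \<delta>0 where \<delta>0: "\<delta>0 > 0" "\<forall>w\<in>cspace m. cdist m w c0 < \<delta>0 \<longrightarrow> w \<in> \<psi> ` V \<and> inv_into V \<psi> w \<in> V"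
    using chart_nbhd[OF Y d(1) cY(1) d(2) d(2)] unfolding c0_def by blast
  \<comment> \<open>Clipping to \<open>\<delta>\<close> leaves coordinates of modulus at most
    \<open>2 * \<delta>\<close>, hence vectors of norm at most \<open>2 * m * \<delta>\<close>;
    these must stay in the image of the chart.\<close>
  define \<delta> where "\<delta> = \<delta>0 / (2 * m + 1)"
  have \<delta>: "\<delta> > 0" "\<delta> \<le> \<delta>0" "2 * m * \<delta> < \<delta>0"
  proof -
    show "\<delta> > 0" using \<delta>0 by (simp add: \<delta>_def add_nonneg_pos)
    show "\<delta> \<le> \<delta>0" using \<delta>0 by (simp add: \<delta>_def divide_le_eq add_nonneg_pos)
    have "2 * real m + 1 \<noteq> 0" by linarith
    moreover have "\<delta> = \<delta>0 / (2 * real m + 1)" unfolding \<delta>_def by simp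
    ultimately have "(2 * real m + 1) * \<delta> = \<delta>0" by (simp only: times_divide_eq_right nonzero_mult_div_cancel_left simp_thms)
    then have "2 * m * \<delta> + \<delta> = \<delta>0" by (simp add: algebra_simps)
    then show "2 * m * \<delta> < \<delta>0" using \<open>\<delta> > 0\<close> by linarith
  qed
  define W where "W = cspace_ball m \<delta>"
  have W: "openin (top_of_set (cspace m)) W" unfolding W_def by (rule openin_cspace_ball)
  have Wc: "W \<subseteq> cspace m" unfolding W_def by (rule cspace_ball_subset)
  define S where "S = cdomain m W"
  note S = cdomain_simps[OF W, folded S_def]
  define g where "g = (\<lambda>s. inv_into V \<psi> (\<lambda>i. c0 i + s i))"
  have tr: "(\<lambda>i. c0 i + s i) \<in> \<psi> ` V" if "s \<in> cspace m" "cnorm m s < \<delta>0" for s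
  proof -
    have "(\<lambda>i. c0 i + s i) \<in> cspace m" using c0 that by (simp add: cspace_def)
    then show ?thesis using \<delta>0(2) that by simp
  qed
  have trW: "(\<lambda>i. c0 i + s i) \<in> \<psi> ` V" if "s \<in> W" for s
    using that \<delta> by (intro tr) (auto simp: W_def cspace_ball_def)
  have ghol: "holomorphic_map_on (cspace_manifold m) W Y g"
    unfolding g_def
  proof (rule holomorphic_map_on_compose[OF complex_manifold_cspace complex_manifold_cspace Y _ chart_inverse_holomorphic[OF Y d(1)]])
    show "holomorphic_map_on (cspace_manifold m) W (cspace_manifold m) (\<lambda>s i. c0 i + s i)"
      using Wc c0 by (intro holomorphic_map_on_into_cspace[OF W])
        (auto simp: cspace_def[of m] intro!: complex_differentiable_add complex_differentiable_const complex_differentiable_coordinate)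
  qed (use trW in blast)
  \<comment> \<open>At time \<open>t\<close> all coordinates are clipped to
    \<open>t * \<delta>\<close>, so the homotopy \<open>H\<close> starts at the constant
    \<open>h x\<close>, which the constant \<open>x\<close> lifts.\<close>
  define cl where "cl = (\<lambda>\<tau> (z::nat\<Rightarrow>complex) i. if i < m then clip \<tau> (z i) else 0)"
  define H where "H = (\<lambda>(z, t). inv_into V \<psi> (\<lambda>i. c0 i + cl (t * \<delta>) z i))"
  let ?C = "complex_box m \<delta>" and ?I = "top_of_set {0..1::real}"
  have clV: "(\<lambda>i. c0 i + cl (t * \<delta>) z i) \<in> \<psi> ` V" if t: "t \<in> {0..1}" for t z
  proof (rule tr)
    show "cl (t * \<delta>) z \<in> cspace m" by (simp add: cl_def cspace_def)
    have "cnorm m (cl (t * \<delta>) z) \<le> (\<Sum>i<m. 2 * \<delta>)"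
    proof (rule order_trans[OF cnorm_le_sum sum_mono])
      fix i assume "i \<in> {..<m}"
      then have "cmod (cl (t * \<delta>) z i) \<le> 2 * (t * \<delta>)" using t \<delta> by (simp add: cl_def cmod_clip)
      also have "\<dots> \<le> 2 * \<delta>" using t \<delta> mult_right_mono[of t 1 \<delta>] by simp
      finally show "cmod (cl (t * \<delta>) z i) \<le> 2 * \<delta>" .
    qed
    then show "cnorm m (cl (t * \<delta>) z) < \<delta>0" using \<delta> by (simp add: algebra_simps)
  qed
  have H: "continuous_map (prod_topology (top_of_set ?C) ?I) (mtop Y) H"
  proof -
    have "continuous_on (?C \<times> {0..1}) (\<lambda>p i. c0 i + cl (snd p * \<delta>) (fst p) i)"
    proof (rule continuous_on_coordinatewise_then_product)
      fix i
      have "continuous_on (?C \<times> {0..1}) (\<lambda>p. fst p i)"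
        by (rule continuous_on_product_then_coordinatewise) (intro continuous_intros)
      then show "continuous_on (?C \<times> {0..1}) (\<lambda>p. c0 i + cl (snd p * \<delta>) (fst p) i)"
        unfolding cl_def by (cases "i < m") (auto intro!: continuous_intros)
    qed
    then have "continuous_map (prod_topology (top_of_set ?C) ?I) (top_of_set (\<psi> ` V)) (\<lambda>p i. c0 i + cl (snd p * \<delta>) (fst p) i)"
      using clV by (auto simp: continuous_map_subtopology_eu)
    from continuous_map_compose[OF this chart_inv_continuous[OF Y d(1)]]
    show ?thesis by (simp add: H_def o_def case_prod_unfold)
  qed
  have H0: "h x = H (z, 0)" for z
  proof -
    have "cl 0 z = (\<lambda>_. 0)" by (simp add: cl_def fun_eq_iff)
    then show ?thesis using chart_inv[OF Y d] by (simp add: H_def c0_def)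
  qed
  have "\<exists>L. continuous_map (prod_topology (top_of_set ?C) ?I) (mtop X) L \<and>
     (\<forall>z\<in>?C. L (z, 0) = x) \<and> (\<forall>z\<in>?C. \<forall>t\<in>{0..1}. h (L (z, t)) = H (z, t))"
    using x H0 by (intro serre_lift_complex_box[OF serre \<delta>(1) H]) auto
  then obtain L where L: "continuous_map (prod_topology (top_of_set ?C) ?I) (mtop X) L"
     "\<forall>z\<in>?C. L (z, 0) = x" "\<forall>z\<in>?C. \<forall>t\<in>{0..1}. h (L (z, t)) = H (z, t)" by blast
  \<comment> \<open>The lifted homotopy is known to pass through \<open>x\<close> only at time zero,
    so the time is tied to the norm: the origin is evaluated at time zero, and at \<open>s\<close>
    the clipping level \<open>cnorm m s\<close> is too large to alter \<open>s\<close>.\<close>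
  define f0 where "f0 = (\<lambda>s. L (s, cnorm m s / \<delta>))"
  have WC: "s \<in> ?C" "cnorm m s / \<delta> \<in> {0..1}" if s: "s \<in> W" for s
  proof -
    have n: "cnorm m s \<le> \<delta>" "s \<in> cspace m" using s by (auto simp: W_def cspace_ball_def)
    have "\<bar>Re (s i)\<bar> \<le> \<delta> \<and> \<bar>Im (s i)\<bar> \<le> \<delta>" if "i < m" for i
      using component_le_cnorm[OF that, of s] abs_Re_le_cmod[of "s i"] abs_Im_le_cmod[of "s i"] n by linarith
    then show "s \<in> ?C" using n by (simp add: complex_box_def)
    show "cnorm m s / \<delta> \<in> {0..1}" using n \<delta> by (simp add: divide_le_eq)
  qed
  have hf0: "h (f0 s) = g s" if s: "s \<in> W" for s
  proof -
    have "cl (cnorm m s / \<delta> * \<delta>) s = s"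
    proof
      fix i show "cl (cnorm m s / \<delta> * \<delta>) s i = s i"
        using component_le_cnorm[of i m s] \<delta>(1) s Wc by (cases "i < m") (auto simp: cl_def clip_eq cspace_def)
    qed
    then show ?thesis unfolding f0_def using L(3) WC[OF s] by (simp add: H_def g_def)
  qed
  have f0c: "continuous_map (top_of_set W) (mtop X) f0"
  proof -
    have "continuous_on W (\<lambda>s. (s, cnorm m s / \<delta>))"
      using \<delta> by (intro continuous_intros continuous_on_cnorm continuous_on_coordinate) auto
    then have "continuous_map (top_of_set W) (prod_topology (top_of_set ?C) ?I) (\<lambda>s. (s, cnorm m s / \<delta>))"
      using WC by (auto simp: continuous_map_subtopology_eu)
    from continuous_map_compose[OF this L(1)] show ?thesis by (simp add: o_def f0_def)
  qed
  have zW: "(\<lambda>_. 0) \<in> W" using \<delta> by (simp add: W_def cspace_ball_def cspace_def)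
  have f00: "f0 (\<lambda>_. 0) = x" using L(2) WC[OF zW] by (simp add: f0_def)
  obtain dX where dX: "metric_of (mtop X) dX" using complex_manifold_metrizable[OF X] by blast
  \<comment> \<open>Interpolation at the origin keeps the section through \<open>x\<close>; the set
    on which approximation is asked is empty.\<close>
  have "\<exists>f. holomorphic_map S X f \<and> (\<forall>s\<in>points S. h (f s) = g s) \<and>
      (\<forall>s\<in>points S. s \<in> {\<lambda>_. 0} \<longrightarrow> f s = f0 s) \<and> (\<forall>s\<in>{}. dX (f s) (f0 s) < 1)"
  proof (rule oka_lifting[OF X pop])
    show "stein_manifold S" unfolding S_def W_def by (rule stein_ball[OF \<delta>(1)])
    show "compactin (mtop S) {}" by simp
    \<comment> \<open>Over the empty set every bound holds, even a negative one for the zero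
      function, so no point belongs to the hull.\<close>
    have "holomorphic_function_on S (points S) (\<lambda>_. 0)"
      using Wc holomorphic_function_on_cdomain[OF W, of "\<lambda>_. 0"] unfolding S S_def[symmetric]
      by (auto intro: complex_differentiable_const)
    then have "\<exists>f B. holomorphic_function_on S (points S) f \<and> (\<forall>y\<in>{}. cmod (f y) \<le> B) \<and> \<not> cmod (f x) \<le> B" for x
      by (intro exI[of _ "\<lambda>_. 0"] exI[of _ "-1"]) simp
    then show "holomorphic_hull S {} = {}" unfolding holomorphic_hull_def by blast
    show "complex_subvariety S {\<lambda>_. 0}" unfolding complex_subvariety_def
    proof (intro conjI ballI)
      show "closedin (mtop S) {\<lambda>_. 0}" unfolding S using zW by (simp add: closedin_closed_subset)
      fix y :: "nat \<Rightarrow> complex" assume "y \<in> {\<lambda>_. 0}"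
      show "\<exists>U \<F>. openin (mtop S) U \<and> y \<in> U \<and> finite \<F> \<and> (\<forall>f\<in>\<F>. holomorphic_function_on S U f) \<and>
            {\<lambda>_. 0} \<inter> U = {y \<in> U. \<forall>f\<in>\<F>. f y = 0}"
      proof (intro exI[of _ W] exI[of _ "(\<lambda>i z. z i) ` {..<m}"] conjI ballI)
        show "openin (mtop S) W" by (simp add: S)
        show "y \<in> W" using zW \<open>y \<in> {\<lambda>_. 0}\<close> by simp
        show "holomorphic_function_on S W f" if "f \<in> (\<lambda>i z. z i) ` {..<m}" for f
          using that Wc unfolding S_def holomorphic_function_on_cdomain[OF W]
          by (auto intro!: complex_differentiable_coordinate)
        have "z = (\<lambda>_. 0)" if "z \<in> W" "\<And>i. i < m \<Longrightarrow> z i = 0" for z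
        proof
          fix i
          have "z \<in> cspace m" using that(1) Wc by blast
          then show "z i = 0" using that(2)[of i] by (cases "i < m") (auto simp: cspace_def)
        qed
        note only0 = this
        show "{\<lambda>_. 0} \<inter> W = {y \<in> W. \<forall>f\<in>(\<lambda>i z. z i) ` {..<m}. f y = 0}"
        proof (intro set_eqI iffI)
          fix w assume "w \<in> {\<lambda>_. 0} \<inter> W"
          then show "w \<in> {y \<in> W. \<forall>f\<in>(\<lambda>i z. z i) ` {..<m}. f y = 0}" using zW by simp
        next
          fix w assume "w \<in> {y \<in> W. \<forall>f\<in>(\<lambda>i z. z i) ` {..<m}. f y = 0}"
          then have "w \<in> W" "\<And>i. i < m \<Longrightarrow> w i = 0" by auto
          from only0[OF this] show "w \<in> {\<lambda>_. 0} \<inter> W" using zW by simp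
        qed
      qed simp
    qed
    show "holomorphic_map S Y g"
      using ghol holomorphic_map_on_cdomain[OF W Y order_refl] unfolding S_def cdomain_simps[OF W] by simp
    show "continuous_map (mtop S) (mtop X) f0" using f0c by (simp add: S)
    show "h (f0 s) = g s" if "s \<in> points S" for s using hf0 that by (simp add: S)
    have "holomorphic_map_on S {} X f0" unfolding holomorphic_map_on_iff[OF X] by simp
    then show "\<exists>W. {} \<subseteq> W \<and> holomorphic_map_on S W X f0" by blast
    have "holomorphic_map_on S W X (\<lambda>_. x)"
      unfolding S_def by (rule holomorphic_map_on_const[OF X _ x complex_manifold_cdomain[OF W]]) (simp add: cdomain_simps[OF W])
    then show "holomorphic_on_subvariety S {\<lambda>_. 0} X f0"
      unfolding holomorphic_on_subvariety_def using zW f00 by (auto intro!: exI[of _ W] exI[of _ "\<lambda>_. x"])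
    show "metric_of (mtop X) dX" by fact
    show "(0::real) < 1" by simp
  qed
  then obtain \<sigma> where "holomorphic_map S X \<sigma>" and h\<sigma>': "\<forall>s\<in>points S. h (\<sigma> s) = g s"
    and \<sigma>0': "\<forall>s\<in>points S. s \<in> {\<lambda>_. 0} \<longrightarrow> \<sigma> s = f0 s" by blast
  then have \<sigma>: "holomorphic_map_on (cspace_manifold m) W X \<sigma>"
    using holomorphic_map_on_cdomain[OF W X order_refl] unfolding S_def cdomain_simps[OF W] by simp
  have \<sigma>0: "\<sigma> (\<lambda>_. 0) = x" using \<sigma>0' zW f00 by (simp add: S)
  have h\<sigma>: "h (\<sigma> s) = g s" if "s \<in> W" for s using h\<sigma>' that by (simp add: S)
  note \<sigma>' = \<sigma>[unfolded holomorphic_map_on_iff[OF X]]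
  have z: "(\<lambda>_. 0) \<in> cspace m" by (simp add: cspace_def)
  have "openin (top_of_set W) {s \<in> W. \<sigma> s \<in> U}"
    using openin_continuous_map_preimage[OF conjunct1[OF conjunct2[OF \<sigma>']] cX(1)] Wc
    by (simp add: subtopology_subtopology Int_absorb1)
  then have "openin (top_of_set (cspace m)) {s \<in> W. \<sigma> s \<in> U}" using W openin_trans by blast
  moreover have "(\<lambda>_. 0) \<in> {s \<in> W. \<sigma> s \<in> U}" using zW \<sigma>0 c by simp
  ultimately obtain \<epsilon> where \<epsilon>: "\<epsilon> > 0" "\<forall>w\<in>cspace m. cdist m w (\<lambda>_. 0) < \<epsilon> \<longrightarrow> w \<in> {s \<in> W. \<sigma> s \<in> U}"
    unfolding openin_cspace_iff by (elim conjE) (drule (1) bspec, blast)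
  have "holomorphic_at X Y h x" using h x unfolding holomorphic_map_on_iff[OF Y] by blast
  then have "\<exists>a. has_complex_gradient n (\<lambda>z. \<psi> (h (inv_into U \<phi> z)) i) a (\<phi> x)" if "i < m" for i
    using c d that unfolding holomorphic_at_def complex_differentiable_at_def by fast
  then obtain A where A: "\<And>i. i < m \<Longrightarrow> has_complex_gradient n (\<lambda>z. \<psi> (h (inv_into U \<phi> z)) i) (A i) (\<phi> x)" by metis
  have "holomorphic_at (cspace_manifold m) X \<sigma> (\<lambda>_. 0)" using \<sigma>' zW by blast
  then have "\<exists>b. has_complex_gradient m (\<lambda>s. \<phi> (\<sigma> s) j) b (\<lambda>_. 0)" if "j < n" for j
    using c that \<sigma>0 unfolding holomorphic_at_cspace[OF z] complex_differentiable_at_def by fastforce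
  then obtain B where B: "\<And>j. j < n \<Longrightarrow> has_complex_gradient m (\<lambda>s. \<phi> (\<sigma> s) j) (B j) (\<lambda>_. 0)" by metis
  \<comment> \<open>Read in the charts, \<open>h \<circ> \<sigma>\<close> is the translation by
    \<open>c0\<close>, so uniqueness of gradients identifies the product of the Jacobians with the
    identity.\<close>
  have AB: "(\<Sum>j<n. A i j * B j k) = (if k = i then 1 else 0)" if i: "i < m" and k: "k < m" for i k
  proof -
    have "has_complex_gradient m (\<lambda>s. (\<lambda>z. \<psi> (h (inv_into U \<phi> z)) i) (\<phi> (\<sigma> s))) (\<lambda>k. \<Sum>j<n. A i j * B j k) (\<lambda>_. 0)"
    proof (rule has_complex_gradient_compose[where f = "\<lambda>s. \<phi> (\<sigma> s)" and g = "\<lambda>z. \<psi> (h (inv_into U \<phi> z)) i", OF z B _ \<epsilon>(1)])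
      show "has_complex_gradient n (\<lambda>z. \<psi> (h (inv_into U \<phi> z)) i) (A i) (\<phi> (\<sigma> (\<lambda>_. 0)))"
        using A[OF i] \<sigma>0 by simp
      show "\<phi> (\<sigma> w) \<in> cspace n" if "w \<in> cspace m" "cdist m w (\<lambda>_. 0) < \<epsilon>" for w
        using \<epsilon>(2)[rule_format, OF that] cX(5) by blast
    qed
    then have "has_complex_gradient m (\<lambda>s. c0 i + s i) (\<lambda>k. \<Sum>j<n. A i j * B j k) (\<lambda>_. 0)"
    proof (rule has_complex_gradient_cong[OF _ z \<epsilon>(1)])
      fix s assume "s \<in> cspace m" "cdist m s (\<lambda>_. 0) < \<epsilon>"
      then have s: "s \<in> W" "\<sigma> s \<in> U" using \<epsilon>(2) by auto
      have "\<psi> (h (\<sigma> s)) = (\<lambda>i. c0 i + s i)"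
        unfolding h\<sigma>[OF s(1)] g_def using trW[OF s(1)] by (rule f_inv_into_f)
      then show "\<psi> (h (inv_into U \<phi> (\<phi> (\<sigma> s)))) i = c0 i + s i" using chart_inv[OF X c(1) s(2)] by simp
    qed
    moreover have "has_complex_gradient m (\<lambda>s. c0 i + s i) (\<lambda>j. if j = i then 1 else 0) (\<lambda>_. 0)"
      using has_complex_gradient_add[OF z has_complex_gradient_const[OF z, of "c0 i"] has_complex_gradient_coordinate[OF z i]]
      by simp
    ultimately show ?thesis by (rule has_complex_gradient_unique[OF z _ _ k])
  qed
  have "\<exists>u\<in>cspace n. \<forall>i<m. (\<Sum>j<n. A i j * u j) = v i" for v
  proof (intro bexI[of _ "\<lambda>j. if j < n then \<Sum>k<m. B j k * v k else 0"] allI impI)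
    fix i assume i: "i < m"
    have "(\<Sum>j<n. A i j * (if j < n then \<Sum>k<m. B j k * v k else 0)) = (\<Sum>j<n. \<Sum>k<m. A i j * B j k * v k)"
      by (simp add: sum_distrib_left mult.assoc)
    also have "\<dots> = (\<Sum>k<m. (\<Sum>j<n. A i j * B j k) * v k)"
      by (subst sum.swap) (simp add: sum_distrib_right)
    also have "\<dots> = v i"
      using AB i by (simp add: if_distrib[of "\<lambda>x. x * _"] cong: if_cong)
    finally show "(\<Sum>j<n. A i j * (if j < n then \<Sum>k<m. B j k * v k else 0)) = v i" .
  qed (simp add: cspace_def)
  with A show "\<exists>A. (\<forall>i<m. has_complex_gradient n (\<lambda>z. \<psi> (h (inv_into U \<phi> z)) i) (A i) (\<phi> x)) \<and>
             (\<forall>v \<in> cspace m. \<exists>u \<in> cspace n. \<forall>i<m. (\<Sum>j<n. A i j * u j) = v i)"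
    by (intro exI[of _ A] conjI allI impI ballI) simp_all
qed

section \<open>Lifting sprays along Oka maps\<close>

text \<open>The pairs violating the bound near \<open>K\<close> form a compact set. Its projection
  to the plane is compact and misses \<open>K\<close>, hence has positive distance from it,
  uniformly in \<open>t\<close>.\<close>

lemma tube_around_compact:
  fixes K :: "complex set" and \<Phi> :: "complex \<Rightarrow> real \<Rightarrow> real"
  assumes K: "compact K" "K \<noteq> {}" and \<Phi>: "continuous_on (UNIV \<times> {0..1}) (\<lambda>(u, t). \<Phi> u t)"
    and lt: "\<And>u t. u \<in> K \<Longrightarrow> t \<in> {0..1} \<Longrightarrow> \<Phi> u t < c"
  shows "\<exists>\<beta>>0. \<forall>u. infdist u K < \<beta> \<longrightarrow> (\<forall>t\<in>{0..1}. \<Phi> u t < c)"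
proof -
  obtain B where B: "\<forall>x\<in>K. cmod x \<le> B" using compact_imp_bounded[OF K(1)] bounded_iff by blast
  \<comment> \<open>Points within distance 1 of \<open>K\<close> lie in the ball of radius
    \<open>B + 1\<close>, so confining \<open>C\<close> to this ball makes it bounded without losing
    violations near \<open>K\<close>.\<close>
  define C where "C = (cball 0 (B + 1) \<times> {0..1}) \<inter> (\<lambda>(u, t). \<Phi> u t) -` {c..}"
  have "continuous_on (cball 0 (B + 1) \<times> {0..1}) (\<lambda>(u, t). \<Phi> u t)"
    by (rule continuous_on_subset[OF \<Phi>]) auto
  then have "closed C" unfolding C_def
    by (rule continuous_closed_preimage) (auto intro: closed_Times)
  moreover have "bounded C"
    by (rule bounded_subset[OF bounded_Times[OF bounded_cball bounded_closed_interval]]) (auto simp: C_def)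
  ultimately have "compact C" by (simp add: compact_eq_bounded_closed)
  then have Z: "compact (fst ` C)" by (rule compact_continuous_image[OF continuous_on_fst[OF continuous_on_id]])
  have "K \<inter> fst ` C = {}" using lt by (force simp: C_def)
  then obtain \<beta> where \<beta>: "\<beta> > 0" "\<forall>x\<in>K. \<forall>y\<in>fst ` C. \<beta> \<le> dist x y"
    using separate_compact_closed[OF K(1) compact_imp_closed[OF Z]] by blast
  have "\<Phi> u t < c" if u: "infdist u K < min \<beta> 1" and t: "t \<in> {0..1}" for u t
  proof (rule ccontr)
    assume n: "\<not> \<Phi> u t < c"
    obtain a where a: "a \<in> K" "infdist u K = dist u a"
      using infdist_attains_inf[OF compact_imp_closed[OF K(1)] K(2)] by blast
    have "cmod u \<le> cmod a + dist u a" using norm_triangle_ineq[of a "u - a"] by (simp add: dist_norm)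
    then have "(u, t) \<in> C" using n t a u B by (force simp: C_def)
    then have "u \<in> fst ` C" by force
    then have "\<beta> \<le> dist a u" using \<beta>(2) a(1) by blast
    then show False using u a by (simp add: dist_commute)
  qed
  then show ?thesis using \<beta>(1) by (intro exI[of _ "min \<beta> 1"]) auto
qed

text \<open>A disc is homeomorphic to a convex set, hence an absolute retract, and as a closed
  subset it is then a retract of the plane.\<close>

lemma closed_disc_retraction:
  assumes "closed_disc D"
  obtains r where "continuous_on UNIV r" "\<And>u. r u \<in> D" "\<And>u. u \<in> D \<Longrightarrow> r u = u"
proof -
  have "AR (cball 0 1 :: complex set)" by (rule convex_imp_AR) auto
  then have "AR D" using assms unfolding closed_disc_def by (meson AR_homeomorphic_AR homeomorphic_sym)
  then have "D retract_of UNIV"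
    using closed_disc_compact[OF assms] compact_imp_closed by (intro AR_imp_absolute_retract_UNIV[of D D]) (auto simp: homeomorphic_refl)
  then show ?thesis unfolding retract_of_def retraction_def using that by auto
qed

lemma closed_disc_nonempty: "closed_disc D \<Longrightarrow> D \<noteq> {}"
  unfolding closed_disc_def using homeomorphic_empty(2) by fastforce

text \<open>
  With \<open>M t\<close> a homotopy in \<open>D'\<close> from a retraction onto \<open>D\<close> to a retraction onto \<open>D'\<close> that is constant
  on \<open>D\<close>, the maps \<open>M t u + clip (u - M t u)\<close> stay close to \<open>D'\<close> and fix all points near \<open>D\<close>.
\<close>

lemma disc_deformation:
  assumes D: "closed_disc D" "closed_disc D'" "D \<subseteq> D'" and \<delta>: "\<delta> > 0"
  obtains \<Gamma> \<beta> where "\<beta> > 0" "continuous_on (UNIV \<times> {0..1}) (\<lambda>(u, t). \<Gamma> u (t::real))"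
    "\<And>u t. t \<in> {0..1} \<Longrightarrow> \<exists>a\<in>D'. cmod (\<Gamma> u t - a) \<le> \<delta>"
    "\<And>u. \<exists>a\<in>D. cmod (\<Gamma> u 0 - a) \<le> \<delta>"
    "\<And>u t. t \<in> {0..1} \<Longrightarrow> infdist u D < \<beta> \<Longrightarrow> \<Gamma> u t = u"
    "\<And>u. infdist u D' < \<beta> \<Longrightarrow> \<Gamma> u 1 = u"
proof -
  obtain r where r: "continuous_on UNIV r" "\<And>u. r u \<in> D" "\<And>u. u \<in> D \<Longrightarrow> r u = u"
    using closed_disc_retraction[OF D(1)] by blast
  obtain r' where r': "continuous_on UNIV r'" "\<And>u. r' u \<in> D'" "\<And>u. u \<in> D' \<Longrightarrow> r' u = u"
    using closed_disc_retraction[OF D(2)] by blast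
  obtain \<theta> \<theta>' where \<theta>: "homeomorphism D' (cball 0 1 :: complex set) \<theta> \<theta>'"
    using D(2) unfolding closed_disc_def homeomorphic_def by blast
  \<comment> \<open>The two retractions are joined by a segment in the round disc, where convexity
    is available, and the segment is carried back by \<open>\<theta>'\<close>.\<close>
  define l where "l = (\<lambda>u (t::real). (1 - t) *\<^sub>R \<theta> (r (r' u)) + t *\<^sub>R \<theta> (r' u))"
  define M where "M = (\<lambda>u t. \<theta>' (l u t))"
  have rD': "r u \<in> D'" for u using r(2) D(3) by blast
  have l: "l u t \<in> cball 0 1" if "t \<in> {0..1}" for u t
  proof -
    have "\<theta> (r (r' u)) \<in> cball 0 1" "\<theta> (r' u) \<in> cball 0 1"
      using homeomorphism_image1[OF \<theta>] rD' r'(2) by blast+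
    then show ?thesis unfolding l_def using that by (intro convexD[OF convex_cball]) auto
  qed
  have M: "M u t \<in> D'" if "t \<in> {0..1}" for u t
    using l[OF that] homeomorphism_image2[OF \<theta>] unfolding M_def by blast
  have \<theta>\<theta>: "\<theta>' (\<theta> a) = a" if "a \<in> D'" for a using homeomorphism_apply1[OF \<theta> that] .
  have M0: "M u 0 = r (r' u)" and M1: "M u 1 = r' u" for u
    using \<theta>\<theta> rD' r'(2) by (auto simp: M_def l_def)
  have MD: "M u t = u" if "u \<in> D" for u t
    using that r(3) r'(3) D(3) \<theta>\<theta> by (simp add: M_def l_def subset_iff flip: scaleR_add_left)
  have cr': "continuous_on S (\<lambda>p. r' (fst p))" for S :: "(complex \<times> real) set"
    by (rule continuous_on_compose2[OF r'(1)]) (auto intro: continuous_intros)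
  have crr': "continuous_on S (\<lambda>p. r (r' (fst p)))" for S :: "(complex \<times> real) set"
    by (rule continuous_on_compose2[OF r(1) cr']) auto
  have cl: "continuous_on (UNIV \<times> {0..1}) (\<lambda>p. l (fst p) (snd p))"
    unfolding l_def using rD' r'(2)
    by (intro continuous_intros continuous_on_compose2[OF homeomorphism_cont1[OF \<theta>]] cr' crr') auto
  have cM: "continuous_on (UNIV \<times> {0..1}) (\<lambda>p. M (fst p) (snd p))"
    unfolding M_def using l by (intro continuous_on_compose2[OF homeomorphism_cont2[OF \<theta>] cl]) auto
  \<comment> \<open>Clipping at \<open>\<delta>/2\<close> adds a vector of modulus at most
    \<open>\<delta>\<close>, and it gives back \<open>u\<close> itself whenever \<open>u\<close> is
    within \<open>\<delta>/2\<close> of \<open>M u t\<close>.\<close>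
  define \<Gamma> where "\<Gamma> = (\<lambda>u t. M u t + clip (\<delta>/2) (u - M u t))"
  have near: "cmod (\<Gamma> u t - M u t) \<le> \<delta>" for u t
    using cmod_clip[of "\<delta>/2" "u - M u t"] \<delta> by (simp add: \<Gamma>_def)
  have fixed: "\<Gamma> u t = u" if "cmod (u - M u t) < \<delta>/2" for u t
    using clip_eq[of "u - M u t" "\<delta>/2"] that by (simp add: \<Gamma>_def)
  have c1: "continuous_on (UNIV \<times> {0..1}) (\<lambda>(u, t). cmod (u - M u t))"
    unfolding case_prod_unfold by (intro continuous_intros cM)
  have "\<exists>\<beta>>0. \<forall>u. infdist u D < \<beta> \<longrightarrow> (\<forall>t\<in>{0..1}. cmod (u - M u t) < \<delta>/2)"
    by (rule tube_around_compact[OF closed_disc_compact[OF D(1)] closed_disc_nonempty[OF D(1)] c1])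
      (use MD \<delta> in simp)
  then obtain \<beta>1 where \<beta>1: "\<beta>1 > 0" "\<forall>u. infdist u D < \<beta>1 \<longrightarrow> (\<forall>t\<in>{0..1}. cmod (u - M u t) < \<delta>/2)" by blast
  have c2: "continuous_on (UNIV \<times> {0..1}) (\<lambda>(u, t::real). cmod (u - r' u))"
    unfolding case_prod_unfold by (intro continuous_intros cr')
  have "\<exists>\<beta>>0. \<forall>u. infdist u D' < \<beta> \<longrightarrow> (\<forall>t\<in>{0..1::real}. cmod (u - r' u) < \<delta>/2)"
    by (rule tube_around_compact[OF closed_disc_compact[OF D(2)] closed_disc_nonempty[OF D(2)] c2])
      (use r'(3) \<delta> in simp)
  then obtain \<beta>2 where \<beta>2: "\<beta>2 > 0" "\<forall>u. infdist u D' < \<beta>2 \<longrightarrow> (\<forall>t\<in>{0..1::real}. cmod (u - r' u) < \<delta>/2)" by blast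
  show thesis
  proof (rule that[of "min \<beta>1 \<beta>2" \<Gamma>])
    show "min \<beta>1 \<beta>2 > 0" using \<beta>1 \<beta>2 by simp
    show "continuous_on (UNIV \<times> {0..1}) (\<lambda>(u, t). \<Gamma> u t)"
      unfolding \<Gamma>_def case_prod_unfold by (intro continuous_intros cM)
    show "\<exists>a\<in>D'. cmod (\<Gamma> u t - a) \<le> \<delta>" if "t \<in> {0..1}" for u t using near M[OF that] by blast
    show "\<exists>a\<in>D. cmod (\<Gamma> u 0 - a) \<le> \<delta>" for u using near[of u 0] M0 r(2) by force
    show "\<Gamma> u t = u" if "t \<in> {0..1}" "infdist u D < min \<beta>1 \<beta>2" for u t
      using \<beta>1(2) that by (intro fixed) auto
    show "\<Gamma> u 1 = u" if "infdist u D' < min \<beta>1 \<beta>2" for u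
      using \<beta>2(2)[rule_format, of u 0] that M1[of u] by (intro fixed) simp
  qed
qed

text \<open>For \<open>\<rho> > 0\<close>, the retraction of C^N onto the closed ball of radius
  \<open>\<rho>\<close>. The maximum in the denominator makes it a single continuous
  formula.\<close>

definition radial :: "nat \<Rightarrow> real \<Rightarrow> (nat \<Rightarrow> complex) \<Rightarrow> nat \<Rightarrow> complex" where
  "radial N \<rho> z = (\<lambda>i. of_real (\<rho> / max \<rho> (cnorm N z)) * z i)"

lemma radial_in_cball: "\<rho> > 0 \<Longrightarrow> z \<in> cspace N \<Longrightarrow> radial N \<rho> z \<in> cspace_cball N \<rho>"
proof -
  assume \<rho>: "\<rho> > 0" and z: "z \<in> cspace N"
  have m: "max \<rho> (cnorm N z) > 0" using \<rho> by simp
  have "cnorm N (radial N \<rho> z) = \<rho> * cnorm N z / max \<rho> (cnorm N z)"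
    unfolding radial_def cnorm_scale using \<rho> m by (simp add: norm_divide)
  also have "\<dots> \<le> \<rho>" unfolding pos_divide_le_eq[OF m] using \<rho> by (intro mult_left_mono) auto
  finally show ?thesis using z by (simp add: cspace_cball_def cspace_def radial_def)
qed

lemma radial_eq: "\<rho> > 0 \<Longrightarrow> cnorm N z \<le> \<rho> \<Longrightarrow> radial N \<rho> z = z"
  by (simp add: radial_def max_def)

lemma cdist_radial: "\<rho> > 0 \<Longrightarrow> cnorm N z \<le> \<rho> + \<delta> \<Longrightarrow> 0 \<le> \<delta> \<Longrightarrow> cdist N z (radial N \<rho> z) \<le> \<delta>"
proof (cases "cnorm N z \<le> \<rho>")
  case False
  assume a: "\<rho> > 0" "cnorm N z \<le> \<rho> + \<delta>"
  have n: "cnorm N z > \<rho>" using False by simp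
  have "cdist N z (radial N \<rho> z) = cnorm N (\<lambda>i. of_real (1 - \<rho> / cnorm N z) * z i)"
    using n by (intro cnorm_cong) (simp add: radial_def max_def algebra_simps)
  also have "\<dots> = \<bar>1 - \<rho> / cnorm N z\<bar> * cnorm N z" unfolding cnorm_scale by (simp only: norm_of_real)
  also have "\<bar>1 - \<rho> / cnorm N z\<bar> = 1 - \<rho> / cnorm N z" using n a by simp
  also have "(1 - \<rho> / cnorm N z) * cnorm N z = cnorm N z - \<rho>" using n a by (simp add: left_diff_distrib)
  finally show ?thesis using a by simp
qed (simp add: radial_eq)

lemma continuous_on_radial:
  assumes "\<rho> > 0" "continuous_on S f" shows "continuous_on S (\<lambda>x. radial N \<rho> (f x))"
  unfolding radial_def
proof (rule continuous_on_coordinatewise_then_product)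
  fix i
  have c: "continuous_on S (\<lambda>x. f x j)" for j by (rule continuous_on_product_then_coordinatewise[OF assms(2)])
  have "max \<rho> (cnorm N (f x)) \<noteq> 0" for x using assms(1) by (simp add: max_def)
  then show "continuous_on S (\<lambda>x. of_real (\<rho> / max \<rho> (cnorm N (f x))) * f x i)"
    by (intro continuous_intros continuous_on_cnorm c) auto
qed

lemma cnorm_Suc_le: "cnorm (Suc N) z \<le> cmod (z 0) + cnorm N (\<lambda>i. z (Suc i))"
proof -
  have "cnorm (Suc N) z = sqrt ((cmod (z 0))\<^sup>2 + (cnorm N (\<lambda>i. z (Suc i)))\<^sup>2)"
    by (simp add: cnorm_def L2_set_def sum.lessThan_Suc_shift sum_nonneg del: sum.lessThan_Suc)
  also have "\<dots> \<le> cmod (z 0) + cnorm N (\<lambda>i. z (Suc i))" by (rule sqrt_sum_squares_le_sum) auto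
  finally show ?thesis .
qed

text \<open>A Lebesgue number argument in product form: \<open>u\<close> is close to the point of
  the compact product obtained by replacing \<open>u 0\<close> by \<open>a\<close> and retracting
  the other coordinates radially.\<close>

lemma cspace_tube:
  assumes D: "compact D" and r: "r > 0" and W: "openin (top_of_set (cspace (Suc N))) W"
    and sub: "cprod D (cspace_cball N r) \<subseteq> W"
  shows "\<exists>\<delta>>0. \<forall>u. (\<exists>a\<in>D. cmod (u 0 - a) \<le> \<delta>) \<and> (\<lambda>i. u (Suc i)) \<in> cspace_cball N (r + \<delta>) \<longrightarrow> u \<in> W"
proof -
  let ?K = "cprod D (cspace_cball N r)"
  have K: "compact ?K" by (intro compact_cprod D compact_cspace_cball)
  have "\<exists>\<delta>>0. \<forall>w\<in>cspace (Suc N). cdist (Suc N) w k < \<delta> \<longrightarrow> w \<in> W" if "k \<in> ?K" for k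
    using W sub that unfolding openin_cspace_iff by blast
  then obtain d where d: "\<And>k. k \<in> ?K \<Longrightarrow> d k > 0"
    "\<And>k w. k \<in> ?K \<Longrightarrow> w \<in> cspace (Suc N) \<Longrightarrow> cdist (Suc N) w k < d k \<Longrightarrow> w \<in> W" by metis
  obtain I where I: "I \<subseteq> ?K" "finite I" "?K \<subseteq> (\<Union>k\<in>I. {w. cdist (Suc N) w k < d k / 2})"
  proof (rule compactE_image[OF K, of ?K "\<lambda>k. {w. cdist (Suc N) w k < d k / 2}"])
    show "open {w. cdist (Suc N) w k < d k / 2}" if "k \<in> ?K" for k by (rule open_cdist_ball)
    show "?K \<subseteq> (\<Union>k\<in>?K. {w. cdist (Suc N) w k < d k / 2})" using d(1) by auto
  qed blast
  \<comment> \<open>The distance from \<open>u\<close> to a suitable centre \<open>k\<close> is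
    below \<open>2 * \<delta> + d k / 2\<close>, so a fifth of \<open>d k\<close> suffices.\<close>
  define \<delta> where "\<delta> = Min (insert 1 ((\<lambda>k. d k / 5) ` I))"
  have \<delta>: "\<delta> \<le> d k / 5" if "k \<in> I" for k using I(2) that unfolding \<delta>_def by (intro Min_le) auto
  have \<delta>0: "\<delta> > 0" unfolding \<delta>_def using I d(1) by (subst Min_gr_iff) auto
  have "u \<in> W" if u: "a \<in> D" "cmod (u 0 - a) \<le> \<delta>" "(\<lambda>i. u (Suc i)) \<in> cspace_cball N (r + \<delta>)" for u a
  proof -
    let ?u = "\<lambda>i. u (Suc i)"
    define k where "k = case_nat a (radial N r ?u)"
    have uc: "?u \<in> cspace N" "cnorm N ?u \<le> r + \<delta>" using u(3) by (auto simp: cspace_cball_def)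
    have kK: "k \<in> ?K" using u(1) radial_in_cball[OF r uc(1)] by (simp add: k_def cprod_def)
    have us: "u \<in> cspace (Suc N)"
      using u uc cprod_subset_cspace[of "cspace N" N UNIV] by (auto simp: cprod_def)
    have "cdist (Suc N) u k \<le> cmod (u 0 - a) + cdist N ?u (radial N r ?u)"
      using cnorm_Suc_le[of N "\<lambda>j. u j - k j"] by (simp add: k_def)
    also have "\<dots> \<le> \<delta> + \<delta>" using \<delta>0 by (intro add_mono u cdist_radial r uc) auto
    finally have uk: "cdist (Suc N) u k \<le> 2 * \<delta>" by simp
    obtain k' where k': "k' \<in> I" "cdist (Suc N) k k' < d k' / 2" using I(3) kK by blast
    have "cdist (Suc N) u k' \<le> cdist (Suc N) u k + cdist (Suc N) k k'" by (rule cdist_triangle)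
    also have "\<dots> < d k'" using uk k'(2) \<delta>[OF k'(1)] d(1)[of k'] I(1) k'(1) by force
    finally show ?thesis using d(2)[of k' u] I(1) k'(1) us by blast
  qed
  then show ?thesis using \<delta>0 by (intro exI[of _ \<delta>]) blast
qed

section \<open>Continuous extension of local liftings and the approximation argument for Oka
  maps\<close>

lemma holomorphic_map_on_cong:
  assumes M: "complex_manifold M" and N: "complex_manifold N"
    and f: "holomorphic_map_on M W N f" and eq: "\<And>x. x \<in> W \<Longrightarrow> f x = g x"
  shows "holomorphic_map_on M W N g"
  unfolding holomorphic_map_on_iff[OF N]
proof (intro conjI ballI)
  note f' = f[unfolded holomorphic_map_on_iff[OF N]]
  show W: "openin (mtop M) W" using f' by blast
  show "continuous_map (subtopology (mtop M) W) (mtop N) g"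
    using f' eq by (auto intro: continuous_map_eq)
  fix x assume x: "x \<in> W"
  show "holomorphic_at M N g x" unfolding holomorphic_at_def
  proof clarify
    fix n U \<phi> m V \<psi> i
    assume c: "(n, U, \<phi>) \<in> charts M" "x \<in> U" "(m, V, \<psi>) \<in> charts N" "g x \<in> V" "i < m"
    obtain \<delta> where \<delta>: "\<delta> > 0" "\<forall>w\<in>cspace n. cdist n w (\<phi> x) < \<delta> \<longrightarrow> w \<in> \<phi> ` U \<and> inv_into U \<phi> w \<in> W"
      using chart_nbhd[OF M c(1) W x c(2)] by blast
    have px: "\<phi> x \<in> cspace n" using manifold_chart(5)[OF M c(1)] c(2) by blast
    have "complex_differentiable_at n (\<lambda>z. \<psi> (f (inv_into U \<phi> z)) i) (\<phi> x)"
      using f' x c eq[OF x] unfolding holomorphic_at_def by fastforce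
    then show "complex_differentiable_at n (\<lambda>z. \<psi> (g (inv_into U \<phi> z)) i) (\<phi> x)"
      by (rule complex_differentiable_cong[OF _ px \<delta>(1)]) (use \<delta>(2) eq in auto)
  qed
qed

lemma holomorphic_map_on_cspace_continuous:
  assumes "holomorphic_map_on (cspace_manifold n) W N f"
  shows "openin (top_of_set (cspace n)) W" "W \<subseteq> cspace n" "continuous_map (top_of_set W) (mtop N) f"
proof -
  show 1: "openin (top_of_set (cspace n)) W" using assms unfolding holomorphic_map_on_def by simp
  show 2: "W \<subseteq> cspace n" using openin_subset[OF 1] by simp
  show "continuous_map (top_of_set W) (mtop N) f"
    using assms 2 unfolding holomorphic_map_on_def by (simp add: subtopology_subtopology Int_absorb1)
qed

text \<open>
  With \<open>\<Gamma>\<close> from \<open>disc_deformation\<close>, the homotopy \<open>G (\<Gamma> u t, \<dots>)\<close> is lifted on a box, and the lifting is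
  evaluated at a time that vanishes near \<open>D\<close> and is 1 away from \<open>D\<close>. In between the homotopy is
  constant, so the time does not matter for the projection.
\<close>

lemma continuous_lift_extension:
  fixes h :: "'x \<Rightarrow> 'y"
  assumes serre: "serre_fibration TX TY h" and D: "closed_disc D" "closed_disc D'" "D \<subseteq> D'" and r: "r > 0"
    and W': "openin (top_of_set (cspace (Suc N))) W'" "cprod D' (cspace_cball N r) \<subseteq> W'"
    and G: "continuous_map (top_of_set W') TY G"
    and W1: "openin (top_of_set (cspace (Suc N))) W1" "cprod D (cspace_cball N r) \<subseteq> W1"
    and F: "continuous_map (top_of_set W1) TX F"
    and hF: "\<And>u. u \<in> W1 \<Longrightarrow> h (F u) = G u"
  obtains U \<rho> f0 W2 where "open U" "D' \<subseteq> U" "\<rho> > r" "cprod U (cspace_ball N \<rho>) \<subseteq> W'"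
    "continuous_map (top_of_set (cprod U (cspace_ball N \<rho>))) TX f0"
    "\<forall>s \<in> cprod U (cspace_ball N \<rho>). h (f0 s) = G s"
    "openin (top_of_set (cspace (Suc N))) W2" "cprod D (cspace_cball N r) \<subseteq> W2"
    "W2 \<subseteq> cprod U (cspace_ball N \<rho>)" "W2 \<subseteq> W1" "\<forall>s \<in> W2. f0 s = F s"
proof -
  note Dc = closed_disc_compact[OF D(1)] and D'c = closed_disc_compact[OF D(2)]
  have D'ne: "D' \<noteq> {}" and Dne: "D \<noteq> {}" using D closed_disc_nonempty by auto
  obtain \<delta>1 where \<delta>1: "\<delta>1 > 0" "\<forall>u. (\<exists>a\<in>D'. cmod (u 0 - a) \<le> \<delta>1) \<and> (\<lambda>i. u (Suc i)) \<in> cspace_cball N (r + \<delta>1) \<longrightarrow> u \<in> W'"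
    using cspace_tube[OF D'c r W'] by blast
  obtain \<delta>2 where \<delta>2: "\<delta>2 > 0" "\<forall>u. (\<exists>a\<in>D. cmod (u 0 - a) \<le> \<delta>2) \<and> (\<lambda>i. u (Suc i)) \<in> cspace_cball N (r + \<delta>2) \<longrightarrow> u \<in> W1"
    using cspace_tube[OF Dc r W1] by blast
  define \<delta> where "\<delta> = min \<delta>1 \<delta>2"
  have \<delta>: "\<delta> > 0" using \<delta>1 \<delta>2 by (simp add: \<delta>_def)
  define \<rho> where "\<rho> = r + \<delta>"
  have \<rho>: "\<rho> > r" "\<rho> > 0" using r \<delta> by (auto simp: \<rho>_def)
  have inW': "u \<in> W'" if "a \<in> D'" "cmod (u 0 - a) \<le> \<delta>" "(\<lambda>i. u (Suc i)) \<in> cspace_cball N \<rho>" for u a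
    using that \<delta>1(2) by (force simp: \<delta>_def \<rho>_def cspace_cball_def)
  have inW1: "u \<in> W1" if "a \<in> D" "cmod (u 0 - a) \<le> \<delta>" "(\<lambda>i. u (Suc i)) \<in> cspace_cball N \<rho>" for u a
    using that \<delta>2(2) by (force simp: \<delta>_def \<rho>_def cspace_cball_def)
  obtain \<Gamma> \<beta> where \<beta>: "\<beta> > 0" and \<Gamma>c: "continuous_on (UNIV \<times> {0..1}) (\<lambda>(u, t). \<Gamma> u (t::real))"
    and \<Gamma>D': "\<And>u t. t \<in> {0..1} \<Longrightarrow> \<exists>a\<in>D'. cmod (\<Gamma> u t - a) \<le> \<delta>"
    and \<Gamma>D: "\<And>u. \<exists>a\<in>D. cmod (\<Gamma> u 0 - a) \<le> \<delta>"
    and \<Gamma>fix: "\<And>u t. t \<in> {0..1} \<Longrightarrow> infdist u D < \<beta> \<Longrightarrow> \<Gamma> u t = u"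
    and \<Gamma>1: "\<And>u. infdist u D' < \<beta> \<Longrightarrow> \<Gamma> u 1 = u"
    by (rule disc_deformation[OF D \<delta>]) blast
  define U where "U = {u. infdist u D' < \<beta>}"
  have U: "open U" unfolding U_def by (intro open_Collect_less continuous_intros)
  have D'U: "D' \<subseteq> U" using \<beta> by (auto simp: U_def)
  obtain B where B: "\<forall>x\<in>D'. cmod x \<le> B" using compact_imp_bounded[OF D'c] bounded_iff by blast
  \<comment> \<open>The box must contain the product over \<open>U\<close>, whose first coordinate
    is bounded by \<open>|B| + \<beta>\<close> and whose other coordinates are bounded by
    \<open>\<rho>\<close>.\<close>
  define M where "M = \<bar>B\<bar> + \<beta> + \<rho>"
  have M: "M > 0" using \<beta> \<rho> by (simp add: M_def)
  let ?S = "cprod U (cspace_ball N \<rho>)" and ?C = "complex_box (Suc N) M" and ?I = "top_of_set {0..1::real}"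
  \<comment> \<open>\<open>\<Gamma>\<close> and \<open>radial\<close> squeeze the whole box into
    \<open>W'\<close>, so that \<open>G\<close> can be composed on a full cube; at time zero they
    squeeze it into \<open>W1\<close>, where the lifting \<open>F\<close> is given.\<close>
  define E where "E = (\<lambda>q t. case_nat (\<Gamma> (q 0) t) (radial N \<rho> (\<lambda>i. q (Suc i))) :: nat \<Rightarrow> complex)"
  have Cc: "?C \<subseteq> cspace (Suc N)" by (auto simp: complex_box_def)
  have rad: "radial N \<rho> (\<lambda>i. q (Suc i)) \<in> cspace_cball N \<rho>" if "q \<in> ?C" for q
    using that Cc by (intro radial_in_cball \<rho> shift_in_cspace) auto
  have EW': "E q t \<in> W'" if q: "q \<in> ?C" and t: "t \<in> {0..1}" for q t
  proof -
    obtain a where "a \<in> D'" "cmod (\<Gamma> (q 0) t - a) \<le> \<delta>" using \<Gamma>D'[OF t] by blast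
    then show ?thesis using rad[OF q] by (intro inW'[of a]) (simp_all add: E_def)
  qed
  have E0: "E q 0 \<in> W1" if "q \<in> ?C" for q
  proof -
    obtain a where "a \<in> D" "cmod (\<Gamma> (q 0) 0 - a) \<le> \<delta>" using \<Gamma>D by blast
    then show ?thesis using rad[OF that] by (intro inW1[of a]) (simp_all add: E_def)
  qed
  have q0: "continuous_on A (\<lambda>p. fst p i)" for A :: "((nat \<Rightarrow> complex) \<times> real) set" and i
    by (rule continuous_on_product_then_coordinatewise[OF continuous_on_fst[OF continuous_on_id]])
  have Ec: "continuous_on (?C \<times> {0..1::real}) (\<lambda>p. E (fst p) (snd p))"
    unfolding E_def
  proof (rule continuous_on_case_nat)
    have "continuous_on (?C \<times> {0..1::real}) (\<lambda>p. (fst p 0, snd p))"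
      by (rule continuous_on_Pair[OF q0 continuous_on_snd[OF continuous_on_id]])
    note c = continuous_on_compose2[OF \<Gamma>c this]
    have "continuous_on (?C \<times> {0..1::real}) (\<lambda>p. case (fst p 0, snd p) of (u, t) \<Rightarrow> \<Gamma> u t)"
      by (rule c) auto
    then show "continuous_on (?C \<times> {0..1::real}) (\<lambda>p. \<Gamma> (fst p 0) (snd p))" by simp
    show "continuous_on (?C \<times> {0..1::real}) (\<lambda>p. radial N \<rho> (\<lambda>i. fst p (Suc i)))"
      by (intro continuous_on_radial \<rho> continuous_on_coordinatewise_then_product q0)
  qed
  have E0c: "continuous_on ?C (\<lambda>q. E q 0)"
  proof -
    have "continuous_on ?C (\<lambda>q. (q, 0::real))" by (intro continuous_intros)
    note c = continuous_on_compose2[OF Ec this]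
    have "continuous_on ?C (\<lambda>q. E (fst (q, 0::real)) (snd (q, 0::real)))" by (rule c) auto
    then show ?thesis by simp
  qed
  define H where "H = (\<lambda>(q, t). G (E q t))"
  have Hc: "continuous_map (prod_topology (top_of_set ?C) ?I) TY H"
  proof -
    have "continuous_map (prod_topology (top_of_set ?C) ?I) (top_of_set W') (\<lambda>p. E (fst p) (snd p))"
      using Ec EW' by (auto simp: continuous_map_subtopology_eu)
    from continuous_map_compose[OF this G] show ?thesis by (simp add: H_def o_def case_prod_unfold)
  qed
  have fc: "continuous_map (top_of_set ?C) TX (\<lambda>q. F (E q 0))"
  proof -
    have "continuous_map (top_of_set ?C) (top_of_set W1) (\<lambda>q. E q 0)"
      using E0c E0 by (auto simp: continuous_map_subtopology_eu)
    from continuous_map_compose[OF this F] show ?thesis by (simp add: o_def)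
  qed
  have "\<exists>L. continuous_map (prod_topology (top_of_set ?C) ?I) TX L \<and>
     (\<forall>z\<in>?C. L (z, 0) = F (E z 0)) \<and> (\<forall>z\<in>?C. \<forall>t\<in>{0..1}. h (L (z, t)) = H (z, t))"
    by (rule serre_lift_complex_box[OF serre M Hc fc]) (simp add: H_def hF E0)
  then obtain L where L: "continuous_map (prod_topology (top_of_set ?C) ?I) TX L"
     "\<forall>z\<in>?C. L (z, 0) = F (E z 0)" "\<forall>z\<in>?C. \<forall>t\<in>{0..1}. h (L (z, t)) = H (z, t)" by blast
  \<comment> \<open>\<open>cut\<close> is zero up to distance \<open>\<beta>/2\<close> from
    \<open>D\<close> and one from distance \<open>\<beta>\<close> on, so it changes only where
    \<open>\<Gamma>\<close> does not move points.\<close>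
  define cut where "cut = (\<lambda>c. max 0 (min 1 (2 * infdist c D / \<beta> - 1)))"
  have cut01: "cut c \<in> {0..1}" for c by (auto simp: cut_def)
  define f0 where "f0 = (\<lambda>s. L (s, cut (s 0)))"
  have SC: "s \<in> ?C" if s: "s \<in> ?S" for s
  proof -
    have sc: "s \<in> cspace (Suc N)" using s cprod_subset_cspace[OF cspace_ball_subset(1)] by blast
    have s0: "cmod (s 0) \<le> \<bar>B\<bar> + \<beta>"
    proof -
      obtain a where a: "a \<in> D'" "infdist (s 0) D' = dist (s 0) a"
        using infdist_attains_inf[OF compact_imp_closed[OF D'c] D'ne] by blast
      have "cmod (s 0) \<le> cmod a + dist (s 0) a" using norm_triangle_ineq[of a "s 0 - a"] by (simp add: dist_norm)
      then show ?thesis using B a s by (force simp: cprod_def U_def)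
    qed
    have "cmod (s i) \<le> M" if "i < Suc N" for i
    proof (cases i)
      case 0
      then show ?thesis using s0 \<rho> by (simp add: M_def)
    next
      case (Suc j)
      have "cnorm N (\<lambda>i. s (Suc i)) < \<rho>" using s by (simp add: cprod_def cspace_ball_def)
      then show ?thesis
        using component_le_cnorm[of j N "\<lambda>i. s (Suc i)"] that Suc \<beta> by (simp add: M_def)
    qed
    then have "\<bar>Re (s i)\<bar> \<le> M \<and> \<bar>Im (s i)\<bar> \<le> M" if "i < Suc N" for i
      using that abs_Re_le_cmod[of "s i"] abs_Im_le_cmod[of "s i"] by (meson order_trans)
    then show ?thesis using sc by (simp add: complex_box_def)
  qed
  have rads: "radial N \<rho> (\<lambda>i. s (Suc i)) = (\<lambda>i. s (Suc i))" if "s \<in> ?S" for s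
    using that \<rho> by (intro radial_eq) (auto simp: cprod_def cspace_ball_def)
  have cn: "case_nat (s 0) (\<lambda>i. s (Suc i)) = s" for s :: "nat \<Rightarrow> complex"
    by (auto simp: fun_eq_iff split: nat.split)
  have Enear: "E s t = s" if "s \<in> ?S" "infdist (s 0) D < \<beta>" "t \<in> {0..1}" for s t
    using \<Gamma>fix[OF that(3,2)] rads[OF that(1)] cn by (simp add: E_def)
  have E1: "E s 1 = s" if "s \<in> ?S" for s
    using \<Gamma>1[of "s 0"] rads[OF that] that cn by (simp add: E_def cprod_def U_def)
  have SW': "?S \<subseteq> W'" using EW' E1 SC by (metis atLeastAtMost_iff order_refl subsetI zero_le_one)
  \<comment> \<open>Here the time is zero and \<open>E s 0 = s\<close>, so the extension agrees with
    \<open>F\<close> on an open set and not only on the compact product. This lets the extension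
    inherit holomorphy there from \<open>F\<close>.\<close>
  define W2 where "W2 = cprod (U \<inter> {c. infdist c D < \<beta> / 2}) (cspace_ball N \<rho>)"
  show thesis
  proof (rule that[OF U D'U \<rho>(1) SW'])
    have "continuous_on ?S (\<lambda>s. (s, cut (s 0)))"
      unfolding cut_def using \<beta> by (intro continuous_intros continuous_on_coordinate) auto
    then have "continuous_map (top_of_set ?S) (prod_topology (top_of_set ?C) ?I) (\<lambda>s. (s, cut (s 0)))"
      using SC cut01 by (auto simp: continuous_map_subtopology_eu)
    from continuous_map_compose[OF this L(1)]
    show "continuous_map (top_of_set ?S) TX f0" by (simp add: f0_def o_def)
    show "\<forall>s\<in>?S. h (f0 s) = G s"
    proof
      fix s assume s: "s \<in> ?S"
      have "E s (cut (s 0)) = s"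
      proof (cases "infdist (s 0) D < \<beta>")
        case False
        then have "cut (s 0) = 1" using \<beta> by (simp add: cut_def field_simps)
        then show ?thesis using E1[OF s] by simp
      qed (use Enear[OF s _ cut01] in blast)
      then show "h (f0 s) = G s" using L(3) SC[OF s] cut01 by (simp add: f0_def H_def)
    qed
    have "open (U \<inter> {c. infdist c D < \<beta> / 2})"
      by (intro open_Int U open_Collect_less continuous_intros)
    then show "openin (top_of_set (cspace (Suc N))) W2"
      unfolding W2_def by (intro openin_cprod openin_cspace_ball)
    show "cprod D (cspace_cball N r) \<subseteq> W2"
      unfolding W2_def using D'U D(3) \<beta> by (intro cprod_mono cspace_cball_subset_ball \<rho>) auto
    show W2S: "W2 \<subseteq> ?S" unfolding W2_def by (intro cprod_mono) auto
    have W2near: "infdist (s 0) D < \<beta> / 2" if "s \<in> W2" for s using that by (simp add: W2_def cprod_def)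
    show "W2 \<subseteq> W1"
    proof
      fix s assume s: "s \<in> W2"
      then have "s \<in> ?S" using W2S by blast
      moreover have "E s 0 = s" using Enear[of s 0] W2near[OF s] \<beta> calculation by simp
      ultimately show "s \<in> W1" using E0[OF SC, of s] by simp
    qed
    show "\<forall>s\<in>W2. f0 s = F s"
    proof
      fix s assume s: "s \<in> W2"
      have sS: "s \<in> ?S" using W2S s by blast
      have "cut (s 0) = 0" using W2near[OF s] \<beta> by (simp add: cut_def field_simps)
      moreover have "E s 0 = s" using Enear[OF sS, of 0] W2near[OF s] \<beta> by simp
      ultimately show "f0 s = F s" using L(2) SC[OF sS] by (simp add: f0_def)
    qed
  qed
qed

lemma LSAP_at_oka:
  fixes X :: "'x charted_space" and Y :: "'y charted_space"
  assumes X: "complex_manifold X" and Y: "LSAP_manifold Y" and oka: "oka_map X Y h" and x: "x \<in> points X"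
  shows "LSAP_at X x"
proof -
  have Ym: "complex_manifold Y" using Y unfolding LSAP_manifold_def by blast
  have h: "holomorphic_map X Y h" and serre: "serre_fibration (mtop X) (mtop Y) h"
    and pop: "parametric_oka_property X Y h" using oka unfolding oka_map_def by blast+
  have hc: "continuous_map (mtop X) (mtop Y) h" using h unfolding holomorphic_map_on_def by simp
  have "h x \<in> points Y" using hc x unfolding continuous_map_def by blast
  then have "LSAP_at Y (h x)" using Y unfolding LSAP_manifold_def by blast
  obtain Q T where Q: "openin (prod_topology (mtop X) (mtop Y)) Q" "(x, h x) \<in> Q"
    and Tc: "continuous_map (subtopology (prod_topology (mtop X) (mtop Y)) Q) (mtop X) (\<lambda>(a, b). T a b)"
    and hT: "\<And>a b. (a, b) \<in> Q \<Longrightarrow> h (T a b) = b" and Th: "\<And>a. (a, h a) \<in> Q \<Longrightarrow> T a (h a) = a"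
    and Thol: "\<And>k W F G. holomorphic_map_on (cspace_manifold k) W X F \<Longrightarrow> holomorphic_map_on (cspace_manifold k) W Y G \<Longrightarrow>
      (\<And>u. u \<in> W \<Longrightarrow> (F u, G u) \<in> Q) \<Longrightarrow> holomorphic_map_on (cspace_manifold k) W X (\<lambda>u. T (F u) (G u))"
    by (rule submersion_local_lift[OF X Ym h x oka_surjective_differential[OF X Ym oka x]]) blast
  from \<open>LSAP_at Y (h x)\<close>[unfolded LSAP_at_def] obtain VY where VY: "openin (mtop Y) VY" "h x \<in> VY"
    and app: "\<forall>D D' N F. special_pair D D' \<and> holomorphic_spray D N (open_submanifold Y VY) F \<longrightarrow>
       (\<exists>r. 0 < r \<and> r < 1 \<and> (\<forall>d \<epsilon>. metric_of (mtop Y) d \<and> 0 < \<epsilon> \<longrightarrow>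
         (\<exists>G. holomorphic_near (cspace_manifold (Suc N)) (cprod D' (cspace_cball N r)) Y G \<and>
                      (\<forall>u \<in> cprod D (cspace_cball N r). d (F u) (G u) < \<epsilon>))))"
    by (elim exE conjE)
  \<comment> \<open>\<open>V\<close> secures two things: sprays in \<open>V\<close> project to
    sprays in \<open>VY\<close>, and \<open>T\<close> is defined near \<open>(a, h a)\<close> for
    each \<open>a\<close> in \<open>V\<close>.\<close>
  define V where "V = {a \<in> points X. h a \<in> VY} \<inter> {a \<in> points X. (a, h a) \<in> Q}"
  have gc: "continuous_map (mtop X) (prod_topology (mtop X) (mtop Y)) (\<lambda>a. (a, h a))"
    using hc by (auto simp: continuous_map_pairwise o_def)
  have V: "openin (mtop X) V" unfolding V_def
    using openin_continuous_map_preimage[OF hc VY(1)] openin_continuous_map_preimage[OF gc Q(1)] by blast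
  have xV: "x \<in> V" using x VY Q by (simp add: V_def)
  show ?thesis unfolding LSAP_at_def
  proof (intro exI[of _ V] conjI allI impI V xV)
    fix D D' N F assume a: "special_pair D D' \<and> holomorphic_spray D N (open_submanifold X V) F"
    then obtain \<Omega> where \<Omega>: "open \<Omega>" "D \<subseteq> \<Omega>"
      and F: "holomorphic_map_on (cspace_manifold (Suc N)) (cprod \<Omega> (cspace_ball N 1)) (open_submanifold X V) F"
      unfolding holomorphic_spray_def by blast
    have D: "closed_disc D" "closed_disc D'" "D \<subseteq> D'" using a unfolding special_pair_def by blast+
    define W where "W = cprod \<Omega> (cspace_ball N 1)"
    have FX: "holomorphic_map_on (cspace_manifold (Suc N)) W X F" and FV: "F ` W \<subseteq> V"
      using F unfolding W_def holomorphic_map_on_open_submanifold_iff[OF X V] by blast+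
    note Fc = holomorphic_map_on_cspace_continuous[OF FX]
    have hFY: "holomorphic_map_on (cspace_manifold (Suc N)) W Y (\<lambda>u. h (F u))"
      using FV V_def by (intro holomorphic_map_on_compose[OF complex_manifold_cspace X Ym FX h]) blast
    have "(\<lambda>u. h (F u)) ` W \<subseteq> VY" using FV by (auto simp: V_def)
    then have "holomorphic_spray D N (open_submanifold Y VY) (\<lambda>u. h (F u))"
      unfolding holomorphic_spray_def holomorphic_map_on_open_submanifold_iff[OF Ym VY(1)]
      using \<Omega> hFY by (intro exI[of _ \<Omega>]) (simp add: W_def)
    with app[rule_format, of D D' N "\<lambda>u. h (F u)"] a
    obtain r where r: "0 < r" "r < 1" and appr: "\<forall>d \<epsilon>. metric_of (mtop Y) d \<and> 0 < \<epsilon> \<longrightarrow>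
         (\<exists>G. holomorphic_near (cspace_manifold (Suc N)) (cprod D' (cspace_cball N r)) Y G \<and>
                      (\<forall>u \<in> cprod D (cspace_cball N r). d (h (F u)) (G u) < \<epsilon>))"
      by blast
    \<comment> \<open>The radius found for \<open>h \<circ> F\<close> precedes the choice of metric
      and error. It need not shrink, because the Oka property is applied over a slightly larger open
      ball, of radius \<open>\<rho> > r\<close>.\<close>
    show "\<exists>r. 0 < r \<and> r < 1 \<and> (\<forall>d \<epsilon>. metric_of (mtop X) d \<and> 0 < \<epsilon> \<longrightarrow>
         (\<exists>G. holomorphic_near (cspace_manifold (Suc N)) (cprod D' (cspace_cball N r)) X G \<and>
                      (\<forall>u \<in> cprod D (cspace_cball N r). d (F u) (G u) < \<epsilon>)))"
    proof (intro exI[of _ r] conjI r allI impI)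
      fix d and \<epsilon> :: real assume "metric_of (mtop X) d \<and> 0 < \<epsilon>"
      then have d: "metric_of (mtop X) d" and \<epsilon>: "0 < \<epsilon>" by blast+
      obtain dY where dY: "metric_of (mtop Y) dY" using complex_manifold_metrizable[OF Ym] by blast
      interpret d: Metric_space "points X" d using d unfolding metric_of_def by blast
      define K where "K = cprod D (cspace_cball N r)"
      have KW: "K \<subseteq> W" unfolding K_def W_def
        by (intro cprod_mono \<Omega> cspace_cball_subset_ball r)
      have Kc: "compact K" unfolding K_def
        by (intro compact_cprod compact_cspace_cball closed_disc_compact D)
      have K: "compactin (top_of_set W) K" using KW Kc by (simp add: compactin_subtopology)
      let ?Z = "top_of_set W"
      let ?ZY = "prod_topology ?Z (mtop Y)"
      have hFc: "continuous_map ?Z (mtop Y) (\<lambda>u. h (F u))"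
        using holomorphic_map_on_cspace_continuous(3)[OF hFY] .
      have pairc: "continuous_map ?ZY (prod_topology (mtop X) (mtop Y)) (\<lambda>p. (F (fst p), snd p))"
        using continuous_map_compose[OF continuous_map_fst Fc(3)] continuous_map_snd[of ?Z "mtop Y"]
        by (auto simp: continuous_map_pairwise o_def)
      define P0 where "P0 = {p \<in> topspace ?ZY. (F (fst p), snd p) \<in> Q}"
      have P0: "openin ?ZY P0" unfolding P0_def by (rule openin_continuous_map_preimage[OF pairc Q(1)])
      have "continuous_map (subtopology ?ZY P0) (subtopology (prod_topology (mtop X) (mtop Y)) Q) (\<lambda>p. (F (fst p), snd p))"
        using pairc by (auto simp: continuous_map_in_subtopology P0_def intro: continuous_map_from_subtopology)
      from continuous_map_compose[OF this Tc]
      have TFc: "continuous_map (subtopology ?ZY P0) (mtop X) (\<lambda>p. T (F (fst p)) (snd p))" by (simp add: o_def)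
      have F1c: "continuous_map (subtopology ?ZY P0) (mtop X) (\<lambda>p. F (fst p))"
        using continuous_map_from_subtopology[OF continuous_map_compose[OF continuous_map_fst Fc(3)]] by (simp add: o_def)
      \<comment> \<open>Half of \<open>\<epsilon>\<close> is allowed for moving \<open>F\<close>
        into the fibres over \<open>G\<close>, the other half for the Oka approximation. The graph
        of \<open>h \<circ> F\<close> over \<open>K\<close> lies in \<open>P\<close> because
        \<open>T a (h a) = a\<close>.\<close>
      define P where "P = {p \<in> P0. d (F (fst p)) (T (F (fst p)) (snd p)) < \<epsilon> / 2}"
      have tP0: "topspace (subtopology ?ZY P0) = P0" using openin_subset[OF P0] by auto
      have "openin (subtopology ?ZY P0) P"
        using openin_continuous_map_preimage[OF continuous_map_metric_of[OF d F1c TFc], of "{..<\<epsilon>/2}"]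
        unfolding tP0 P_def by simp
      then have P: "openin ?ZY P" using P0 openin_trans_full by blast
      have KP: "(u, h (F u)) \<in> P" if "u \<in> K" for u
      proof -
        have u: "u \<in> W" using that KW by blast
        have FuV: "F u \<in> points X" "(F u, h (F u)) \<in> Q" using FV u by (auto simp: V_def)
        have "h (F u) \<in> points Y" using hc FuV(1) unfolding continuous_map_def by blast
        then show ?thesis using u FuV Th[OF FuV(2)] \<epsilon> by (simp add: P_def P0_def)
      qed
      obtain \<eta> where \<eta>: "\<eta> > 0" "\<forall>u\<in>K. \<forall>b\<in>points Y. dY (h (F u)) b < \<eta> \<longrightarrow> (u, b) \<in> P"
        using compact_graph_neighbourhood[OF K hFc P KP dY] by blast
      obtain G where G: "holomorphic_near (cspace_manifold (Suc N)) (cprod D' (cspace_cball N r)) Y G"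
        "\<forall>u \<in> K. dY (h (F u)) (G u) < \<eta>" using appr dY \<eta>(1) unfolding K_def by blast
      obtain W' where W': "cprod D' (cspace_cball N r) \<subseteq> W'" "holomorphic_map_on (cspace_manifold (Suc N)) W' Y G"
        using G(1) unfolding holomorphic_near_def by blast
      note Gc = holomorphic_map_on_cspace_continuous[OF W'(2)]
      have GW: "G u \<in> points Y" if "u \<in> W'" for u
        using Gc(3) that unfolding continuous_map_def by auto
      have KW': "K \<subseteq> W'" using W'(1) D(3) unfolding K_def by (auto simp: cprod_def)
      have GP: "(u, G u) \<in> P" if "u \<in> K" for u using \<eta>(2) G(2) GW KW' that by blast
      \<comment> \<open>The condition that holds on \<open>K\<close> persists on this open
        neighbourhood, where \<open>T (F u) (G u)\<close> is a holomorphic and exact lifting of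
        \<open>G\<close>.\<close>
      define W1 where "W1 = {u \<in> W \<inter> W'. (F u, G u) \<in> Q}"
      have WW': "openin (top_of_set (cspace (Suc N))) (W \<inter> W')" using Fc(1) Gc(1) by blast
      have FGc: "continuous_map (top_of_set (W \<inter> W')) (prod_topology (mtop X) (mtop Y)) (\<lambda>u. (F u, G u))"
        using continuous_map_from_subtopology_mono[OF Fc(3), of "W \<inter> W'"] continuous_map_from_subtopology_mono[OF Gc(3), of "W \<inter> W'"]
        by (auto simp: continuous_map_pairwise o_def)
      have "openin (top_of_set (W \<inter> W')) W1"
        using openin_continuous_map_preimage[OF FGc Q(1)] by (simp add: W1_def)
      then have W1: "openin (top_of_set (cspace (Suc N))) W1" using WW' openin_trans by blast
      define F1 where "F1 = (\<lambda>u. T (F u) (G u))"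
      have F1hol: "holomorphic_map_on (cspace_manifold (Suc N)) W1 X F1"
        unfolding F1_def
      proof (rule Thol)
        show "holomorphic_map_on (cspace_manifold (Suc N)) W1 X F"
          using W1 by (intro holomorphic_map_on_subset[OF X FX]) (auto simp: W1_def)
        show "holomorphic_map_on (cspace_manifold (Suc N)) W1 Y G"
          using W1 by (intro holomorphic_map_on_subset[OF Ym W'(2)]) (auto simp: W1_def)
      qed (simp add: W1_def)
      have KW1: "K \<subseteq> W1" using GP KW KW' by (auto simp: W1_def P_def P0_def)
      have hF1: "h (F1 u) = G u" if "u \<in> W1" for u using that hT by (simp add: W1_def F1_def)
      obtain U \<rho> f0 W2 where U: "open U" "D' \<subseteq> U" and \<rho>: "\<rho> > r" and SW': "cprod U (cspace_ball N \<rho>) \<subseteq> W'"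
        and f0c: "continuous_map (top_of_set (cprod U (cspace_ball N \<rho>))) (mtop X) f0"
        and hf0: "\<forall>s \<in> cprod U (cspace_ball N \<rho>). h (f0 s) = G s"
        and W2: "openin (top_of_set (cspace (Suc N))) W2" "K \<subseteq> W2" "W2 \<subseteq> cprod U (cspace_ball N \<rho>)" "W2 \<subseteq> W1"
        and f0F: "\<forall>s \<in> W2. f0 s = F1 s"
        by (rule continuous_lift_extension[OF serre D r(1) Gc(1) W'(1) Gc(3) W1 KW1[unfolded K_def]
            holomorphic_map_on_cspace_continuous(3)[OF F1hol] hF1, folded K_def]) blast
      let ?WS = "cprod U (cspace_ball N \<rho>)"
      have WS: "openin (top_of_set (cspace (Suc N))) ?WS" by (intro openin_cprod U openin_cspace_ball)
      define S where "S = cdomain (Suc N) ?WS"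
      note S = cdomain_simps[OF WS, folded S_def]
      have KS: "K \<subseteq> ?WS" using W2 by blast
      have "\<exists>f. holomorphic_map S X f \<and> (\<forall>s\<in>points S. h (f s) = G s) \<and>
        (\<forall>s\<in>points S. s \<in> {} \<longrightarrow> f s = f0 s) \<and> (\<forall>s\<in>K. d (f s) (f0 s) < \<epsilon> / 2)"
      proof (rule oka_lifting[OF X pop])
        show "stein_manifold S" unfolding S_def using \<rho> r by (intro stein_cprod U) auto
        show "compactin (mtop S) K" using Kc KS by (simp add: S compactin_subtopology)
        have "connected (- D)"
          using D(1) unfolding closed_disc_def
          by (rule connected_complement_homeomorphic_convex_compact) auto
        then show "holomorphic_hull S K = K" unfolding S_def K_def
          using U D r \<rho> by (intro holomorphic_hull_cprod closed_disc_compact) auto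
        show "complex_subvariety S {}" unfolding complex_subvariety_def by simp
        have "holomorphic_map_on (cspace_manifold (Suc N)) ?WS Y G"
          using WS SW' by (intro holomorphic_map_on_subset[OF Ym W'(2)]) auto
        then show "holomorphic_map S Y G"
          using holomorphic_map_on_cdomain[OF WS Ym order_refl] by (simp add: S S_def[symmetric])
        show "continuous_map (mtop S) (mtop X) f0" using f0c by (simp add: S)
        show "h (f0 s) = G s" if "s \<in> points S" for s using hf0 that by (simp add: S)
        \<comment> \<open>On the open set \<open>W2\<close> around \<open>K\<close> the continuous
          lifting \<open>f0\<close> agrees with the holomorphic \<open>F1\<close>; this is the
          holomorphy near \<open>K\<close> that the Oka property asks for.\<close>
        have "holomorphic_map_on (cspace_manifold (Suc N)) W2 X f0"
        proof (rule holomorphic_map_on_cong[OF complex_manifold_cspace X])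
          show "holomorphic_map_on (cspace_manifold (Suc N)) W2 X F1"
            using W2 by (intro holomorphic_map_on_subset[OF X F1hol]) auto
          show "F1 s = f0 s" if "s \<in> W2" for s using f0F that by simp
        qed
        then have "holomorphic_map_on S W2 X f0"
          using holomorphic_map_on_cdomain[OF WS X W2(3)] by (simp add: S_def[symmetric])
        then show "\<exists>W. K \<subseteq> W \<and> holomorphic_map_on S W X f0" using W2(2) by blast
        show "holomorphic_on_subvariety S {} X f0" unfolding holomorphic_on_subvariety_def by simp
        show "metric_of (mtop X) d" by fact
        show "0 < \<epsilon> / 2" using \<epsilon> by simp
      qed
      then obtain f where f: "holomorphic_map S X f" "\<forall>s\<in>K. d (f s) (f0 s) < \<epsilon> / 2" by blast
      have fhol: "holomorphic_map_on (cspace_manifold (Suc N)) ?WS X f"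
        using f(1) holomorphic_map_on_cdomain[OF WS X order_refl] by (simp add: S S_def[symmetric])
      have "cprod D' (cspace_cball N r) \<subseteq> ?WS" by (intro cprod_mono U cspace_cball_subset_ball \<rho>)
      then have "holomorphic_near (cspace_manifold (Suc N)) (cprod D' (cspace_cball N r)) X f"
        using fhol unfolding holomorphic_near_def by blast
      moreover have "d (F u) (f u) < \<epsilon>" if u: "u \<in> K" for u
      proof -
        have pts: "F u \<in> points X" "F1 u \<in> points X" "f u \<in> points X"
          using Fc(3) holomorphic_map_on_cspace_continuous(3)[OF F1hol] holomorphic_map_on_cspace_continuous(3)[OF fhol]
            u KW KW1 KS unfolding continuous_map_def by auto
        have "d (F u) (f u) \<le> d (F u) (F1 u) + d (F1 u) (f u)" by (rule d.triangle[OF pts])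
        moreover have "d (F u) (F1 u) < \<epsilon> / 2" using GP[OF u] by (simp add: P_def F1_def)
        moreover have "d (F1 u) (f u) < \<epsilon> / 2"
        proof -
          have "f0 u = F1 u" using f0F W2(2) u by blast
          then show ?thesis using f(2) u by (metis d.commute)
        qed
        ultimately show ?thesis by linarith
      qed
      ultimately show "\<exists>G. holomorphic_near (cspace_manifold (Suc N)) (cprod D' (cspace_cball N r)) X G \<and>
                      (\<forall>u \<in> cprod D (cspace_cball N r). d (F u) (G u) < \<epsilon>)"
        unfolding K_def by blast
    qed
  qed
qed

theorem proposition5p5:
  fixes X :: "'x charted_space" and Y :: "'y charted_space"
  assumes "complex_manifold X" and "complex_manifold Y"
  shows
    "(strongly_dominable_by_LSAP TYPE('w) X \<longrightarrow> LSAP_manifold X) \<and>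
     (\<forall>(Z :: 'z charted_space) \<pi>.
        LSAP_manifold Z \<and> holomorphic_submersion Z X \<pi> \<and> \<pi> ` points Z = points X
          \<longrightarrow> LSAP_manifold X) \<and>
     (\<forall>h. oka_map X Y h \<and> h ` points X = points Y \<and> LSAP_manifold Y \<longrightarrow> LSAP_manifold X) \<and>
     (\<forall>\<U>. (\<forall>U \<in> \<U>. openin (mtop X) U \<and> LSAP_manifold (open_submanifold X U)) \<and>
           \<Union>\<U> = points X \<longrightarrow> LSAP_manifold X)"
proof (intro conjI allI impI)
  note X = assms(1)
  show "LSAP_manifold X" if dom: "strongly_dominable_by_LSAP TYPE('w) X"
  proof -
    have "LSAP_at X x" if "x \<in> points X" for x
    proof -
      obtain Z :: "'w charted_space" and h z where "LSAP_manifold Z" "holomorphic_map Z X h" "z \<in> points Z" "h z = x"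
        "surjective_differential_at Z X h z"
        using bspec[OF dom[unfolded strongly_dominable_by_LSAP_def] \<open>x \<in> points X\<close>] by (elim exE conjE)
      then show ?thesis by (rule LSAP_at_dominated[OF X])
    qed
    then show ?thesis using X unfolding LSAP_manifold_def by blast
  qed
  show "LSAP_manifold X"
    if sub: "LSAP_manifold Z \<and> holomorphic_submersion Z X \<pi> \<and> \<pi> ` points Z = points X" for Z :: "'z charted_space" and \<pi>
  proof -
    have Z: "LSAP_manifold Z" and \<pi>: "holomorphic_map Z X \<pi>"
      and sd: "\<And>z. z \<in> points Z \<Longrightarrow> surjective_differential_at Z X \<pi> z"
      using sub unfolding holomorphic_submersion_def by blast+
    have "LSAP_at X x" if x: "x \<in> points X" for x
    proof -
      have "x \<in> \<pi> ` points Z" using x sub by simp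
      then obtain z where z: "z \<in> points Z" "\<pi> z = x" by blast
      show ?thesis by (rule LSAP_at_dominated[OF X Z \<pi> z sd[OF z(1)]])
    qed
    then show ?thesis using X unfolding LSAP_manifold_def by blast
  qed
  show "LSAP_manifold X" if "oka_map X Y h \<and> h ` points X = points Y \<and> LSAP_manifold Y" for h
    using that X LSAP_at_oka[OF X] unfolding LSAP_manifold_def[of X] by blast
  show "LSAP_manifold X"
    if cover: "(\<forall>U \<in> \<U>. openin (mtop X) U \<and> LSAP_manifold (open_submanifold X U)) \<and> \<Union>\<U> = points X" for \<U>
  proof -
    have "LSAP_at X x" if x: "x \<in> points X" for x
    proof -
      obtain U where U: "U \<in> \<U>" "x \<in> U" using x cover by blast
      then have o: "openin (mtop X) U" and L: "LSAP_manifold (open_submanifold X U)" using cover by blast+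
      have "x \<in> points (open_submanifold X U)" using U x by (simp add: open_submanifold_simps)
      then show ?thesis using L LSAP_at_open_submanifold[OF X o] unfolding LSAP_manifold_def by blast
    qed
    then show ?thesis using X unfolding LSAP_manifold_def by blast
  qed
qed

end
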